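(* Let $p$ be a prime number, let $k$ be a number field of finite degree over $\mathbb{Q}$, and let $K/k$ be a pro-$p$-extension (a Galois extension whose Galois group is a pro-$p$-group) such that $\mathrm{Gal}(K/k)$ is (topologically) finitely generated. For a number field $F$ let $A(F)$ denote the non-$p$-part of the ideal class group of $F$. Then, for any sequence $$k_0\subseteq k_1\subseteq k_2\subseteq\cdots\subseteq k_i\subseteq k_{i+1}\subseteq\cdots$$ of intermediate fields of $K/k$ such that $\bigcup_{i\ge 0}k_i=K$ and each $k_i/k$ is a finite normal extension, the $p$-adic limit $\lim_{n\to\infty}\#A(k_n)$ exists (in $\mathbb{Z}_p$). Furthermore, this limit does not depend on the choice of the sequence $\{k_i\}$.
   Context: The non-$p$-part of a finite abelian group is its subgroup of elements of order prime to $p$. "$p$-adic limit" means limit in $\mathbb{Z}_p$ with respect to the $p$-adic topology. *)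

theory Defs
  imports
    "HOL-Algebra.Algebraic_Closure_Type"
    "HOL-Algebra.Finite_Extensions"
    "HOL-Algebra.Multiplicative_Group"
    "HOL-Algebra.Generated_Groups"
    "HOL-Algebra.Bij"
    "HOL-Analysis.Analysis"
begin

text \<open>
  All fields are subfields of one ambient field of characteristic 0, given by a type of class
  \<^class>\<open>field_char_0\<close>.  The notions for subfields (degree, polynomials, homomorphisms) are those of
  HOL-Algebra, applied to the ambient field regarded as a ring record.
\<close>

abbreviation ambient :: "'a :: field_char_0 ring" where
  "ambient \<equiv> ring_of_type_algebra"

definition field_extension :: "'a :: field_char_0 set \<Rightarrow> 'a set \<Rightarrow> bool" where
  "field_extension F E \<longleftrightarrow> subfield F ambient \<and> subfield E ambient \<and> F \<subseteq> E"

definition finite_field_extension :: "'a :: field_char_0 set \<Rightarrow> 'a set \<Rightarrow> bool" where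
  "finite_field_extension F E \<longleftrightarrow> field_extension F E \<and> ring.finite_dimension ambient F E"

definition algebraic_extension :: "'a :: field_char_0 set \<Rightarrow> 'a set \<Rightarrow> bool" where
  "algebraic_extension F E \<longleftrightarrow>
     field_extension F E \<and> (\<forall>x\<in>E. (ring.algebraic ambient over F) x)"

text \<open>
  In the ring \<open>ambient\<lparr>carrier := E\<rparr>\<close>, \<^const>\<open>ring.splitted\<close> means that the number of roots in \<open>E\<close>,
  counted with multiplicity, is the degree.
\<close>

definition normal_extension :: "'a :: field_char_0 set \<Rightarrow> 'a set \<Rightarrow> bool" where
  "normal_extension F E \<longleftrightarrow> algebraic_extension F E \<and>
     (\<forall>f \<in> carrier (F[X]\<^bsub>ambient\<^esub>).
        pirreducible\<^bsub>ambient\<^esub> F f \<and> (\<exists>x\<in>E. ring.eval ambient f x = 0) \<longrightarrow>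
        ring.splitted (ambient\<lparr>carrier := E\<rparr>) f)"

text \<open>Automorphisms of \<open>E\<close> are normalised to be \<^const>\<open>undefined\<close> outside \<open>E\<close>, as in \<^const>\<open>Bij\<close>.\<close>

definition galois_group :: "'a :: field_char_0 set \<Rightarrow> 'a set \<Rightarrow> ('a \<Rightarrow> 'a) monoid" where
  "galois_group F E = (BijGroup E)\<lparr>carrier :=
     {\<sigma> \<in> Bij E. \<sigma> \<in> ring_hom (ambient\<lparr>carrier := E\<rparr>) (ambient\<lparr>carrier := E\<rparr>) \<and>
                 (\<forall>x\<in>F. \<sigma> x = x)}\<rparr>"

text \<open>
  This covers infinite extensions; for algebraic extensions the fixed-field condition is normality
  together with separability.
\<close>

definition galois_extension :: "'a :: field_char_0 set \<Rightarrow> 'a set \<Rightarrow> bool" where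
  "galois_extension F E \<longleftrightarrow> algebraic_extension F E \<and>
     {x \<in> E. \<forall>\<sigma> \<in> carrier (galois_group F E). \<sigma> x = x} = F"

definition krull_topology :: "'a :: field_char_0 set \<Rightarrow> 'a set \<Rightarrow> ('a \<Rightarrow> 'a) topology" where
  "krull_topology F E = topology_generated_by
     {\<sigma> <#\<^bsub>galois_group F E\<^esub> carrier (galois_group M E) | \<sigma> M.
        \<sigma> \<in> carrier (galois_group F E) \<and> finite_field_extension F M \<and> field_extension M E}"

definition topological_group :: "('g, 'b) monoid_scheme \<Rightarrow> 'g topology \<Rightarrow> bool" where
  "topological_group G T \<longleftrightarrow> group G \<and> topspace T = carrier G \<and>
     continuous_map (prod_topology T T) T (\<lambda>(x, y). x \<otimes>\<^bsub>G\<^esub> y) \<and>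
     continuous_map T T (\<lambda>x. inv\<^bsub>G\<^esub> x)"

definition profinite_group :: "('g, 'b) monoid_scheme \<Rightarrow> 'g topology \<Rightarrow> bool" where
  "profinite_group G T \<longleftrightarrow> topological_group G T \<and> compact_space T \<and> Hausdorff_space T \<and>
     (\<forall>C. connectedin T C \<longrightarrow> (\<exists>x. C \<subseteq> {x}))"

definition pro_p_group :: "nat \<Rightarrow> ('g, 'b) monoid_scheme \<Rightarrow> 'g topology \<Rightarrow> bool" where
  "pro_p_group p G T \<longleftrightarrow> profinite_group G T \<and>
     (\<forall>N. N \<lhd> G \<and> openin T N \<longrightarrow> (\<exists>n. card (carrier (G Mod N)) = p ^ n))"

definition topologically_finitely_generated ::
    "('g, 'b) monoid_scheme \<Rightarrow> 'g topology \<Rightarrow> bool" where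
  "topologically_finitely_generated G T \<longleftrightarrow>
     (\<exists>S. finite S \<and> S \<subseteq> carrier G \<and> T closure_of (generate G S) = carrier G)"

definition pro_p_extension :: "nat \<Rightarrow> 'a :: field_char_0 set \<Rightarrow> 'a set \<Rightarrow> bool" where
  "pro_p_extension p F E \<longleftrightarrow>
     galois_extension F E \<and> pro_p_group p (galois_group F E) (krull_topology F E)"

definition number_field :: "'a :: field_char_0 set \<Rightarrow> bool" where
  "number_field F \<longleftrightarrow> finite_field_extension \<rat> F"

definition ring_of_integers :: "'a :: field_char_0 set \<Rightarrow> 'a set" where
  "ring_of_integers F = {x \<in> F. algebraic_int x}"

definition fractional_ideal :: "'a :: field_char_0 set \<Rightarrow> 'a set \<Rightarrow> bool" where
  "fractional_ideal F I \<longleftrightarrow> I \<subseteq> F \<and> 0 \<in> I \<and> I \<noteq> {0} \<and>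
     (\<forall>x\<in>I. \<forall>y\<in>I. x + y \<in> I) \<and>
     (\<forall>a\<in>ring_of_integers F. \<forall>x\<in>I. a * x \<in> I) \<and>
     (\<exists>d\<in>ring_of_integers F - {0}. \<forall>x\<in>I. d * x \<in> ring_of_integers F)"

definition ideal_product :: "'a :: field_char_0 set \<Rightarrow> 'a set \<Rightarrow> 'a set" where
  "ideal_product I J =
     {\<Sum>i<n. x i * y i | (n :: nat) x y. (\<forall>i<n. x i \<in> I) \<and> (\<forall>i<n. y i \<in> J)}"

definition fractional_ideal_group :: "'a :: field_char_0 set \<Rightarrow> 'a set monoid" where
  "fractional_ideal_group F =
     \<lparr>carrier = {I. fractional_ideal F I}, monoid.mult = ideal_product, one = ring_of_integers F\<rparr>"

definition principal_fractional_ideals :: "'a :: field_char_0 set \<Rightarrow> 'a set set" where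
  "principal_fractional_ideals F = {(\<lambda>x. a * x) ` ring_of_integers F | a. a \<in> F - {0}}"

definition ideal_class_group :: "'a :: field_char_0 set \<Rightarrow> 'a set set monoid" where
  "ideal_class_group F = fractional_ideal_group F Mod principal_fractional_ideals F"

definition non_p_part :: "nat \<Rightarrow> ('g, 'b) monoid_scheme \<Rightarrow> 'g set" where
  "non_p_part p G = {x \<in> carrier G. coprime (group.ord G x) p}"

text \<open>
  \<open>\<int>\<^sub>p\<close> is the inverse limit of the sets \<open>\<int>/p\<^sup>n\<int>\<close>, each represented by \<open>{0..<p\<^sup>n}\<close>.
  Its ring structure is not needed to speak about limits.
\<close>

definition padic_integers :: "nat \<Rightarrow> (nat \<Rightarrow> nat) set" where
  "padic_integers p = {x. \<forall>n. x n < p ^ n \<and> x (Suc n) mod p ^ n = x n}"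

definition padic_topology :: "nat \<Rightarrow> (nat \<Rightarrow> nat) topology" where
  "padic_topology p =
     subtopology (product_topology (\<lambda>n. discrete_topology {..<p ^ n}) UNIV) (padic_integers p)"

definition padic_of_nat :: "nat \<Rightarrow> nat \<Rightarrow> (nat \<Rightarrow> nat)" where
  "padic_of_nat p m = (\<lambda>n. m mod p ^ n)"

lemma topspace_padic_topology: "topspace (padic_topology p) = padic_integers p"
  by (auto simp: padic_topology_def padic_integers_def)

text \<open>Convergence is convergence with respect to the neighbourhoods \<open>L + p\<^sup>n\<int>\<^sub>p\<close>.\<close>

lemma limitin_padic_topology_iff:
  assumes "p > 0"
  shows "limitin (padic_topology p) (\<lambda>i. padic_of_nat p (a i)) L sequentially \<longleftrightarrow>
           L \<in> padic_integers p \<and> (\<forall>n. \<forall>\<^sub>F i in sequentially. a i mod p ^ n = L n)"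
proof -
  have in_Zp: "padic_of_nat p m \<in> padic_integers p" for m
    using assms by (auto simp: padic_of_nat_def padic_integers_def mod_mod_cancel)
  have discrete: "limitin (discrete_topology U) f l F \<longleftrightarrow> l \<in> U \<and> (\<forall>\<^sub>F i in F. f i = l)"
    for U and f :: "nat \<Rightarrow> nat" and l F
  proof
    assume *: "limitin (discrete_topology U) f l F"
    then have l: "l \<in> U"
      using limitin_topspace by fastforce
    have "\<forall>\<^sub>F i in F. f i \<in> {l}"
      using * l unfolding limitin_def by (metis empty_subsetI insert_subset openin_discrete_topology singletonI)
    then show "l \<in> U \<and> (\<forall>\<^sub>F i in F. f i = l)"
      using l by simp
  next
    assume *: "l \<in> U \<and> (\<forall>\<^sub>F i in F. f i = l)"
    then show "limitin (discrete_topology U) f l F"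
      unfolding limitin_def by (auto elim: eventually_mono)
  qed
  have "limitin (padic_topology p) (\<lambda>i. padic_of_nat p (a i)) L sequentially \<longleftrightarrow>
          L \<in> padic_integers p \<and> (\<forall>n. L n < p ^ n \<and> (\<forall>\<^sub>F i in sequentially. a i mod p ^ n = L n))"
    unfolding padic_topology_def limitin_subtopology limitin_componentwise discrete
    using in_Zp by (simp add: padic_of_nat_def assms PiE_UNIV_domain)
  then show ?thesis
    unfolding padic_integers_def by blast
qed

definition finite_normal_tower ::
    "'a :: field_char_0 set \<Rightarrow> 'a set \<Rightarrow> (nat \<Rightarrow> 'a set) \<Rightarrow> bool" where
  "finite_normal_tower k K ks \<longleftrightarrow>
     (\<forall>i. field_extension k (ks i) \<and> field_extension (ks i) K) \<and>
     (\<forall>i. ks i \<subseteq> ks (Suc i)) \<and> (\<Union>i. ks i) = K \<and>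
     (\<forall>i. finite_field_extension k (ks i) \<and> normal_extension k (ks i))"

end

theory Submission
  imports Defs "Jordan_Normal_Form.Schur_Decomposition" "HOL-Number_Theory.Cong" "HOL-Algebra.Group_Action"
begin

text \<open>
  Let \<open>F \<subseteq> L\<close> be finite subextensions of \<open>K/k\<close> that are normal over \<open>k\<close>.  The order of
  \<open>Gal(L/F)\<close> is a power of \<open>p\<close>, hence invertible on \<open>A(L)\<close>, so extension of ideals and the norm
  identify \<open>A(F)\<close> with the fixed points of \<open>Gal(L/F)\<close> in \<open>A(L)\<close>.  The group \<open>Gal(K/k)\<close> acts on
  \<open>A(L)\<close> with orbits of \<open>p\<close>-power size, and the orbits with fewer than \<open>p\<^sup>m\<close> elements have
  stabilizers of index less than \<open>p\<^sup>m\<close>.  Since \<open>Gal(K/k)\<close> is topologically finitely generated, it has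
  only finitely many such open subgroups, so all of them contain \<open>Gal(K/F)\<close> once \<open>F\<close> is far enough
  up the tower.  Then every orbit outside of \<open>A(F)\<close> has size divisible by \<open>p\<^sup>m\<close>, and
  \<open>#A(L) \<equiv> #A(F)\<close> modulo \<open>p\<^sup>m\<close>.
\<close>

section \<open>Finitely generated additive groups and algebraic integers\<close>

text \<open>Factorization into prime ideals is bypassed. Invertibility of fractional ideals comes
  from finiteness of the ideal classes: two powers of an ideal fall into one class, and the common
  power cancels by a determinant argument. So finiteness has to come first, and counting residues
  modulo an element replaces norms of ideals. The norm of an ideal from \<open>L\<close> to
  \<open>F\<close> is realised by polynomials: an ideal is the content of a polynomial, the product
  of the conjugate polynomials has coefficients in \<open>F\<close>, and Gauss's lemma identifies
  its content with the product of the conjugate ideals. Gauss's lemma rests on Dedekind's theorem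
  that products of coefficients of \<open>f\<close> and \<open>g\<close> are integral if the
  coefficients of \<open>f * g\<close> are. On the group side, an action on few points is determined
  by what finitely many generators do to the points. Density of the generated subgroup carries this
  over to the whole Galois group, since every stabilizer in question contains the fixer of a finite
  subextension.\<close>

definition additive_subgroup :: "'a::ab_group_add set \<Rightarrow> bool" where
  "additive_subgroup M \<longleftrightarrow> 0 \<in> M \<and> (\<forall>x\<in>M. \<forall>y\<in>M. x - y \<in> M)"

lemma additive_subgroupI:
  "0 \<in> M \<Longrightarrow> (\<And>x y. x \<in> M \<Longrightarrow> y \<in> M \<Longrightarrow> x - y \<in> M) \<Longrightarrow> additive_subgroup M"
  by (simp add: additive_subgroup_def)

lemma additive_subgroup_0: "additive_subgroup M \<Longrightarrow> 0 \<in> M"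
  and additive_subgroup_diff: "additive_subgroup M \<Longrightarrow> x \<in> M \<Longrightarrow> y \<in> M \<Longrightarrow> x - y \<in> M"
  by (auto simp: additive_subgroup_def)

lemma additive_subgroup_uminus: "additive_subgroup M \<Longrightarrow> x \<in> M \<Longrightarrow> - x \<in> M"
  using additive_subgroup_diff[of M 0 x] additive_subgroup_0 by auto

lemma additive_subgroup_add: "additive_subgroup M \<Longrightarrow> x \<in> M \<Longrightarrow> y \<in> M \<Longrightarrow> x + y \<in> M"
  using additive_subgroup_diff[of M x "- y"] additive_subgroup_uminus by auto

lemma additive_subgroup_sum:
  "additive_subgroup M \<Longrightarrow> (\<And>i. i \<in> A \<Longrightarrow> f i \<in> M) \<Longrightarrow> sum f A \<in> M"
  by (induction A rule: infinite_finite_induct)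
     (auto intro: additive_subgroup_0 additive_subgroup_add)

lemma additive_subgroup_of_nat_mult:
  "additive_subgroup M \<Longrightarrow> x \<in> M \<Longrightarrow> of_nat n * (x::'a::comm_ring_1) \<in> M"
  by (induction n) (auto simp: algebra_simps intro: additive_subgroup_0 additive_subgroup_add)

lemma additive_subgroup_of_int_mult:
  "additive_subgroup M \<Longrightarrow> x \<in> M \<Longrightarrow> of_int n * (x::'a::comm_ring_1) \<in> M"
  by (cases n) (auto simp: additive_subgroup_uminus additive_subgroup_of_nat_mult simp del: of_nat_Suc)

text \<open>The \<int>-module generated by \<open>S\<close>. The clauses mirror
  \<open>additive_subgroup\<close>, so that minimality is a direct induction.\<close>

inductive_set zspan :: "'a::ab_group_add set \<Rightarrow> 'a set" for S where
  zero: "0 \<in> zspan S"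
| base: "s \<in> S \<Longrightarrow> s \<in> zspan S"
| diff: "x \<in> zspan S \<Longrightarrow> y \<in> zspan S \<Longrightarrow> x - y \<in> zspan S"

lemma additive_subgroup_zspan: "additive_subgroup (zspan S)"
  by (auto simp: additive_subgroup_def intro: zspan.intros)

lemmas zspan_add = additive_subgroup_add[OF additive_subgroup_zspan]
lemmas zspan_uminus = additive_subgroup_uminus[OF additive_subgroup_zspan]
lemmas zspan_of_int_mult = additive_subgroup_of_int_mult[OF additive_subgroup_zspan]
lemmas zspan_sum = additive_subgroup_sum[OF additive_subgroup_zspan]

lemma zspan_minimal:
  assumes "additive_subgroup M" "S \<subseteq> M"
  shows "zspan S \<subseteq> M"
proof
  fix x assume "x \<in> zspan S" then show "x \<in> M"
    by induction (use assms in \<open>auto intro: additive_subgroup_0 additive_subgroup_diff\<close>)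
qed

lemma zspan_mono: "S \<subseteq> T \<Longrightarrow> zspan S \<subseteq> zspan T"
  by (intro zspan_minimal additive_subgroup_zspan) (auto intro: zspan.base)

lemma additive_subgroup_vimage_mult:
  "additive_subgroup M \<Longrightarrow> additive_subgroup {y. x * y \<in> M}" for x :: "'a::comm_ring_1"
  by (auto simp: additive_subgroup_def right_diff_distrib)

text \<open>One variable at a time: for a fixed factor, the elements whose product with it lies in
  \<open>M\<close> form a subgroup, which contains the span as soon as it contains the
  generators.\<close>

lemma zspan_mult_closed:
  fixes S :: "'a::comm_ring_1 set"
  assumes "\<And>s t. s \<in> S \<Longrightarrow> t \<in> T \<Longrightarrow> s * t \<in> M" "additive_subgroup M" "x \<in> zspan S" "y \<in> zspan T"
  shows "x * y \<in> M"
proof -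
  have 1: "s * y \<in> M" if "s \<in> S" for s
  proof -
    have "zspan T \<subseteq> {y. s * y \<in> M}"
      using assms that by (intro zspan_minimal additive_subgroup_vimage_mult) auto
    then show ?thesis using assms(4) by auto
  qed
  have "zspan S \<subseteq> {x. y * x \<in> M}"
    using 1 assms(2) by (intro zspan_minimal additive_subgroup_vimage_mult) (auto simp: mult.commute)
  then show ?thesis using assms(3) by (auto simp: mult.commute)
qed

lemma zspan_image_indexed:
  fixes w :: "nat \<Rightarrow> 'a::comm_ring_1"
  assumes "x \<in> zspan (w ` {..<n})"
  obtains c :: "nat \<Rightarrow> int" where "x = (\<Sum>i<n. of_int (c i) * w i)"
proof -
  have "additive_subgroup {x. \<exists>c::nat \<Rightarrow> int. x = (\<Sum>i<n. of_int (c i) * w i)}"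
  proof (rule additive_subgroupI)
    show "0 \<in> {x. \<exists>c::nat \<Rightarrow> int. x = (\<Sum>i<n. of_int (c i) * w i)}"
      by (auto intro!: exI[of _ "\<lambda>_. 0"])
    fix x y assume "x \<in> {x. \<exists>c::nat \<Rightarrow> int. x = (\<Sum>i<n. of_int (c i) * w i)}"
      "y \<in> {x. \<exists>c::nat \<Rightarrow> int. x = (\<Sum>i<n. of_int (c i) * w i)}"
    then obtain c d :: "nat \<Rightarrow> int"
      where "x = (\<Sum>i<n. of_int (c i) * w i)" "y = (\<Sum>i<n. of_int (d i) * w i)" by auto
    then show "x - y \<in> {x. \<exists>c::nat \<Rightarrow> int. x = (\<Sum>i<n. of_int (c i) * w i)}"
      by (auto intro!: exI[of _ "\<lambda>i. c i - d i"] simp: algebra_simps sum_subtractf)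
  qed
  moreover have "w ` {..<n} \<subseteq> {x. \<exists>c::nat \<Rightarrow> int. x = (\<Sum>i<n. of_int (c i) * w i)}"
  proof clarify
    fix j assume "j < n"
    have "(\<Sum>i<n. of_int (of_bool (i = j)) * w i) = (\<Sum>i<n. if i = j then w j else 0)"
      by (intro sum.cong) auto
    also have "\<dots> = w j" using \<open>j < n\<close> by simp
    finally show "\<exists>c::nat \<Rightarrow> int. w j = (\<Sum>i<n. of_int (c i) * w i)"
      by (intro exI[of _ "\<lambda>i. of_bool (i = j)"]) simp
  qed
  ultimately have "zspan (w ` {..<n}) \<subseteq> {x. \<exists>c::nat \<Rightarrow> int. x = (\<Sum>i<n. of_int (c i) * w i)}"
    by (rule zspan_minimal)
  then show ?thesis using assms that by auto
qed

lemma finite_indexed: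
  assumes "finite W"
  obtains w :: "nat \<Rightarrow> 'a" and n :: nat where "W = w ` {..<n}"
  using assms by (metis finite_imp_nat_seg_image_inj_on lessThan_def)

text \<open>Multiplication by \<open>x\<close> on the generators is described by an integer matrix
  \<open>B\<close>. The vector of generators, nonzero because of \<open>w0\<close>, is an
  eigenvector for \<open>x\<close>, so \<open>x\<close> is a root of the characteristic polynomial
  of \<open>B\<close>, which is monic over the integers.\<close>

lemma algebraic_int_if_stable:
  fixes x :: "'a::field_char_0"
  assumes "finite W" "\<And>w. w \<in> W \<Longrightarrow> x * w \<in> zspan W" "w0 \<in> W" "w0 \<noteq> 0"
  shows "algebraic_int x"
proof -
  obtain w :: "nat \<Rightarrow> 'a" and n where W: "W = w ` {..<n}" by (rule finite_indexed[OF assms(1)])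
  have "\<exists>c::nat \<Rightarrow> int. x * w i = (\<Sum>j<n. of_int (c j) * w j)" if "i < n" for i
  proof -
    have "x * w i \<in> zspan (w ` {..<n})" using assms(2)[of "w i"] that unfolding W by auto
    then show ?thesis by (rule zspan_image_indexed) blast
  qed
  then obtain c :: "nat \<Rightarrow> nat \<Rightarrow> int"
    where c: "\<And>i. i < n \<Longrightarrow> x * w i = (\<Sum>j<n. of_int (c i j) * w j)" by metis
  define B where "B = mat n n (\<lambda>(i, j). c i j)"
  define A where "A = map_mat (of_int :: int \<Rightarrow> 'a) B"
  have A: "A \<in> carrier_mat n n" and B: "B \<in> carrier_mat n n" by (auto simp: A_def B_def)
  have "A *\<^sub>v vec n w = x \<cdot>\<^sub>v vec n w"
    by (rule eq_vecI) (auto simp: A_def B_def scalar_prod_def c lessThan_atLeast0)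
  moreover have "vec n w \<noteq> 0\<^sub>v n"
  proof
    assume *: "vec n w = 0\<^sub>v n"
    obtain i where "i < n" "w0 = w i" using assms(3) W by auto
    then show False using arg_cong[OF *, of "\<lambda>v. vec_index v i"] assms(4) by auto
  qed
  ultimately have "eigenvalue A x"
    using A by (auto simp: eigenvalue_def eigenvector_def intro!: exI[of _ "vec n w"])
  then have "poly (char_poly A) x = 0" using eigenvalue_root_char_poly[OF A] by simp
  moreover have "char_poly A = map_poly of_int (char_poly B)"
    unfolding A_def using of_int_hom.char_poly_hom[OF B] .
  moreover have "Polynomial.lead_coeff (char_poly B) = 1" using degree_monic_char_poly[OF B] by auto
  ultimately show ?thesis unfolding algebraic_int_altdef_ipoly by auto
qed


text \<open>The span of the powers below \<open>n\<close> is stable under multiplication by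
  \<open>x\<close>: the only product that leaves the list of generators is \<open>x ^ n\<close>, and
  the assumption puts it back.\<close>

lemma zspan_powers:
  fixes x :: "'a::comm_ring_1"
  assumes "x ^ n \<in> zspan ((\<lambda>i. x ^ i) ` {..<n})" "n > 0"
  shows "x ^ m \<in> zspan ((\<lambda>i. x ^ i) ` {..<n})"
proof (induction m)
  case 0
  then show ?case using assms(2) by (intro zspan.base image_eqI[of _ _ 0]) auto
next
  case (Suc m)
  have "x * x ^ i \<in> zspan ((\<lambda>i. x ^ i) ` {..<n})" if "i < n" for i
  proof (cases "Suc i = n")
    case True
    then show ?thesis using assms(1) by auto
  next
    case False
    then show ?thesis using that by (intro zspan.base image_eqI[of _ _ "Suc i"]) auto
  qed
  then have "x * x ^ m \<in> zspan ((\<lambda>i. x ^ i) ` {..<n})"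
    by (intro zspan_mult_closed[OF _ additive_subgroup_zspan _ Suc.IH, where S = "{x}"])
       (auto intro: zspan.base)
  then show ?case by simp
qed

lemma poly_as_sum_lessThan:
  "poly p x = coeff p (degree p) * x ^ degree p + (\<Sum>i<degree p. coeff p i * x ^ i)"
  for x :: "'a::comm_ring_1"
  using sum.lessThan_Suc[of "\<lambda>i. coeff p i * x ^ i" "degree p"]
  by (simp only: poly_altdef lessThan_Suc_atMost add.commute)

lemma algebraic_int_power_in_zspan:
  fixes x :: "'a::field_char_0"
  assumes "algebraic_int x"
  obtains n where "n > 0" "\<And>m. x ^ m \<in> zspan ((\<lambda>i. x ^ i) ` {..<n})"
proof -
  obtain p :: "int poly"
    where p: "poly (map_poly of_int p) x = 0" "Polynomial.lead_coeff p = 1"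
    using assms unfolding algebraic_int_altdef_ipoly by auto
  define n where "n = degree p"
  have deg: "degree (map_poly (of_int :: int \<Rightarrow> 'a) p) = n" by (simp add: n_def)
  have "x ^ n = - (\<Sum>i<n. of_int (coeff p i) * x ^ i)"
    using p unfolding poly_as_sum_lessThan[of "map_poly of_int p"] deg
    by (simp add: coeff_map_poly n_def add_eq_0_iff)
  then have 1: "x ^ n \<in> zspan ((\<lambda>i. x ^ i) ` {..<n})"
    by (auto intro!: zspan_uminus zspan_sum zspan_of_int_mult intro: zspan.base)
  have "n \<noteq> 0"
  proof
    assume "n = 0"
    then have "degree p = 0" by (simp add: n_def)
    then obtain c where "p = [:c:]" by (metis degree_eq_zeroE)
    then show False using p by (auto simp: map_poly_pCons)
  qed
  then show ?thesis using that[of n] zspan_powers[OF 1] by auto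
qed

text \<open>The elements are adjoined one by one, each time multiplying the generators by the powers
  of \<open>s\<close> below a bound that suffices for all powers. The span of \<open>W\<close> is
  then an order: a ring that is finitely generated as a group.\<close>

lemma algebraic_int_order:
  fixes S :: "'a::field_char_0 set"
  assumes "finite S" "\<And>s. s \<in> S \<Longrightarrow> algebraic_int s"
  obtains W where "finite W" "1 \<in> W" "S \<subseteq> zspan W" "\<And>u v. u \<in> W \<Longrightarrow> v \<in> W \<Longrightarrow> u * v \<in> zspan W"
  using assms
proof (induction S arbitrary: thesis rule: finite_induct)
  case empty
  show ?case by (rule empty(1)[of "{1}"]) (auto intro: zspan.base)
next
  case (insert s S)
  obtain W where W: "finite W" "1 \<in> W" "S \<subseteq> zspan W" "\<And>u v. u \<in> W \<Longrightarrow> v \<in> W \<Longrightarrow> u * v \<in> zspan W"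
    using insert.IH insert.prems(2) by blast
  obtain n where n: "n > 0" "\<And>m. s ^ m \<in> zspan ((\<lambda>i. s ^ i) ` {..<n})"
    using algebraic_int_power_in_zspan insert.prems(2) by blast
  define V where "V = (\<lambda>(u, i). u * s ^ i) ` (W \<times> {..<n})"
  have V: "u * s ^ i \<in> V" if "u \<in> W" "i < n" for u i
    using that by (auto simp: V_def)
  have mult: "u * y \<in> zspan V" if "u \<in> zspan W" "y \<in> zspan ((\<lambda>i. s ^ i) ` {..<n})" for u y
    using that by (intro zspan_mult_closed[OF _ additive_subgroup_zspan that]) (auto intro: zspan.base V)
  show ?case
  proof (rule insert.prems(1))
    show "finite V" using W(1) by (simp add: V_def)
    show "1 \<in> V" using V[OF W(2) n(1)] by simp
    have "x \<in> zspan V" if "x \<in> S" for x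
      using mult[of x "s ^ 0"] W(3) that n(2)[of 0] by auto
    moreover have "s \<in> zspan V"
      using mult[OF zspan.base[OF W(2)] n(2)[of 1]] by simp
    ultimately show "insert s S \<subseteq> zspan V" by auto
  next
    fix a b assume "a \<in> V" "b \<in> V"
    then obtain u v i j where "u \<in> W" "v \<in> W" "a = u * s ^ i" "b = v * s ^ j"
      by (auto simp: V_def)
    then show "a * b \<in> zspan V"
      using mult[OF W(4)[of u v] n(2)[of "i + j"]] by (simp add: power_add algebra_simps)
  qed
qed

text \<open>All elements of an order containing \<open>x\<close> and \<open>y\<close> are integral,
  because multiplication by them preserves the order.\<close>

lemma
  fixes x y :: "'a::field_char_0"
  assumes "algebraic_int x" "algebraic_int y"
  shows algebraic_int_add [intro]: "algebraic_int (x + y)"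
    and algebraic_int_mult [intro]: "algebraic_int (x * y)"
proof -
  obtain W where W: "finite W" "1 \<in> W" "{x, y} \<subseteq> zspan W"
      "\<And>u v. u \<in> W \<Longrightarrow> v \<in> W \<Longrightarrow> u * v \<in> zspan W"
    using algebraic_int_order[of "{x, y}"] assms by blast
  have mult: "a * b \<in> zspan W" if "a \<in> zspan W" "b \<in> zspan W" for a b
    using zspan_mult_closed[OF W(4) additive_subgroup_zspan that] .
  have "algebraic_int z" if "z \<in> zspan W" for z
    using algebraic_int_if_stable[OF W(1) mult[OF that zspan.base] W(2)] by simp
  then show "algebraic_int (x + y)" "algebraic_int (x * y)"
    using W(3) mult[of x y] zspan_add[of x W y] by blast+
qed

lemma algebraic_int_diff [intro]:
  "algebraic_int x \<Longrightarrow> algebraic_int y \<Longrightarrow> algebraic_int (x - y)" for x :: "'a::field_char_0"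
  using algebraic_int_add[of x "- y"] by auto

lemma additive_subgroup_algebraic_int: "additive_subgroup {x::'a::field_char_0. algebraic_int x}"
  by (auto intro: additive_subgroupI)

lemma algebraic_int_power [intro]:
  "algebraic_int x \<Longrightarrow> algebraic_int (x ^ n)" for x :: "'a::field_char_0"
  by (induction n) auto

text \<open>Transitivity of integrality. The coefficients lie in an order with generators
  \<open>W\<close>; the products of \<open>W\<close> with the powers of \<open>x\<close> below the
  degree span a group stable under \<open>x\<close>, because the equation rewrites
  \<open>x ^ n\<close> with coefficients from the order.\<close>

lemma algebraic_int_if_integral:
  fixes x :: "'a::field_char_0"
  assumes "Polynomial.lead_coeff p = 1" "\<And>i. algebraic_int (coeff p i)" "poly p x = 0"
  shows "algebraic_int x"
proof -
  define n where "n = degree p"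
  have n: "x ^ n = - (\<Sum>i<n. coeff p i * x ^ i)"
    using assms unfolding poly_as_sum_lessThan by (simp add: n_def add_eq_0_iff)
  have "n \<noteq> 0" using n by (cases n) auto
  obtain W where W: "finite W" "1 \<in> W" "coeff p ` {..<n} \<subseteq> zspan W"
      "\<And>u v. u \<in> W \<Longrightarrow> v \<in> W \<Longrightarrow> u * v \<in> zspan W"
    using algebraic_int_order[of "coeff p ` {..<n}"] assms by blast
  define V where "V = (\<lambda>(u, i). u * x ^ i) ` (W \<times> {..<n})"
  have V: "u * x ^ i \<in> zspan V" if "u \<in> zspan W" "i < n" for u i
    by (rule zspan_mult_closed[OF _ additive_subgroup_zspan that(1), of "{x ^ i}"])
       (use that(2) in \<open>auto simp: V_def intro: zspan.base\<close>)
  have W_mult: "a * b \<in> zspan W" if "a \<in> zspan W" "b \<in> zspan W" for a b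
    using zspan_mult_closed[OF W(4) additive_subgroup_zspan that] .
  show ?thesis
  proof (rule algebraic_int_if_stable)
    show "finite V" using W(1) by (simp add: V_def)
    show "1 \<in> V" using W(2) \<open>n \<noteq> 0\<close> by (auto simp: V_def intro!: image_eqI[of _ _ "(1, 0)"])
    fix v assume "v \<in> V"
    then obtain u i where v: "v = u * x ^ i" "u \<in> W" "i < n" by (auto simp: V_def)
    show "x * v \<in> zspan V"
    proof (cases "Suc i = n")
      case True
      have "x * v = u * x ^ n" using v True by (auto simp: algebra_simps)
      also have "\<dots> = - (\<Sum>i<n. (u * coeff p i) * x ^ i)"
        by (simp add: n sum_distrib_left mult.assoc)
      also have "\<dots> \<in> zspan V"
        using W(3) v(2) by (intro zspan_uminus zspan_sum V W_mult) (auto intro: zspan.base)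
      finally show ?thesis .
    next
      case False
      have "x * v = u * x ^ Suc i" using v by (auto simp: algebra_simps)
      then show ?thesis using V[OF zspan.base[OF v(2)], of "Suc i"] v(3) False by (metis Suc_lessI)
    qed
  qed simp
qed

text \<open>The least positive element divides all others, since a remainder would be
  smaller.\<close>

lemma int_additive_subgroup_principal:
  fixes C :: "int set"
  assumes "additive_subgroup C"
  obtains d where "d \<in> C" "\<And>c. c \<in> C \<Longrightarrow> d dvd c"
proof (cases "C \<subseteq> {0}")
  case True
  then show ?thesis using that[of 0] additive_subgroup_0[OF assms] by auto
next
  case False
  then obtain c where "c \<in> C" "c \<noteq> 0" by auto
  then have "nat \<bar>c\<bar> > 0 \<and> int (nat \<bar>c\<bar>) \<in> C"
    using additive_subgroup_uminus[OF assms] by (auto simp: abs_if)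
  then have ex: "\<exists>m. m > 0 \<and> int m \<in> C" by blast
  define m where "m = (LEAST m. m > 0 \<and> int m \<in> C)"
  have m: "m > 0" "int m \<in> C" using LeastI_ex[OF ex] by (auto simp: m_def)
  have m_le: "m \<le> l" if "l > 0" "int l \<in> C" for l
    unfolding m_def using that by (intro Least_le) auto
  have "int m dvd x" if "x \<in> C" for x
  proof (rule ccontr)
    assume "\<not> int m dvd x"
    then have *: "x mod int m > 0"
      by (metis dvd_eq_mod_eq_0 le_less m(1) of_nat_0_less_iff pos_mod_sign)
    have "x mod int m = x - of_int (x div int m) * int m"
      by (simp add: minus_div_mult_eq_mod)
    also have "\<dots> \<in> C"
      using that m(2) by (intro additive_subgroup_diff[OF assms] additive_subgroup_of_int_mult[OF assms])
    finally have "m \<le> nat (x mod int m)" using * by (intro m_le) auto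
    moreover have "x mod int m < int m" using m(1) by simp
    ultimately show False using * by (simp add: le_nat_iff)
  qed
  then show ?thesis using that m(2) by blast
qed

lemma zspan_insertE:
  assumes "y \<in> zspan (insert u W)"
  obtains c :: int and x where "x \<in> zspan W" "y = of_int c * u + (x :: 'a::comm_ring_1)"
proof -
  let ?M = "{y. \<exists>c::int. \<exists>x\<in>zspan W. y = of_int c * u + x}"
  have "zspan (insert u W) \<subseteq> ?M"
  proof (intro zspan_minimal additive_subgroupI)
    show "0 \<in> ?M" by (auto intro!: exI[of _ 0] zspan.zero)
    fix x y assume "x \<in> ?M" "y \<in> ?M"
    then obtain c x' d y' where *: "x' \<in> zspan W" "y' \<in> zspan W"
        "x = of_int c * u + x'" "y = of_int d * u + y'" by blast
    then have "x - y = of_int (c - d) * u + (x' - y')" by (simp add: algebra_simps)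
    then show "x - y \<in> ?M" using zspan.diff[OF *(1,2)] by blast
  next
    have "u = of_int 1 * u + 0" by simp
    then have "u \<in> ?M" using zspan.zero[of W] by blast
    moreover have "w = of_int 0 * u + w" for w by simp
    then have "W \<subseteq> ?M" using zspan.base[of _ W] by blast
    ultimately show "insert u W \<subseteq> ?M" by auto
  qed
  then show ?thesis using that assms by blast
qed

text \<open>Induction on the generators of the ambient group. The coefficients of \<open>u\<close>
  in elements of \<open>N\<close> form a subgroup of \<int>, generated by some \<open>d\<close>; one
  element \<open>y0\<close> of \<open>N\<close> with coefficient \<open>d\<close>, together with
  generators of \<open>N \<inter> zspan W\<close>, generates \<open>N\<close>.\<close>

lemma additive_subgroup_finitely_generated:
  fixes N :: "'a::comm_ring_1 set"
  assumes "finite W" "additive_subgroup N" "N \<subseteq> zspan W"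
  obtains V where "finite V" "N = zspan V"
  using assms
proof (induction W arbitrary: N thesis rule: finite_induct)
  case empty
  have "zspan {} \<subseteq> {0::'a}" by (intro zspan_minimal) (auto simp: additive_subgroup_def)
  then have "N = zspan {}"
    using empty additive_subgroup_0[OF empty(2)] zspan.zero[of "{}"] by auto
  then show ?case using empty(1)[of "{}"] by simp
next
  case (insert u W)
  note N = insert.prems(2)
  have "additive_subgroup (N \<inter> zspan W)"
    using N additive_subgroup_zspan[of W] by (auto simp: additive_subgroup_def)
  then obtain V where V: "finite V" "N \<inter> zspan W = zspan V" using insert.IH by blast
  define C where "C = {c::int. \<exists>x\<in>zspan W. of_int c * u + x \<in> N}"
  have "additive_subgroup C"
  proof (rule additive_subgroupI)
    show "0 \<in> C" using additive_subgroup_0[OF N] by (auto simp: C_def intro!: bexI[of _ 0] zspan.zero)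
    fix c d assume "c \<in> C" "d \<in> C"
    then obtain x y where *: "x \<in> zspan W" "y \<in> zspan W" "of_int c * u + x \<in> N" "of_int d * u + y \<in> N"
      by (auto simp: C_def)
    have "of_int (c - d) * u + (x - y) = (of_int c * u + x) - (of_int d * u + y)"
      by (simp add: algebra_simps)
    also have "\<dots> \<in> N" using N * by (auto intro: additive_subgroup_diff)
    finally show "c - d \<in> C" using zspan.diff[OF *(1,2)] by (auto simp: C_def)
  qed
  then obtain d where d: "d \<in> C" "\<And>c. c \<in> C \<Longrightarrow> d dvd c"
    using int_additive_subgroup_principal by blast
  then obtain x0 where x0: "x0 \<in> zspan W" "of_int d * u + x0 \<in> N" by (auto simp: C_def)
  define y0 where "y0 = of_int d * u + x0"
  have "N = zspan (insert y0 V)"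
  proof
    show "zspan (insert y0 V) \<subseteq> N"
      using x0(2) V(2) zspan.base[of _ V] by (intro zspan_minimal N) (auto simp: y0_def)
    show "N \<subseteq> zspan (insert y0 V)"
    proof
      fix y assume y: "y \<in> N"
      then obtain c :: int and x where cx: "x \<in> zspan W" "y = of_int c * u + x"
        using insert.prems(3) by (meson subsetD zspan_insertE)
      then have "c \<in> C" using y by (auto simp: C_def)
      then obtain q where q: "c = d * q" using d(2) by (auto elim: dvdE)
      have "y - of_int q * y0 = x - of_int q * x0"
        by (simp add: cx y0_def q algebra_simps)
      moreover have "y - of_int q * y0 \<in> N"
        using x0(2) y by (auto simp: y0_def intro!: additive_subgroup_diff[OF N] additive_subgroup_of_int_mult[OF N])
      moreover have "x - of_int q * x0 \<in> zspan W"
        using x0 cx by (intro zspan.diff zspan_of_int_mult)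
      ultimately have "y - of_int q * y0 \<in> zspan V" using V(2) by auto
      then have "y - of_int q * y0 \<in> zspan (insert y0 V)" using zspan_mono[of V "insert y0 V"] by auto
      moreover have "of_int q * y0 \<in> zspan (insert y0 V)" by (intro zspan_of_int_mult zspan.base) simp
      ultimately have "(y - of_int q * y0) + of_int q * y0 \<in> zspan (insert y0 V)" by (rule zspan_add)
      then show "y \<in> zspan (insert y0 V)" by simp
    qed
  qed
  then show ?case using insert.prems(1)[of "insert y0 V"] V(1) by simp
qed

section \<open>Contents of products of polynomials\<close>

text \<open>With \<open>a\<close> the leading coefficient, \<open>a ^ n * poly p r\<close> becomes a
  monic polynomial in \<open>a * r\<close> whose coefficients \<open>coeff p i * a ^ (n - i)\<close>
  are integral.\<close>

lemma algebraic_int_lead_coeff_times_root: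
  fixes p :: "'a::field_char_0 poly"
  assumes "\<And>i. algebraic_int (coeff p i)" "poly p r = 0" "degree p = Suc n"
  shows "algebraic_int (coeff p (Suc n) * r)"
proof -
  define a where "a = coeff p (Suc n)"
  define P where "P = Polynomial.monom 1 (Suc n) + (\<Sum>i\<le>n. Polynomial.monom (coeff p i * a ^ (n - i)) i)"
  have coeff_P: "coeff P i = (if i = Suc n then 1 else if i \<le> n then coeff p i * a ^ (n - i) else 0)" for i
    by (cases "i \<le> n") (simp_all add: P_def coeff_sum)
  have "degree P = Suc n"
    by (rule antisym[OF degree_le le_degree]) (auto simp: coeff_P)
  moreover have "poly P (a * r) = 0"
  proof -
    have "poly P (a * r) = (a * r) ^ Suc n + (\<Sum>i\<le>n. coeff p i * a ^ (n - i) * (a * r) ^ i)"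
      by (simp add: P_def poly_sum poly_monom)
    also have "(\<Sum>i\<le>n. coeff p i * a ^ (n - i) * (a * r) ^ i) = (\<Sum>i\<le>n. a ^ n * (coeff p i * r ^ i))"
    proof (rule sum.cong)
      fix i assume "i \<in> {..n}"
      then have "a ^ n = a ^ (n - i) * a ^ i" by (simp add: power_add[symmetric])
      then show "coeff p i * a ^ (n - i) * (a * r) ^ i = a ^ n * (coeff p i * r ^ i)"
        by (simp add: power_mult_distrib algebra_simps)
    qed simp
    also have "(a * r) ^ Suc n + \<dots> = a ^ n * (a * r ^ Suc n + (\<Sum>i\<le>n. coeff p i * r ^ i))"
      by (simp add: power_mult_distrib sum_distrib_left algebra_simps)
    also have "a * r ^ Suc n + (\<Sum>i\<le>n. coeff p i * r ^ i) = poly p r"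
      using assms(3) by (simp add: poly_altdef a_def)
    finally show ?thesis using assms(2) by simp
  qed
  moreover have "algebraic_int (coeff P i)" for i
    using assms(1) by (auto simp: coeff_P a_def)
  ultimately show ?thesis
    using algebraic_int_if_integral[of P "a * r"] by (simp add: coeff_P a_def)
qed

text \<open>The polynomials \<open>p\<close> and \<open>q\<close> share the leading coefficient
  \<open>a\<close>, and \<open>a * r\<close> is integral. Subtracting from \<open>p\<close> the
  product of \<open>[:- r, 1:]\<close> with the top term of \<open>q\<close> thus keeps the
  coefficients integral and shortens \<open>q\<close>. Induction on the length of the coefficient
  list, unlike the degree, also drops when a constant \<open>q\<close> becomes zero.\<close>

lemma algebraic_int_coeff_quotient:
  fixes p :: "'a::field_char_0 poly"
  assumes "p = [:- r, 1:] * q" "\<And>i. algebraic_int (coeff p i)"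
  shows "algebraic_int (coeff q i)"
  using assms
proof (induction "length (coeffs q)" arbitrary: p q i rule: less_induct)
  case less
  show ?case
  proof (cases "q = 0")
    case False
    define n where "n = degree q"
    define a where "a = coeff q n"
    have "a \<noteq> 0" using False by (simp add: a_def n_def)
    have deg: "degree p = Suc n"
      unfolding less.prems(1) using False by (subst degree_mult_eq) (auto simp: n_def)
    have a: "a = coeff p (Suc n)"
      by (simp add: less.prems(1) a_def n_def coeff_eq_0)
    have ar: "algebraic_int (a * r)"
      unfolding a by (rule algebraic_int_lead_coeff_times_root[OF less.prems(2) _ deg])
        (simp add: less.prems(1))
    define q1 where "q1 = q - Polynomial.monom a n"
    have IH: "algebraic_int (coeff q1 j)" for j
    proof (rule less.hyps)
      have *: "coeff q1 i = 0" if "i \<ge> n" for i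
        using that by (cases "i = n") (auto simp: q1_def a_def n_def coeff_eq_0)
      show "length (coeffs q1) < length (coeffs q)"
      proof (cases "q1 = 0")
        case True
        then show ?thesis using False by (simp add: length_coeffs_degree)
      next
        case nz: False
        then have "degree q1 < n" using *[of "degree q1"] by (meson leading_coeff_0_iff not_le)
        then show ?thesis using False nz by (simp add: length_coeffs_degree n_def)
      qed
    next
      show "[:- r, 1:] * q1 = [:- r, 1:] * q1" ..
      fix i
      have eq: "[:- r, 1:] * q1 = p - [:- r, 1:] * Polynomial.monom a n"
        by (simp add: q1_def less.prems(1) right_diff_distrib)
      show "algebraic_int (coeff ([:- r, 1:] * q1) i)"
        unfolding eq using ar less.prems(2)[of i] a less.prems(2)[of "Suc n"]
        by (auto simp: coeff_monom coeff_pCons mult.commute[of r] split: nat.splits)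
    qed
    have "coeff q i = coeff q1 i + (if i = n then a else 0)" by (auto simp: q1_def)
    then show ?thesis using IH[of i] a less.prems(2)[of "Suc n"] by auto
  qed simp
qed

text \<open>Dedekind's theorem. A root \<open>r\<close> of \<open>f\<close> is split off, and the
  induction hypothesis for \<open>f1\<close> is used twice: with cofactor \<open>g\<close>, and with
  the linear factor moved over to \<open>g\<close>. Together they make
  \<open>r * coeff f1 i * coeff g j\<close> integral, and each coefficient of \<open>f\<close> is a
  coefficient of \<open>f1\<close> minus \<open>r\<close> times the next one.\<close>

lemma algebraic_int_coeff_products_alg_closed:
  fixes f g :: "'a::{alg_closed_field, field_char_0} poly"
  assumes "\<And>i. algebraic_int (coeff (f * g) i)"
  shows "algebraic_int (coeff f i * coeff g j)"
  using assms
proof (induction "degree f" arbitrary: f g i j)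
  case 0
  then obtain a where f: "f = [:a:]" by (metis degree_eq_zeroE)
  show ?case using 0(2)[of j] by (cases i) (auto simp: f)
next
  case (Suc n)
  then obtain r where "poly f r = 0" using alg_closed_imp_poly_has_root[of f] by auto
  then obtain f1 where f: "f = [:- r, 1:] * f1" by (auto simp: poly_eq_0_iff_dvd elim: dvdE)
  have "f \<noteq> 0" using Suc.hyps(2) by auto
  then have "degree f = Suc (degree f1)"
    unfolding f by (subst degree_mult_eq) auto
  then have deg: "n = degree f1" using Suc.hyps(2) by simp
  have "algebraic_int (coeff (f1 * g) i)" for i
    by (rule algebraic_int_coeff_quotient[OF _ Suc.prems, of r]) (simp only: f mult.assoc)
  then have 1: "algebraic_int (coeff f1 i * coeff g j)" for i j
    by (rule Suc.hyps(1)[OF deg])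
  have "f1 * ([:- r, 1:] * g) = f * g" by (simp only: f ac_simps)
  then have 2: "algebraic_int (coeff f1 i * coeff ([:- r, 1:] * g) j)" for i j
    using Suc.hyps(1)[OF deg, of "[:- r, 1:] * g"] Suc.prems by simp
  have 3: "algebraic_int (coeff f1 i * (r * coeff g j))" for i j
  proof -
    have "coeff f1 i * (r * coeff g j) =
        (if j = 0 then 0 else coeff f1 i * coeff g (j - 1)) - coeff f1 i * coeff ([:- r, 1:] * g) j"
      by (auto simp: coeff_pCons algebra_simps split: nat.splits)
    moreover have "algebraic_int (if j = 0 then 0 else coeff f1 i * coeff g (j - 1))" using 1 by simp
    ultimately show ?thesis using algebraic_int_diff[OF _ 2] by metis
  qed
  have "coeff f i * coeff g j =
      (if i = 0 then 0 else coeff f1 (i - 1) * coeff g j) - coeff f1 i * (r * coeff g j)"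
    by (auto simp: f coeff_pCons algebra_simps split: nat.splits)
  moreover have "algebraic_int (if i = 0 then 0 else coeff f1 (i - 1) * coeff g j)" using 1 by simp
  ultimately show ?case using algebraic_int_diff[OF _ 3] by metis
qed

lemma to_ac_poly: "to_ac (poly p x) = poly (map_poly to_ac p) (to_ac x)"
  by (induction p) (auto simp: map_poly_pCons)

lemma algebraic_int_to_ac_iff: "algebraic_int (to_ac x) \<longleftrightarrow> algebraic_int x"
  for x :: "'a::field_char_0"
proof -
  have "poly (map_poly of_int p) (to_ac x) = to_ac (poly (map_poly of_int p) x)" for p :: "int poly"
    by (simp add: to_ac_poly map_poly_map_poly o_def)
  then show ?thesis by (simp add: algebraic_int_altdef_ipoly)
qed

text \<open>Roots of \<open>f\<close> become available in the algebraic closure, and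
  \<open>to_ac\<close> both preserves and reflects integrality.\<close>

lemma algebraic_int_coeff_products:
  fixes f g :: "'a::field_char_0 poly"
  assumes "\<And>i. algebraic_int (coeff (f * g) i)"
  shows "algebraic_int (coeff f i * coeff g j)"
proof -
  have "map_poly to_ac (f * g) = map_poly to_ac f * map_poly to_ac g"
    by (intro poly_eqI) (simp add: coeff_map_poly coeff_mult to_ac_sum)
  then have "coeff (map_poly to_ac f * map_poly to_ac g) k = to_ac (coeff (f * g) k)" for k
    by (metis coeff_map_poly to_ac_0)
  then have "algebraic_int (coeff (map_poly to_ac f) i * coeff (map_poly to_ac g) j)"
    using assms by (intro algebraic_int_coeff_products_alg_closed) (simp add: algebraic_int_to_ac_iff)
  then show ?thesis by (simp add: coeff_map_poly algebraic_int_to_ac_iff flip: to_ac_mult)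
qed

section \<open>Subfields and bases\<close>

text \<open>Subfields in terms of the type class operations, so that later computations stay clear
  of the ring record. The value \<open>inverse 0 = 0\<close> makes the last clause uniform.\<close>

definition closed_subfield :: "'a::field set \<Rightarrow> bool" where
  "closed_subfield F \<longleftrightarrow> 1 \<in> F \<and> (\<forall>x\<in>F. \<forall>y\<in>F. x - y \<in> F \<and> x * y \<in> F) \<and> (\<forall>x\<in>F. inverse x \<in> F)"

lemma ambient_simps [simp]:
  "carrier ambient = UNIV" "x \<otimes>\<^bsub>ambient\<^esub> y = x * y" "x \<oplus>\<^bsub>ambient\<^esub> y = x + y"
  "\<zero>\<^bsub>ambient\<^esub> = 0" "\<one>\<^bsub>ambient\<^esub> = 1"
  by (simp_all add: ring_of_type_algebra_def)

lemma field_ambient: "Ring.field ambient" and ring_ambient: "Ring.ring ambient"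
  by (rule field_from_type_algebra, rule ring_from_type_algebra)

lemma a_inv_ambient: "\<ominus>\<^bsub>ambient\<^esub> x = - x"
proof -
  interpret Ring.ring "ambient :: 'a ring" by (rule ring_ambient)
  have "\<ominus>\<^bsub>ambient\<^esub> x \<oplus>\<^bsub>ambient\<^esub> x = \<zero>\<^bsub>ambient\<^esub>" by (rule l_neg) simp
  then show ?thesis by (simp add: eq_neg_iff_add_eq_0)
qed

lemma m_inv_ambient: "x \<noteq> 0 \<Longrightarrow> inv\<^bsub>ambient\<^esub> x = inverse x"
proof -
  assume "x \<noteq> 0"
  interpret Ring.field "ambient :: 'a ring" by (rule field_ambient)
  have "x \<in> Units ambient" using \<open>x \<noteq> 0\<close> by (simp add: field_Units)
  then have "inv\<^bsub>ambient\<^esub> x \<otimes>\<^bsub>ambient\<^esub> x = \<one>\<^bsub>ambient\<^esub>" by (rule Units_l_inv)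
  then show ?thesis using \<open>x \<noteq> 0\<close> by (simp add: field_simps)
qed

lemma closed_subfield_if_subfield:
  assumes "subfield F ambient"
  shows "closed_subfield F"
proof -
  interpret Ring.field "ambient :: 'a ring" by (rule field_ambient)
  note F = subfieldE[OF assms] and sr = subringE[OF subfieldE(1)[OF assms]]
  have "x - y \<in> F" if "x \<in> F" "y \<in> F" for x y
    using sr(7)[OF that(1) sr(5)[OF that(2)]] by (simp add: a_inv_ambient)
  moreover have "x * y \<in> F" if "x \<in> F" "y \<in> F" for x y
    using sr(6)[OF that] by simp
  moreover have "inverse x \<in> F" if "x \<in> F" for x
    using subfield_m_inv(1)[OF assms, of x] that sr(2) by (cases "x = 0") (auto simp: m_inv_ambient)
  ultimately show ?thesis using sr(3) by (auto simp: closed_subfield_def)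
qed

lemma
  assumes "closed_subfield F"
  shows closed_subfield_1: "1 \<in> F"
    and closed_subfield_diff: "x \<in> F \<Longrightarrow> y \<in> F \<Longrightarrow> x - y \<in> F"
    and closed_subfield_mult: "x \<in> F \<Longrightarrow> y \<in> F \<Longrightarrow> x * y \<in> F"
    and closed_subfield_inverse: "x \<in> F \<Longrightarrow> inverse x \<in> F"
  using assms by (auto simp: closed_subfield_def)

lemma additive_subgroup_closed_subfield: "closed_subfield F \<Longrightarrow> additive_subgroup F"
  using closed_subfield_diff[of F 1 1] by (auto simp: additive_subgroup_def closed_subfield_def)

lemmas closed_subfield_0 = additive_subgroup_0[OF additive_subgroup_closed_subfield]
lemmas closed_subfield_add = additive_subgroup_add[OF additive_subgroup_closed_subfield]
lemmas closed_subfield_uminus = additive_subgroup_uminus[OF additive_subgroup_closed_subfield]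
lemmas closed_subfield_sum = additive_subgroup_sum[OF additive_subgroup_closed_subfield]

lemma closed_subfield_divide: "closed_subfield F \<Longrightarrow> x \<in> F \<Longrightarrow> y \<in> F \<Longrightarrow> x / y \<in> F"
  by (simp add: divide_inverse closed_subfield_mult closed_subfield_inverse)

lemma closed_subfield_prod:
  "closed_subfield F \<Longrightarrow> (\<And>i. i \<in> A \<Longrightarrow> f i \<in> F) \<Longrightarrow> prod f A \<in> F"
  by (induction A rule: infinite_finite_induct) (auto intro: closed_subfield_1 closed_subfield_mult)

lemma closed_subfield_power: "closed_subfield F \<Longrightarrow> x \<in> F \<Longrightarrow> x ^ n \<in> F"
  by (induction n) (auto intro: closed_subfield_1 closed_subfield_mult)

lemma closed_subfield_of_int: "closed_subfield F \<Longrightarrow> of_int n \<in> F"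
  using additive_subgroup_of_int_mult[OF additive_subgroup_closed_subfield closed_subfield_1, of F n] by simp

lemma closed_subfield_of_nat: "closed_subfield F \<Longrightarrow> of_nat n \<in> F"
  using closed_subfield_of_int[of F "int n"] by simp

lemma closed_subfield_of_rat: "closed_subfield F \<Longrightarrow> of_rat q \<in> F"
  by (cases q) (auto simp: of_rat_rat intro: closed_subfield_divide closed_subfield_of_int)

definition basis_of :: "'a::field set \<Rightarrow> 'a set \<Rightarrow> nat \<Rightarrow> (nat \<Rightarrow> 'a) \<Rightarrow> bool" where
  "basis_of F E n w \<longleftrightarrow> w ` {..<n} \<subseteq> E \<and>
     (\<forall>x\<in>E. \<exists>c. (\<forall>i<n. c i \<in> F) \<and> x = (\<Sum>i<n. c i * w i)) \<and>
     (\<forall>c. (\<forall>i<n. c i \<in> F) \<and> (\<Sum>i<n. c i * w i) = 0 \<longrightarrow> (\<forall>i<n. c i = 0))"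

lemma combine_ambient:
  "length Ks = length Us \<Longrightarrow> ring.combine ambient Ks Us = (\<Sum>i<length Us. Ks ! i * Us ! i)"
proof (induction Ks Us rule: list_induct2)
  case Nil
  interpret Ring.ring "ambient :: 'a ring" by (rule ring_ambient)
  show ?case by simp
next
  case (Cons x xs y ys)
  interpret Ring.ring "ambient :: 'a ring" by (rule ring_ambient)
  show ?case using Cons by (simp add: sum.lessThan_Suc_shift del: sum.lessThan_Suc)
qed

lemma finite_field_extension_basis:
  assumes "finite_field_extension F E"
  obtains n w where "basis_of F E n w"
proof -
  interpret Ring.field "ambient :: 'a ring" by (rule field_ambient)
  have F: "subfield F ambient" using assms by (auto simp: finite_field_extension_def field_extension_def)
  obtain n where n: "dimension n F E" using assms by (auto simp: finite_field_extension_def)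
  then obtain Us where Us: "independent F Us" "length Us = n" "Span F Us = E"
    using exists_base[OF F n] by blast
  have "basis_of F E n ((!) Us)"
    unfolding basis_of_def
  proof (intro conjI ballI allI impI)
    show "(!) Us ` {..<n} \<subseteq> E"
      using Span_base_incl[OF F, of Us] Us by (auto simp: set_conv_nth)
  next
    fix x assume "x \<in> E"
    then obtain Ks where "set Ks \<subseteq> F" "length Ks = length Us" "x = combine Ks Us"
      using Span_mem_iff_length_version[OF F, of Us x] Us by auto
    then show "\<exists>c. (\<forall>i<n. c i \<in> F) \<and> x = (\<Sum>i<n. c i * Us ! i)"
      using Us(2) by (intro exI[of _ "(!) Ks"]) (auto simp: combine_ambient set_conv_nth)
  next
    fix c i assume c: "(\<forall>i<n. c i \<in> F) \<and> (\<Sum>i<n. c i * Us ! i) = 0" and "i < n"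
    have "combine (map c [0..<n]) Us = 0" using c Us(2) by (subst combine_ambient) auto
    moreover have "set (map c [0..<n]) \<subseteq> F" using c by auto
    ultimately have "set (take (length Us) (map c [0..<n])) \<subseteq> {0}"
      using independent_imp_trivial_combine[OF F Us(1), of "map c [0..<n]"] by simp
    then show "c i = 0" using Us(2) \<open>i < n\<close> by (simp add: take_map image_subset_iff)
  qed
  then show ?thesis by (rule that)
qed

section \<open>The trace form of a number field\<close>

lemma common_denominator:
  fixes c :: "'i \<Rightarrow> 'a::field_char_0"
  assumes "finite I" "\<And>i. i \<in> I \<Longrightarrow> c i \<in> \<rat>"
  obtains d :: nat where "d > 0" "\<And>i. i \<in> I \<Longrightarrow> of_nat d * c i \<in> \<int>"
  using assms
proof (induction I arbitrary: thesis rule: finite_induct)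
  case empty
  then show ?case using empty(1)[of 1] by auto
next
  case (insert i I)
  obtain d :: nat where d: "d > 0" "\<And>i. i \<in> I \<Longrightarrow> of_nat d * c i \<in> \<int>"
    using insert.IH insert.prems(2) by blast
  obtain a b :: int where ab: "b > 0" "c i = of_int a / of_int b"
    using insert.prems(2)[of i] by (auto elim!: Rats_cases')
  show ?case
  proof (rule insert.prems(1))
    show "d * nat b > 0" using d ab by simp
    fix j assume j: "j \<in> insert i I"
    have b: "(of_nat (d * nat b) :: 'a) = of_nat d * of_int b" using ab(1) by simp
    show "of_nat (d * nat b) * c j \<in> \<int>"
    proof (cases "j \<in> I")
      case True
      have "of_nat (d * nat b) * c j = of_int b * (of_nat d * c j)" unfolding b by simp
      then show ?thesis using d(2)[OF True] by (metis Ints_mult Ints_of_int)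
    next
      case False
      then have "of_nat (d * nat b) * c j = of_int (int d * a)"
        unfolding b using ab j by simp
      then show ?thesis by (metis Ints_of_int)
    qed
  qed
qed

lemma number_field_closed_subfield: "number_field F \<Longrightarrow> closed_subfield F"
  by (simp add: number_field_def finite_field_extension_def field_extension_def closed_subfield_if_subfield)

lemma basis_of_mem: "basis_of F E n w \<Longrightarrow> i < n \<Longrightarrow> w i \<in> E"
  and basis_of_coords: "basis_of F E n w \<Longrightarrow> x \<in> E \<Longrightarrow> \<exists>c. (\<forall>i<n. c i \<in> F) \<and> x = (\<Sum>i<n. c i * w i)"
  and basis_of_independent:
    "basis_of F E n w \<Longrightarrow> (\<And>i. i < n \<Longrightarrow> c i \<in> F) \<Longrightarrow> (\<Sum>i<n. c i * w i) = 0 \<Longrightarrow> i < n \<Longrightarrow> c i = 0"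
  unfolding basis_of_def by blast+

lemma basis_of_nonzero:
  assumes "basis_of F E n w" "x \<in> E" "x \<noteq> 0"
  obtains i where "i < n" "w i \<noteq> 0"
proof -
  obtain c where c: "x = (\<Sum>i<n. c i * w i)" using basis_of_coords[OF assms(1,2)] by blast
  have "\<exists>i<n. w i \<noteq> 0"
  proof (rule ccontr)
    assume "\<not> (\<exists>i<n. w i \<noteq> 0)"
    then have "x = 0" by (simp add: c)
    then show False using assms(3) by simp
  qed
  then show ?thesis using that by blast
qed

text \<open>On a rational basis \<open>x\<close> acts by a rational matrix. Once \<open>d\<close>
  clears its denominators, \<open>of_nat d * x\<close> preserves the lattice spanned by the
  basis.\<close>

lemma number_field_denominator:
  fixes F :: "'a::field_char_0 set"
  assumes "number_field F" "x \<in> F"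
  obtains d :: nat where "d > 0" "algebraic_int (of_nat d * x)"
proof -
  note F = number_field_closed_subfield[OF assms(1)]
  obtain n w where w: "basis_of \<rat> F n w"
    using finite_field_extension_basis assms(1) unfolding number_field_def by blast
  have "\<forall>i\<in>{..<n}. \<exists>c. (\<forall>j<n. c j \<in> \<rat>) \<and> x * w i = (\<Sum>j<n. c j * w j)"
    using basis_of_coords[OF w closed_subfield_mult[OF F assms(2) basis_of_mem[OF w]]] by blast
  from bchoice[OF this] obtain c where c: "\<And>i j. i < n \<Longrightarrow> j < n \<Longrightarrow> c i j \<in> \<rat>"
      "\<And>i. i < n \<Longrightarrow> x * w i = (\<Sum>j<n. c i j * w j)"
    by blast
  obtain d :: nat where d: "d > 0" "\<And>i. i \<in> {..<n} \<times> {..<n} \<Longrightarrow> of_nat d * (case i of (i, j) \<Rightarrow> c i j) \<in> \<int>"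
    by (rule common_denominator[of "{..<n} \<times> {..<n}" "\<lambda>(i, j). c i j"]) (use c(1) in auto)
  obtain i where i: "i < n" "w i \<noteq> 0" using basis_of_nonzero[OF w closed_subfield_1[OF F]] by auto
  have "algebraic_int (of_nat d * x)"
  proof (rule algebraic_int_if_stable)
    show "finite (w ` {..<n})" "w i \<in> w ` {..<n}" "w i \<noteq> 0" using i by auto
    fix v assume "v \<in> w ` {..<n}"
    then obtain i where i: "i < n" "v = w i" by auto
    have "of_nat d * x * v = (\<Sum>j<n. (of_nat d * c i j) * w j)"
      using c(2)[OF i(1)] by (simp add: i(2) mult.assoc sum_distrib_left)
    also have "\<dots> \<in> zspan (w ` {..<n})"
    proof (rule zspan_sum)
      fix j assume "j \<in> {..<n}"
      then obtain m where "of_nat d * c i j = of_int m" using d(2)[of "(i, j)"] i(1) by (auto elim: Ints_cases)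
      then show "of_nat d * c i j * w j \<in> zspan (w ` {..<n})"
        using \<open>j \<in> {..<n}\<close> by (auto intro: zspan_of_int_mult zspan.base)
    qed
    finally show "of_nat d * x * v \<in> zspan (w ` {..<n})" .
  qed
  then show ?thesis using d(1) that by blast
qed

text \<open>A \<rat>-basis of \<open>F\<close> consisting of algebraic integers. It may span a
  proper subgroup of the ring of integers; the discrepancy is bounded in
  \<open>algebraic_int_bounded_denominator\<close>.\<close>

locale integral_basis =
  fixes F :: "'a::field_char_0 set" and n :: nat and w :: "nat \<Rightarrow> 'a"
  assumes F: "closed_subfield F"
    and w: "basis_of \<rat> F n w"
    and algebraic_int_w: "i < n \<Longrightarrow> algebraic_int (w i)"

lemma number_field_integral_basis:
  assumes "number_field F"
  obtains n w where "integral_basis F n w"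
proof -
  note F = number_field_closed_subfield[OF assms(1)]
  obtain n w where w: "basis_of \<rat> F n w"
    using finite_field_extension_basis assms(1) unfolding number_field_def by blast
  have "\<forall>i\<in>{..<n}. \<exists>d. d > 0 \<and> algebraic_int (of_nat d * w i)"
    using number_field_denominator[OF assms basis_of_mem[OF w]] by blast
  from bchoice[OF this] obtain d :: "nat \<Rightarrow> nat"
    where d: "\<And>i. i < n \<Longrightarrow> d i > 0 \<and> algebraic_int (of_nat (d i) * w i)"
    by blast
  have "basis_of \<rat> F n (\<lambda>i. of_nat (d i) * w i)"
    unfolding basis_of_def
  proof (intro conjI ballI allI impI)
    show "(\<lambda>i. of_nat (d i) * w i) ` {..<n} \<subseteq> F"
      using w by (auto simp: basis_of_def intro!: closed_subfield_mult[OF F] closed_subfield_of_nat[OF F])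
  next
    fix x assume "x \<in> F"
    then obtain c where c: "\<forall>i<n. c i \<in> \<rat>" "x = (\<Sum>i<n. c i * w i)"
      using basis_of_coords[OF w] by blast
    have "(\<Sum>i<n. c i * w i) = (\<Sum>i<n. c i / of_nat (d i) * (of_nat (d i) * w i))"
    proof (rule sum.cong)
      fix i assume "i \<in> {..<n}"
      then have "of_nat (d i) \<noteq> (0::'a)" using d[of i] by simp
      then show "c i * w i = c i / of_nat (d i) * (of_nat (d i) * w i)" by simp
    qed simp
    then show "\<exists>c. (\<forall>i<n. c i \<in> \<rat>) \<and> x = (\<Sum>i<n. c i * (of_nat (d i) * w i))"
      using c by (intro exI[of _ "\<lambda>i. c i / of_nat (d i)"]) auto
  next
    fix c i assume c: "(\<forall>i<n. c i \<in> \<rat>) \<and> (\<Sum>i<n. c i * (of_nat (d i) * w i)) = 0" and i: "i < n"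
    have "\<And>i. i < n \<Longrightarrow> c i * of_nat (d i) \<in> \<rat>" using c by auto
    moreover have "(\<Sum>i<n. (c i * of_nat (d i)) * w i) = 0" using c by (simp add: mult.assoc)
    ultimately have "c i * of_nat (d i) = 0" by (rule basis_of_independent[OF w _ _ i])
    then show "c i = 0" using d[OF i] by simp
  qed
  then show ?thesis using that d F by (auto simp: integral_basis_def)
qed

context integral_basis
begin

definition coord :: "'a \<Rightarrow> nat \<Rightarrow> rat" where
  "coord x = (SOME c. x = (\<Sum>i<n. of_rat (c i) * w i))"

lemma w_in_F: "i < n \<Longrightarrow> w i \<in> F"
  by (rule basis_of_mem[OF w])

lemma lincomb_in_F: "(\<Sum>i<n. of_rat (c i) * w i) \<in> F"
  by (intro closed_subfield_sum[OF F] closed_subfield_mult[OF F] closed_subfield_of_rat[OF F] w_in_F) auto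

lemma coord:
  assumes "x \<in> F"
  shows "x = (\<Sum>i<n. of_rat (coord x i) * w i)"
proof -
  obtain c where c: "\<forall>i<n. c i \<in> \<rat>" "x = (\<Sum>i<n. c i * w i)"
    using basis_of_coords[OF w assms] by blast
  then have "\<forall>i\<in>{..<n}. \<exists>q. c i = of_rat q" by (auto elim: Rats_cases)
  from bchoice[OF this] obtain q where "\<And>i. i < n \<Longrightarrow> c i = of_rat (q i)" by blast
  then have "x = (\<Sum>i<n. of_rat (q i) * w i)" using c(2) by simp
  then show ?thesis unfolding coord_def by (rule someI[where P = "\<lambda>c. x = (\<Sum>i<n. of_rat (c i) * w i)"])
qed

lemma coord_unique:
  assumes "x = (\<Sum>i<n. of_rat (c i) * w i)" "i < n"
  shows "coord x i = c i"
proof -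
  have "x \<in> F" using lincomb_in_F assms(1) by simp
  have "(\<Sum>i<n. of_rat (coord x i - c i) * w i) =
      (\<Sum>i<n. of_rat (coord x i) * w i) - (\<Sum>i<n. of_rat (c i) * w i)"
    by (simp add: of_rat_diff algebra_simps sum_subtractf)
  also have "\<dots> = 0" using coord[OF \<open>x \<in> F\<close>] assms(1) by simp
  finally have "(of_rat (coord x i - c i) :: 'a) = 0"
    by (intro basis_of_independent[OF w _ _ assms(2), where c = "\<lambda>i. of_rat (coord x i - c i)"]) auto
  then show ?thesis by simp
qed

lemma coord_lincomb:
  assumes "\<And>k. k \<in> A \<Longrightarrow> y k \<in> F" "i < n"
  shows "coord (\<Sum>k\<in>A. of_rat (q k) * y k) i = (\<Sum>k\<in>A. q k * coord (y k) i)"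
proof (rule coord_unique[OF _ assms(2)])
  have "(\<Sum>k\<in>A. of_rat (q k) * y k) = (\<Sum>k\<in>A. of_rat (q k) * (\<Sum>j<n. of_rat (coord (y k) j) * w j))"
    using assms coord by (intro sum.cong refl arg_cong2[where f = "(*)"]) auto
  also have "\<dots> = (\<Sum>k\<in>A. \<Sum>j<n. of_rat (q k * coord (y k) j) * w j)"
    by (simp add: sum_distrib_left of_rat_mult mult.assoc)
  also have "\<dots> = (\<Sum>j<n. \<Sum>k\<in>A. of_rat (q k * coord (y k) j) * w j)" by (rule sum.swap)
  finally show "(\<Sum>k\<in>A. of_rat (q k) * y k) = (\<Sum>i<n. of_rat (\<Sum>k\<in>A. q k * coord (y k) i) * w i)"
    by (simp add: of_rat_sum sum_distrib_right)
qed

lemma coord_w: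
  assumes "i < n" "j < n"
  shows "coord (w i) j = of_bool (i = j)"
proof (rule coord_unique[OF _ assms(2), where c = "\<lambda>j. of_bool (i = j)"])
  have "of_rat (of_bool (i = j)) * w j = (if j = i then w i else 0)" for j
    by (cases "i = j") simp_all
  then have "(\<Sum>j<n. of_rat (of_bool (i = j)) * w j) = (\<Sum>j<n. if j = i then w i else 0)"
    by (simp only:)
  then show "w i = (\<Sum>j<n. of_rat (of_bool (i = j)) * w j)" using assms by simp
qed

definition field_trace :: "'a \<Rightarrow> rat" where
  "field_trace x = (\<Sum>i<n. coord (x * w i) i)"

lemma field_trace_lincomb:
  assumes "\<And>k. k \<in> A \<Longrightarrow> y k \<in> F"
  shows "field_trace (\<Sum>k\<in>A. of_rat (q k) * y k) = (\<Sum>k\<in>A. q k * field_trace (y k))"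
proof -
  have "coord ((\<Sum>k\<in>A. of_rat (q k) * y k) * w i) i = (\<Sum>k\<in>A. q k * coord (y k * w i) i)" if "i < n" for i
  proof -
    have "(\<Sum>k\<in>A. of_rat (q k) * y k) * w i = (\<Sum>k\<in>A. of_rat (q k) * (y k * w i))"
      by (simp only: sum_distrib_right mult.assoc)
    then show ?thesis
      using coord_lincomb[OF closed_subfield_mult[OF F assms w_in_F[OF that]] that, where A = A and q = q] by simp
  qed
  then have "field_trace (\<Sum>k\<in>A. of_rat (q k) * y k) = (\<Sum>i<n. \<Sum>k\<in>A. q k * coord (y k * w i) i)"
    by (simp add: field_trace_def)
  also have "\<dots> = (\<Sum>k\<in>A. \<Sum>i<n. q k * coord (y k * w i) i)" by (rule sum.swap)
  finally show ?thesis by (simp add: field_trace_def sum_distrib_left)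
qed

lemma field_trace_1: "field_trace 1 = of_nat n"
  by (simp add: field_trace_def coord_w)

lemma n_pos: "n > 0"
  using basis_of_nonzero[OF w closed_subfield_1[OF F]] by auto

text \<open>
  An eigenvector \<open>v\<close> of the matrix of multiplication by \<open>x\<close> gives a linear form that multiplication
  by \<open>x\<close> scales by the eigenvalue, so the eigenvalue is a root of every polynomial vanishing at \<open>x\<close>.
\<close>

lemma eigenvalue_algebraic_int:
  assumes x: "x \<in> F" "algebraic_int x"
    and e: "eigenvalue (mat n n (\<lambda>(i, j). of_rat (coord (x * w i) j)) :: complex mat) e"
  shows "algebraic_int e"
proof -
  let ?A = "mat n n (\<lambda>(i, j). of_rat (coord (x * w i) j)) :: complex mat"
  obtain v where v: "v \<in> carrier_vec n" "v \<noteq> 0\<^sub>v n" "?A *\<^sub>v v = e \<cdot>\<^sub>v v"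
    using e by (auto simp: eigenvalue_def eigenvector_def)
  define \<phi> where "\<phi> y = (\<Sum>j<n. of_rat (coord y j) * vec_index v j)" for y
  have lin: "\<phi> (\<Sum>k\<in>A. of_rat (q k) * y k) = (\<Sum>k\<in>A. of_rat (q k) * \<phi> (y k))"
    if "\<And>k. k \<in> A \<Longrightarrow> y k \<in> F" for A :: "nat set" and q y
  proof -
    have "\<phi> (\<Sum>k\<in>A. of_rat (q k) * y k) = (\<Sum>j<n. \<Sum>k\<in>A. of_rat (q k) * (of_rat (coord (y k) j) * vec_index v j))"
      using that by (simp add: \<phi>_def coord_lincomb of_rat_sum of_rat_mult sum_distrib_right mult.assoc)
    also have "\<dots> = (\<Sum>k\<in>A. \<Sum>j<n. of_rat (q k) * (of_rat (coord (y k) j) * vec_index v j))"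
      by (rule sum.swap)
    finally show ?thesis by (simp add: \<phi>_def sum_distrib_left)
  qed
  have \<phi>w: "\<phi> (w i) = vec_index v i" if "i < n" for i
  proof -
    have "\<phi> (w i) = (\<Sum>j<n. if j = i then vec_index v i else 0)"
      unfolding \<phi>_def using that by (intro sum.cong) (simp_all add: coord_w)
    then show ?thesis using that by simp
  qed
  have \<phi>xw: "\<phi> (x * w i) = e * vec_index v i" if "i < n" for i
  proof -
    have "vec_index (?A *\<^sub>v v) i = \<phi> (x * w i)"
      using that v(1) by (simp add: \<phi>_def scalar_prod_def lessThan_atLeast0)
    then show ?thesis using v(1,3) that by simp
  qed
  have \<phi>x: "\<phi> (x * y) = e * \<phi> y" if y: "y \<in> F" for y
  proof -
    have "x * y = (\<Sum>i<n. of_rat (coord y i) * (x * w i))"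
      by (subst coord[OF y]) (simp add: sum_distrib_left algebra_simps)
    moreover have "x * w i \<in> F" if "i \<in> {..<n}" for i
      using that by (intro closed_subfield_mult[OF F x(1)] w_in_F) simp
    ultimately have "\<phi> (x * y) = (\<Sum>i<n. of_rat (coord y i) * \<phi> (x * w i))"
      using lin[of "{..<n}" "\<lambda>i. x * w i" "coord y"] by simp
    also have "\<dots> = (\<Sum>i<n. of_rat (coord y i) * (e * vec_index v i))" by (simp add: \<phi>xw)
    also have "\<dots> = e * \<phi> y" by (simp add: \<phi>_def sum_distrib_left algebra_simps)
    finally show ?thesis .
  qed
  have \<phi>power: "\<phi> (x ^ k * y) = e ^ k * \<phi> y" if y: "y \<in> F" for k y
  proof (induction k)
    case (Suc k)
    have "x ^ k * y \<in> F" by (intro closed_subfield_mult[OF F] closed_subfield_power[OF F] x y)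
    then show ?case using \<phi>x[of "x ^ k * y"] Suc by (simp add: mult.assoc)
  qed simp
  obtain p :: "int poly" where p: "poly (map_poly of_int p) x = 0" "Polynomial.lead_coeff p = 1"
    using x(2) unfolding algebraic_int_altdef_ipoly by auto
  obtain i where i: "i < n" "vec_index v i \<noteq> 0"
    using v(1,2) by (auto simp: vec_eq_iff)
  have "0 = poly (map_poly of_int p) x * w i" using p by simp
  also have "\<dots> = (\<Sum>k\<le>degree p. of_rat (of_int (coeff p k)) * (x ^ k * w i))"
    by (simp add: poly_altdef sum_distrib_right coeff_map_poly mult.assoc)
  finally have "\<phi> 0 = (\<Sum>k\<le>degree p. of_rat (of_int (coeff p k)) * \<phi> (x ^ k * w i))"
    by (subst lin[symmetric])
      (simp_all add: closed_subfield_mult[OF F closed_subfield_power[OF F x(1)] w_in_F[OF i(1)]])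
  also have "\<dots> = poly (map_poly of_int p) e * vec_index v i"
    using i by (simp add: \<phi>power w_in_F \<phi>w poly_altdef sum_distrib_right coeff_map_poly mult.assoc)
  finally have "poly (map_poly of_int p) e = 0" using lin[of "{}"] i(2) by simp
  then show ?thesis using p(2) unfolding algebraic_int_altdef_ipoly by auto
qed

end

section \<open>Integrality and nondegeneracy of the trace form\<close>

definition mat_trace :: "'a::comm_ring_1 mat \<Rightarrow> 'a" where
  "mat_trace A = (\<Sum>i<dim_row A. A $$ (i, i))"

lemma mat_trace_mult_commute:
  assumes "A \<in> carrier_mat n n" "B \<in> carrier_mat n n"
  shows "mat_trace (A * B) = mat_trace (B * A)"
proof -
  have "mat_trace (A * B) = (\<Sum>i<n. \<Sum>j<n. A $$ (i, j) * B $$ (j, i))"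
    using assms by (simp add: mat_trace_def scalar_prod_def lessThan_atLeast0)
  also have "\<dots> = (\<Sum>j<n. \<Sum>i<n. A $$ (i, j) * B $$ (j, i))" by (rule sum.swap)
  also have "\<dots> = mat_trace (B * A)"
    using assms by (simp add: mat_trace_def scalar_prod_def lessThan_atLeast0 mult.commute)
  finally show ?thesis .
qed

text \<open>The trace is invariant under similarity, and the Schur form of \<open>A\<close> carries
  the eigenvalues on its diagonal.\<close>

lemma mat_trace_eq_sum_eigenvalues:
  fixes A :: "complex mat"
  assumes A: "A \<in> carrier_mat n n" and es: "char_poly A = (\<Prod>e\<leftarrow>es. [:- e, 1:])"
  shows "mat_trace A = sum_list es"
proof -
  obtain B P Q where "schur_decomposition A es = (B, P, Q)" by (metis prod_cases3)
  from schur_decomposition[OF A es this]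
  have "similar_mat_wit A B P Q" and diag: "diag_mat B = es" by auto
  then have B: "B \<in> carrier_mat n n" and P: "P \<in> carrier_mat n n" and Q: "Q \<in> carrier_mat n n"
    and QP: "Q * P = 1\<^sub>m n" and eq: "A = P * B * Q"
    using A by (auto simp: similar_mat_wit_def Let_def)
  have "mat_trace A = mat_trace (P * (B * Q))" using eq P B Q by simp
  also have "\<dots> = mat_trace ((B * Q) * P)" using P B Q by (intro mat_trace_mult_commute[of _ n]) auto
  also have "(B * Q) * P = B" using P B Q QP by simp
  also have "mat_trace B = sum_list (diag_mat B)"
    by (simp add: mat_trace_def diag_mat_def sum_list_sum_nth lessThan_atLeast0)
  finally show ?thesis using diag by simp
qed

context integral_basis
begin

text \<open>The trace is the sum of the complex eigenvalues of multiplication by \<open>x\<close>,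
  hence an algebraic integer; being rational as well, it is an integer.\<close>

lemma field_trace_in_Ints:
  assumes x: "x \<in> F" "algebraic_int x"
  shows "field_trace x \<in> \<int>"
proof -
  define A where "A = (mat n n (\<lambda>(i, j). of_rat (coord (x * w i) j)) :: complex mat)"
  have A: "A \<in> carrier_mat n n" by (simp add: A_def)
  obtain es where es: "char_poly A = (\<Prod>e\<leftarrow>es. [:- e, 1:])" using char_poly_factorized[OF A] by blast
  have "algebraic_int e" if "e \<in> set es" for e
  proof -
    have "poly (char_poly A) e = 0"
      using that by (auto simp: es poly_prod_list prod_list_zero_iff)
    then have "eigenvalue A e" using eigenvalue_root_char_poly[OF A] by simp
    then show ?thesis unfolding A_def by (rule eigenvalue_algebraic_int[OF x])
  qed
  then have "algebraic_int (sum_list es)"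
    by (induction es) auto
  moreover have "mat_trace A = of_rat (field_trace x)"
    by (simp add: mat_trace_def A_def field_trace_def of_rat_sum)
  ultimately have "algebraic_int (of_rat (field_trace x) :: complex)"
    using mat_trace_eq_sum_eigenvalues[OF A es] by simp
  then have "(of_rat (field_trace x) :: complex) \<in> \<int>"
    by (rule rational_algebraic_int_is_int) simp
  then obtain m where "(of_rat (field_trace x) :: complex) = of_rat (of_int m)" by (auto elim: Ints_cases)
  then have "field_trace x = of_int m" by (simp only: of_rat_eq_iff)
  then show ?thesis by simp
qed

text \<open>The trace form is nondegenerate because \<open>y * inverse y = 1\<close> has trace \<open>n\<close>.\<close>

lemma trace_form_nondegenerate:
  fixes q :: "nat \<Rightarrow> rat"
  assumes "\<And>i. i < n \<Longrightarrow> (\<Sum>j<n. field_trace (w i * w j) * q j) = 0" "i < n"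
  shows "q i = 0"
proof (rule ccontr)
  assume "q i \<noteq> 0"
  define y where "y = (\<Sum>j<n. of_rat (q j) * w j)"
  have y: "y \<in> F" by (simp add: y_def lincomb_in_F)
  have "y \<noteq> 0"
  proof
    assume "y = 0"
    then have "coord 0 i = q i" using assms(2) by (intro coord_unique) (auto simp: y_def)
    moreover have "coord 0 i = 0" using assms(2) by (intro coord_unique) auto
    ultimately show False using \<open>q i \<noteq> 0\<close> by simp
  qed
  have "field_trace (w i * y) = 0" if "i < n" for i
  proof -
    have "w i * y = (\<Sum>j<n. of_rat (q j) * (w i * w j))"
      by (simp add: y_def sum_distrib_left algebra_simps)
    then have "field_trace (w i * y) = (\<Sum>j<n. q j * field_trace (w i * w j))"
      using field_trace_lincomb[OF closed_subfield_mult[OF F w_in_F[OF that] w_in_F], of "{..<n}" "\<lambda>j. j" q]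
      by simp
    then show ?thesis using assms(1)[OF that] by (simp add: mult.commute)
  qed
  moreover have "1 = (\<Sum>j<n. of_rat (coord (inverse y) j) * (w j * y))"
  proof -
    have "1 = inverse y * y" using \<open>y \<noteq> 0\<close> by simp
    also have "\<dots> = (\<Sum>j<n. of_rat (coord (inverse y) j) * (w j * y))"
      by (subst coord[OF closed_subfield_inverse[OF F y]]) (simp add: sum_distrib_right mult.assoc)
    finally show ?thesis .
  qed
  then have "field_trace 1 = (\<Sum>j<n. coord (inverse y) j * field_trace (w j * y))"
    using field_trace_lincomb[OF closed_subfield_mult[OF F w_in_F y], of "{..<n}" "\<lambda>j. j" "coord (inverse y)"]
    by simp
  ultimately show False using n_pos by (simp add: field_trace_1)
qed

text \<open>Cramer's rule for the Gram matrix of the trace form. For integral \<open>x\<close> it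
  maps the coordinates of \<open>x\<close> to the integers \<open>field_trace (x * w i)\<close>, so
  multiplying by the adjugate shows that its determinant \<open>D\<close>, the discriminant of the
  basis, clears the denominators of all coordinates.\<close>

lemma algebraic_int_bounded_denominator:
  obtains D :: int where "D \<noteq> 0"
    "\<And>x. x \<in> F \<Longrightarrow> algebraic_int x \<Longrightarrow> of_int D * x \<in> zspan (w ` {..<n})"
proof -
  have tr_int: "field_trace (y * w j) \<in> \<int>" if "y \<in> F" "algebraic_int y" "j < n" for y j
    using that by (intro field_trace_in_Ints closed_subfield_mult[OF F] w_in_F)
      (auto intro: algebraic_int_w)
  \<comment> \<open>The traces are integers already; the floors merely change their type, so that
    the adjugate is an integer matrix.\<close>
  define Z where "Z = mat n n (\<lambda>(i, j). \<lfloor>field_trace (w i * w j)\<rfloor>)"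
  define G where "G = map_mat (of_int :: int \<Rightarrow> rat) Z"
  have Z: "Z \<in> carrier_mat n n" and G: "G \<in> carrier_mat n n" by (auto simp: Z_def G_def)
  have G_index: "G $$ (i, j) = field_trace (w i * w j)" if "i < n" "j < n" for i j
    using that tr_int[OF w_in_F algebraic_int_w, of i j] by (auto simp: G_def Z_def elim: Ints_cases)
  define D where "D = Determinant.det Z"
  have detG: "Determinant.det G = of_int D" by (simp add: G_def D_def of_int_hom.hom_det)
  have "Determinant.det G \<noteq> 0"
  proof
    assume "Determinant.det G = 0"
    then obtain v where v: "v \<in> carrier_vec n" "v \<noteq> 0\<^sub>v n" "G *\<^sub>v v = 0\<^sub>v n"
      using det_0_iff_vec_prod_zero_field[OF G] by blast
    have "vec_index v i = 0" if "i < n" for i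
    proof (rule trace_form_nondegenerate[OF _ that])
      fix i assume "i < n"
      have "vec_index (G *\<^sub>v v) i = (\<Sum>j<n. field_trace (w i * w j) * vec_index v j)"
        using G v(1) \<open>i < n\<close> by (simp add: scalar_prod_def lessThan_atLeast0 G_index)
      then show "(\<Sum>j<n. field_trace (w i * w j) * vec_index v j) = 0" using v(3) \<open>i < n\<close> by simp
    qed
    then show False using v(1,2) by (auto simp: vec_eq_iff)
  qed
  then have "D \<noteq> 0" using detG by auto
  moreover have "of_int D * x \<in> zspan (w ` {..<n})" if x: "x \<in> F" "algebraic_int x" for x
  proof -
    define c where "c = vec n (coord x)"
    define b where "b = vec n (\<lambda>i. \<lfloor>field_trace (x * w i)\<rfloor>)"
    define R where "R = map_mat (of_int :: int \<Rightarrow> rat) (adj_mat Z)"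
    have R: "R \<in> carrier_mat n n" using adj_mat(1)[OF Z] by (simp add: R_def)
    have "G *\<^sub>v c = map_vec of_int b"
    proof (rule eq_vecI)
      fix i assume "i < dim_vec (map_vec of_int b)"
      then have i: "i < n" by (simp add: b_def)
      have "vec_index (G *\<^sub>v c) i = (\<Sum>j<n. field_trace (w i * w j) * coord x j)"
        using G i by (simp add: c_def scalar_prod_def lessThan_atLeast0 G_index)
      also have "\<dots> = field_trace (\<Sum>j<n. of_rat (coord x j) * (w i * w j))"
        using field_trace_lincomb[OF closed_subfield_mult[OF F w_in_F[OF i] w_in_F], of "{..<n}" "\<lambda>j. j" "coord x"]
        by (simp add: mult.commute)
      also have "(\<Sum>j<n. of_rat (coord x j) * (w i * w j)) = x * w i"
      proof -
        have "(\<Sum>j<n. of_rat (coord x j) * (w i * w j)) = (\<Sum>j<n. of_rat (coord x j) * w j) * w i"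
          unfolding sum_distrib_right by (intro sum.cong refl) simp
        then show ?thesis by (simp only: coord[OF x(1), symmetric])
      qed
      finally show "vec_index (G *\<^sub>v c) i = vec_index (map_vec of_int b) i"
        using i tr_int[OF x i] by (auto simp: b_def elim: Ints_cases)
    qed (use G in \<open>simp add: b_def\<close>)
    moreover have "R * G = of_int D \<cdot>\<^sub>m 1\<^sub>m n"
    proof -
      have "R * G = map_mat of_int (adj_mat Z * Z)"
        unfolding R_def G_def by (rule of_int_hom.mat_hom_mult[symmetric, OF adj_mat(1)[OF Z] Z])
      also have "adj_mat Z * Z = D \<cdot>\<^sub>m 1\<^sub>m n" using adj_mat(3)[OF Z] by (simp add: D_def)
      finally show ?thesis by (auto intro!: eq_matI)
    qed
    then have "R *\<^sub>v (G *\<^sub>v c) = of_int D \<cdot>\<^sub>v c"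
      using R G by (subst assoc_mult_mat_vec[symmetric]) (auto simp: c_def intro!: eq_vecI)
    ultimately have "of_int D \<cdot>\<^sub>v c = R *\<^sub>v map_vec of_int b" by simp
    also have "\<dots> = map_vec of_int (adj_mat Z *\<^sub>v b)"
      unfolding R_def by (rule of_int_hom.mult_mat_vec_hom[symmetric, OF adj_mat(1)[OF Z]]) (simp add: b_def)
    finally have eq: "of_int D \<cdot>\<^sub>v c = map_vec of_int (adj_mat Z *\<^sub>v b)" .
    have *: "of_int D * coord x i = of_int (vec_index (adj_mat Z *\<^sub>v b) i)" if "i < n" for i
      using that arg_cong[OF eq, of "\<lambda>v. vec_index v i"] adj_mat(1)[OF Z] by (simp add: c_def)
    have "of_int D * x = (\<Sum>i<n. of_rat (of_int D * coord x i) * w i)"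
      by (subst coord[OF x(1)]) (simp add: sum_distrib_left of_rat_mult mult.assoc)
    also have "\<dots> = (\<Sum>i<n. of_int (vec_index (adj_mat Z *\<^sub>v b) i) * w i)"
      by (intro sum.cong) (auto simp: *)
    also have "\<dots> \<in> zspan (w ` {..<n})" by (intro zspan_sum zspan_of_int_mult zspan.base) auto
    finally show ?thesis .
  qed
  ultimately show ?thesis by (rule that)
qed

end

section \<open>Finiteness of the class number\<close>

locale number_field_locale =
  fixes F :: "'a::field_char_0 set"
  assumes number_field: "number_field F"
begin

abbreviation "R \<equiv> ring_of_integers F"

lemmas F = number_field_closed_subfield[OF number_field]

lemma R_iff: "x \<in> R \<longleftrightarrow> x \<in> F \<and> algebraic_int x"
  by (simp add: ring_of_integers_def)

lemma R_subset_F: "R \<subseteq> F"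
  by (auto simp: R_iff)

lemma of_int_in_R: "of_int c \<in> R"
  by (auto simp: R_iff intro: closed_subfield_of_int[OF F] int_imp_algebraic_int)

lemma zero_in_R: "0 \<in> R" and one_in_R: "1 \<in> R"
  using of_int_in_R[of 0] of_int_in_R[of 1] by auto

lemma mult_in_R: "x \<in> R \<Longrightarrow> y \<in> R \<Longrightarrow> x * y \<in> R"
  by (auto simp: R_iff intro: closed_subfield_mult[OF F])

lemma additive_subgroup_R: "additive_subgroup R"
  by (auto simp: R_iff additive_subgroup_def intro: closed_subfield_diff[OF F] closed_subfield_0[OF F])

lemma denominator:
  assumes "x \<in> F"
  obtains d :: nat where "d > 0" "of_nat d * x \<in> R"
proof -
  obtain d :: nat where d: "d > 0" "algebraic_int (of_nat d * x)"
    by (rule number_field_denominator[OF number_field assms])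
  moreover have "of_nat d * x \<in> F"
    by (intro closed_subfield_mult[OF F] closed_subfield_of_nat[OF F] assms)
  ultimately show ?thesis using that by (simp add: R_iff)
qed

text \<open>A denominator of \<open>inverse x\<close> is a multiple of \<open>x\<close>. It follows
  that a nonzero ideal of \<open>R\<close> contains a positive integer and so has finite
  index.\<close>

lemma R_divides_int:
  assumes "x \<in> R" "x \<noteq> 0"
  obtains c :: nat and y where "c > 0" "y \<in> R" "of_nat c = x * y"
proof -
  have "inverse x \<in> F" using assms by (auto simp: R_iff intro: closed_subfield_inverse[OF F])
  then obtain d :: nat where "d > 0" "of_nat d * inverse x \<in> R" by (rule denominator)
  moreover have "of_nat d = x * (of_nat d * inverse x)" using assms(2) by simp
  ultimately show ?thesis by (rule that)
qed

text \<open>A fixed multiple of \<open>R\<close> lies in the lattice spanned by the integral basis,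
  so \<open>R\<close> is a subgroup of a finitely generated group.\<close>

lemma R_finitely_generated:
  obtains u :: "nat \<Rightarrow> 'a" and m where "R = zspan (u ` {..<m})"
proof -
  obtain n w where "integral_basis F n w" by (rule number_field_integral_basis[OF number_field])
  then interpret integral_basis F n w .
  obtain D :: int where D: "D \<noteq> 0" "\<And>x. x \<in> F \<Longrightarrow> algebraic_int x \<Longrightarrow> of_int D * x \<in> zspan (w ` {..<n})"
    using algebraic_int_bounded_denominator by blast
  have "R \<subseteq> zspan ((\<lambda>x. x / of_int D) ` w ` {..<n})"
  proof
    fix x assume "x \<in> R"
    then have b: "of_int D * x \<in> zspan (w ` {..<n})" using D(2) by (simp add: R_iff)
    have a: "1 / of_int D \<in> zspan {1 / of_int D :: 'a}" by (simp add: zspan.base)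
    have "(1 / of_int D) * (of_int D * x) \<in> zspan ((\<lambda>x. x / of_int D) ` w ` {..<n})"
      by (rule zspan_mult_closed[OF _ additive_subgroup_zspan a b])
        (auto intro!: zspan.base image_eqI[OF _ imageI])
    then show "x \<in> zspan ((\<lambda>x. x / of_int D) ` w ` {..<n})" using D(1) by simp
  qed
  then obtain V where V: "finite V" "R = zspan V"
    using additive_subgroup_finitely_generated[OF _ additive_subgroup_R, of "(\<lambda>x. x / of_int D) ` w ` {..<n}"]
    by blast
  obtain u :: "nat \<Rightarrow> 'a" and m where "V = u ` {..<m}" using V(1) by (rule finite_indexed)
  then show ?thesis using that V(2) by simp
qed

text \<open>Reducing the coefficients with respect to generators of \<open>R\<close> modulo
  \<open>c\<close> yields the representatives. The generators may be dependent, so a class can be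
  represented more than once.\<close>

lemma R_finite_mod:
  assumes "c > 0"
  obtains T where "finite T" "T \<subseteq> R" "\<And>x. x \<in> R \<Longrightarrow> \<exists>t\<in>T. \<exists>y\<in>R. x - t = of_nat c * y"
proof -
  obtain u :: "nat \<Rightarrow> 'a" and m where u: "R = zspan (u ` {..<m})" by (rule R_finitely_generated)
  define g where "g r = (\<Sum>i<m. of_int (r i) * u i)" for r :: "nat \<Rightarrow> int"
  have g: "g r \<in> R" for r
    unfolding u g_def by (intro zspan_sum zspan_of_int_mult zspan.base) auto
  define T where "T = g ` ({..<m} \<rightarrow>\<^sub>E {0..<int c})"
  show ?thesis
  proof (rule that[of T])
    show "finite T" unfolding T_def by (intro finite_imageI finite_PiE) auto
    show "T \<subseteq> R" using g by (auto simp: T_def)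
    fix x assume "x \<in> R"
    then obtain a :: "nat \<Rightarrow> int" where x: "x = g a" unfolding u g_def by (rule zspan_image_indexed)
    define r where "r = restrict (\<lambda>i. a i mod int c) {..<m}"
    have "r \<in> {..<m} \<rightarrow>\<^sub>E {0..<int c}" using assms by (auto simp: r_def)
    moreover have "x - g r = of_nat c * g (\<lambda>i. a i div int c)"
    proof -
      have "(of_int (a i) :: 'a) - of_int (r i) = of_nat c * of_int (a i div int c)" if "i < m" for i
      proof -
        have "a i - r i = int c * (a i div int c)"
          using that by (simp add: r_def minus_mod_eq_mult_div)
        then have "(of_int (a i - r i) :: 'a) = of_int (int c * (a i div int c))" by simp
        then show ?thesis by simp
      qed
      then have "(\<Sum>i<m. (of_int (a i) - of_int (r i)) * u i) = (\<Sum>i<m. of_nat c * of_int (a i div int c) * u i)"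
        by (intro sum.cong) auto
      then show ?thesis
        by (simp add: x g_def sum_subtractf[symmetric] left_diff_distrib[symmetric] sum_distrib_left mult.assoc)
    qed
    ultimately show "\<exists>t\<in>T. \<exists>y\<in>R. x - t = of_nat c * y"
      using g unfolding T_def by blast
  qed
qed

text \<open>
  Every residue class modulo \<open>\<beta>\<close> has a representative in the fundamental parallelepiped spanned by
  \<open>\<beta> * w 0, \<beta> * w 1, \<dots>\<close>, whose coordinates are bounded linearly in those of \<open>\<beta>\<close>.  This replaces the
  norm in the classical proof.
\<close>

lemma residues_bounded:
  assumes "integral_basis F n w"
  obtains E :: nat where
    "\<And>b \<beta> B T. \<beta> = (\<Sum>i<n. of_int (b i) * w i) \<Longrightarrow> \<beta> \<noteq> 0 \<Longrightarrow> (\<And>i. i < n \<Longrightarrow> \<bar>b i\<bar> \<le> int B) \<Longrightarrow> B > 0 \<Longrightarrow>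
      T \<subseteq> R \<Longrightarrow> (\<And>s t y. s \<in> T \<Longrightarrow> t \<in> T \<Longrightarrow> y \<in> R \<Longrightarrow> s - t = \<beta> * y \<Longrightarrow> s = t) \<Longrightarrow>
      finite T \<and> card T \<le> E * B ^ n"
proof -
  interpret integral_basis F n w by fact
  obtain D0 :: int where D0: "D0 \<noteq> 0" "\<And>x. x \<in> F \<Longrightarrow> algebraic_int x \<Longrightarrow> of_int D0 * x \<in> zspan (w ` {..<n})"
    using algebraic_int_bounded_denominator by blast
  define D where "D = nat \<bar>D0\<bar>"
  have D_pos: "D > 0" using D0(1) by (simp add: D_def)
  have D: "of_nat D * coord x i \<in> \<int>" if x: "x \<in> R" and i: "i < n" for x i
  proof -
    have "of_int D0 * x \<in> zspan (w ` {..<n})" using D0(2) x by (simp add: R_iff)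
    then obtain c :: "nat \<Rightarrow> int" where c: "of_int D0 * x = (\<Sum>i<n. of_int (c i) * w i)"
      by (rule zspan_image_indexed)
    have "coord (of_int D0 * x) i = of_int (c i)"
      using c i by (intro coord_unique) auto
    moreover have "coord (of_int D0 * x) i = of_int D0 * coord x i"
      using coord_lincomb[of "{0::nat}" "\<lambda>_. x" i "\<lambda>_. of_int D0"] x i by (simp add: R_iff)
    ultimately have "of_int D0 * coord x i \<in> \<int>" by simp
    moreover have "of_nat D * coord x i = of_int D0 * coord x i \<or> of_nat D * coord x i = - (of_int D0 * coord x i)"
      by (cases "D0 \<ge> 0") (auto simp: D_def)
    ultimately show ?thesis by (metis Ints_minus)
  qed
  \<comment> \<open>A bound for the structure constants of multiplication in the basis
    \<open>w\<close>.\<close>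
  define K where "K = nat \<lceil>Max ((\<lambda>(i, j, l). \<bar>coord (w i * w j) l\<bar>) ` ({..<n} \<times> {..<n} \<times> {..<n}))\<rceil>"
  have K: "\<bar>coord (w i * w j) l\<bar> \<le> of_nat K" if "i < n" "j < n" "l < n" for i j l
  proof -
    have "\<bar>coord (w i * w j) l\<bar> \<le> Max ((\<lambda>(i, j, l). \<bar>coord (w i * w j) l\<bar>) ` ({..<n} \<times> {..<n} \<times> {..<n}))"
      using that by (intro Max_ge) (auto intro!: image_eqI[of _ _ "(i, j, l)"])
    also have "\<dots> \<le> of_nat K" unfolding K_def by (rule of_nat_ceiling)
    finally show ?thesis .
  qed
  \<comment> \<open>Coordinates of \<open>\<beta> * w j\<close> are at most \<open>n * B * K\<close>
    in absolute value, and a point of the parallelepiped is a sum of \<open>n\<close> fractions of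
    these vectors, which gives the second factor \<open>n\<close>. After clearing the denominator
    \<open>D\<close>, the coordinates of a reduced residue are integers of absolute value at most
    \<open>E * B\<close>.\<close>
  define E where "E = D * n * n * K"
  show ?thesis
  proof (rule that[of "(2 * E + 1) ^ n"])
    fix b \<beta> B T
    assume \<beta>: "\<beta> = (\<Sum>i<n. of_int (b i) * w i)" "\<beta> \<noteq> 0" and b: "\<And>i. i < n \<Longrightarrow> \<bar>b i\<bar> \<le> int B" and B: "B > 0"
      and T: "T \<subseteq> R" "\<And>s t y. s \<in> T \<Longrightarrow> t \<in> T \<Longrightarrow> y \<in> R \<Longrightarrow> s - t = \<beta> * y \<Longrightarrow> s = t"
    have \<beta>F: "\<beta> \<in> F" unfolding \<beta>(1)
      by (intro closed_subfield_sum[OF F] closed_subfield_mult[OF F] closed_subfield_of_int[OF F] w_in_F) auto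
    have w_R: "w i \<in> R" if "i < n" for i using that w_in_F algebraic_int_w by (simp add: R_iff)
    have \<beta>R: "\<beta> \<in> R" unfolding \<beta>(1)
      by (intro additive_subgroup_sum[OF additive_subgroup_R] mult_in_R of_int_in_R w_R) auto
    have \<beta>w: "\<bar>coord (\<beta> * w j) l\<bar> \<le> of_nat (n * B * K)" if jl: "j < n" "l < n" for j l
    proof -
      have "\<beta> * w j = (\<Sum>i<n. of_rat (of_int (b i)) * (w i * w j))"
        unfolding \<beta>(1) sum_distrib_right by (intro sum.cong refl) simp
      then have "coord (\<beta> * w j) l = (\<Sum>i<n. of_int (b i) * coord (w i * w j) l)"
        using jl closed_subfield_mult[OF F w_in_F w_in_F]
        by (simp only:) (rule coord_lincomb, auto)
      then have "\<bar>coord (\<beta> * w j) l\<bar> \<le> (\<Sum>i<n. \<bar>of_int (b i) * coord (w i * w j) l\<bar>)"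
        by (simp only: sum_abs)
      also have "\<dots> \<le> (\<Sum>i<n. of_nat (B * K))"
      proof (rule sum_mono)
        fix i assume "i \<in> {..<n}"
        then have "\<bar>of_int (b i)\<bar> \<le> (of_nat B :: rat)" using b[of i]
          by (metis lessThan_iff of_int_abs of_int_le_iff of_int_of_nat_eq)
        then show "\<bar>of_int (b i) * coord (w i * w j) l\<bar> \<le> of_nat (B * K)"
          using K[of i j l] jl \<open>i \<in> {..<n}\<close> unfolding abs_mult of_nat_mult by (intro mult_mono) auto
      qed
      finally show ?thesis by simp
    qed
    define q where "q t = coord (inverse \<beta> * t)" for t
    define red where "red t = t - \<beta> * (\<Sum>i<n. of_int \<lfloor>q t i\<rfloor> * w i)" for t
    have red_R: "red t \<in> R" if "t \<in> R" for t
      unfolding red_def using that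
      by (intro additive_subgroup_diff[OF additive_subgroup_R] mult_in_R \<beta>R
          additive_subgroup_sum[OF additive_subgroup_R] of_int_in_R w_R) auto
    have red_bound: "\<bar>coord (red t) l\<bar> \<le> of_nat (n * (n * B * K))" if t: "t \<in> R" and l: "l < n" for t l
    proof -
      have "inverse \<beta> * t \<in> F"
        using t R_subset_F by (intro closed_subfield_mult[OF F] closed_subfield_inverse[OF F] \<beta>F) auto
      then have "inverse \<beta> * t = (\<Sum>i<n. of_rat (q t i) * w i)" unfolding q_def by (rule coord)
      moreover have t_eq: "\<beta> * (inverse \<beta> * t) = t" using \<beta>(2) by simp
      ultimately have "t = \<beta> * (\<Sum>i<n. of_rat (q t i) * w i)"
        using arg_cong[of _ _ "\<lambda>z. \<beta> * z"] by metis
      then have "red t = \<beta> * (\<Sum>i<n. of_rat (q t i) * w i) - \<beta> * (\<Sum>i<n. of_int \<lfloor>q t i\<rfloor> * w i)"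
        unfolding red_def by simp
      also have "\<dots> = (\<Sum>i<n. of_rat (frac (q t i)) * (\<beta> * w i))"
        by (simp add: frac_def of_rat_diff sum_distrib_left sum_subtractf[symmetric] algebra_simps)
      finally have "coord (red t) l = (\<Sum>i<n. frac (q t i) * coord (\<beta> * w i) l)"
        using l closed_subfield_mult[OF F \<beta>F w_in_F]
        by (simp only:) (rule coord_lincomb, auto)
      then have "\<bar>coord (red t) l\<bar> \<le> (\<Sum>i<n. \<bar>frac (q t i) * coord (\<beta> * w i) l\<bar>)"
        by (simp only: sum_abs)
      also have "\<dots> \<le> (\<Sum>i<n. of_nat (n * B * K))"
      proof (rule sum_mono)
        fix i assume "i \<in> {..<n}"
        have "\<bar>frac (q t i)\<bar> \<le> 1" using frac_ge_0[of "q t i"] frac_lt_1[of "q t i"] by simp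
        then have "\<bar>frac (q t i)\<bar> * \<bar>coord (\<beta> * w i) l\<bar> \<le> 1 * of_nat (n * B * K)"
          using \<beta>w[of i l] l \<open>i \<in> {..<n}\<close> by (intro mult_mono) auto
        then show "\<bar>frac (q t i) * coord (\<beta> * w i) l\<bar> \<le> of_nat (n * B * K)"
          by (simp add: abs_mult)
      qed
      finally show ?thesis by simp
    qed
    define h where "h t = restrict (\<lambda>l. \<lfloor>of_nat D * coord (red t) l\<rfloor>) {..<n}" for t
    have h: "of_int (h t l) = of_nat D * coord (red t) l" if "t \<in> R" "l < n" for t l
      using D[OF red_R[OF that(1)] that(2)] that(2) by (auto simp: h_def elim: Ints_cases)
    have "h ` T \<subseteq> {..<n} \<rightarrow>\<^sub>E {- int (E * B)..int (E * B)}"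
    proof clarify
      fix t assume t: "t \<in> T"
      have "\<bar>h t l\<bar> \<le> int (E * B)" if "l < n" for l
      proof -
        have tR: "t \<in> R" using T(1) t by auto
        have "(of_int \<bar>h t l\<bar> :: rat) = of_nat D * \<bar>coord (red t) l\<bar>"
          using h[OF tR that] by (simp add: abs_mult)
        also have "\<dots> \<le> of_nat D * of_nat (n * (n * B * K))"
          by (intro mult_left_mono red_bound tR that) simp
        also have "\<dots> = of_int (int (E * B))" by (simp add: E_def)
        finally show ?thesis by (simp only: of_int_le_iff)
      qed
      then have "- int (E * B) \<le> h t l \<and> h t l \<le> int (E * B)" if "l < n" for l
        using that by (auto simp only: abs_le_iff minus_le_iff)
      moreover have "h t \<in> extensional {..<n}" by (simp add: h_def)
      ultimately show "h t \<in> {..<n} \<rightarrow>\<^sub>E {- int (E * B)..int (E * B)}"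
        by (simp add: PiE_def Pi_def)
    qed
    moreover have "inj_on h T"
    proof (rule inj_onI)
      fix s t assume st: "s \<in> T" "t \<in> T" "h s = h t"
      have R: "s \<in> R" "t \<in> R" using T(1) st(1,2) by blast+
      have "coord (red s) l = coord (red t) l" if "l < n" for l
        using h[OF R(1) that] h[OF R(2) that] st(3) D_pos by simp
      then have "(\<Sum>l<n. of_rat (coord (red s) l) * w l) = (\<Sum>l<n. of_rat (coord (red t) l) * w l)"
        by simp
      then have "red s = red t"
        using coord[OF subsetD[OF R_subset_F red_R[OF R(1)]]] coord[OF subsetD[OF R_subset_F red_R[OF R(2)]]]
        by metis
      then have "s - t = \<beta> * ((\<Sum>i<n. of_int \<lfloor>q s i\<rfloor> * w i) - (\<Sum>i<n. of_int \<lfloor>q t i\<rfloor> * w i))"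
        by (simp add: red_def algebra_simps)
      moreover have "(\<Sum>i<n. of_int \<lfloor>q s i\<rfloor> * w i) - (\<Sum>i<n. of_int \<lfloor>q t i\<rfloor> * w i) \<in> R"
        by (intro additive_subgroup_diff[OF additive_subgroup_R] mult_in_R
          additive_subgroup_sum[OF additive_subgroup_R] of_int_in_R w_R) auto
      ultimately show "s = t" using T(2) st by blast
    qed
    moreover have fin: "finite ({..<n} \<rightarrow>\<^sub>E {- int (E * B)..int (E * B)})" by (intro finite_PiE) auto
    ultimately have "finite T" "card T \<le> card ({..<n} \<rightarrow>\<^sub>E {- int (E * B)..int (E * B)})"
      by (auto intro: inj_on_finite card_inj_on_le)
    moreover have "card ({..<n} \<rightarrow>\<^sub>E {- int (E * B)..int (E * B)}) = (2 * (E * B) + 1) ^ n"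
      by (simp add: card_PiE nat_add_distrib nat_mult_distrib mult.commute)
    moreover have "(2 * (E * B) + 1) ^ n \<le> ((2 * E + 1) * B) ^ n"
      using B by (intro power_mono) (auto simp: algebra_simps)
    ultimately show "finite T \<and> card T \<le> (2 * E + 1) ^ n * B ^ n"
      unfolding power_mult_distrib[symmetric] by (metis le_trans)
  qed
qed

text \<open>Two pigeonhole arguments around the index \<open>N\<close> of \<open>I\<close> in
  \<open>R\<close>. More than \<open>N\<close> elements have coordinates between 0 and
  \<open>B\<close>, the integer \<open>n\<close>-th root of \<open>N\<close>, so two of them differ
  by some \<beta> in \<open>I\<close> with small coordinates. There are at most
  \<open>E * B ^ n \<le> E * N\<close> classes modulo \<beta>, fewer than the
  \<open>N * (E + 1)\<close> elements \<open>s + of_nat j * x\<close> with \<open>s\<close> running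
  over representatives of \<open>R\<close> modulo \<open>I\<close> and \<open>j \<le> E\<close>. A
  coincidence modulo \<beta> forces equal \<open>s\<close>, and the difference of the two
  \<open>j\<close> is the desired \<open>t\<close>. The bound \<open>E\<close> is the same for all
  \<open>I\<close>.\<close>

lemma ideal_almost_principal:
  obtains C :: nat where
    "\<And>I. fractional_ideal F I \<Longrightarrow> I \<subseteq> R \<Longrightarrow>
      \<exists>\<beta>\<in>I - {0}. \<forall>x\<in>I. \<exists>t\<in>{1..C}. \<exists>y\<in>R. of_nat t * x = \<beta> * y"
proof -
  obtain n w where ib: "integral_basis F n w" by (rule number_field_integral_basis[OF number_field])
  then interpret integral_basis F n w .
  obtain E :: nat where E:
    "\<And>b \<beta> B T. \<beta> = (\<Sum>i<n. of_int (b i) * w i) \<Longrightarrow> \<beta> \<noteq> 0 \<Longrightarrow> (\<And>i. i < n \<Longrightarrow> \<bar>b i\<bar> \<le> int B) \<Longrightarrow> B > 0 \<Longrightarrow>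
      T \<subseteq> R \<Longrightarrow> (\<And>s t y. s \<in> T \<Longrightarrow> t \<in> T \<Longrightarrow> y \<in> R \<Longrightarrow> s - t = \<beta> * y \<Longrightarrow> s = t) \<Longrightarrow>
      finite T \<and> card T \<le> E * B ^ n"
    by (rule residues_bounded[OF ib]) blast
  have w_R: "w i \<in> R" if "i < n" for i using that w_in_F algebraic_int_w by (simp add: R_iff)
  show ?thesis
  proof (rule that[of E])
    fix I assume I: "fractional_ideal F I" "I \<subseteq> R"
    have I_add: "additive_subgroup I"
    proof (rule additive_subgroupI)
      show "0 \<in> I" using I by (simp add: fractional_ideal_def)
      fix x y assume xy: "x \<in> I" "y \<in> I"
      have "of_int (- 1) * y \<in> I" using I(1) xy(2) of_int_in_R unfolding fractional_ideal_def by blast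
      then have "x + of_int (- 1) * y \<in> I" using I(1) xy(1) unfolding fractional_ideal_def by blast
      then show "x - y \<in> I" by simp
    qed
    have I_mult: "a * x \<in> I" if "a \<in> R" "x \<in> I" for a x
      using I(1) that unfolding fractional_ideal_def by blast
    obtain x0 where x0: "x0 \<in> I" "x0 \<noteq> 0" using I(1) by (auto simp: fractional_ideal_def)
    obtain c :: nat and y0 where c: "c > 0" "y0 \<in> R" "of_nat c = x0 * y0"
      using R_divides_int[of x0] x0 I(2) by auto
    \<comment> \<open>The integer \<open>c\<close> lies in \<open>I\<close>, so representatives
      modulo \<open>c\<close> meet every class modulo \<open>I\<close>, and the index is
      finite.\<close>
    obtain T0 where T0: "finite T0" "T0 \<subseteq> R" "\<And>x. x \<in> R \<Longrightarrow> \<exists>t\<in>T0. \<exists>y\<in>R. x - t = of_nat c * y"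
      using R_finite_mod[OF c(1)] by blast
    define cls where "cls x = {y \<in> R. y - x \<in> I}" for x
    have cls_eq: "cls x = cls y \<longleftrightarrow> x - y \<in> I" if "x \<in> R" "y \<in> R" for x y
    proof
      assume "cls x = cls y"
      moreover have "x \<in> cls x" using that additive_subgroup_0[OF I_add] by (simp add: cls_def)
      ultimately show "x - y \<in> I" by (auto simp: cls_def)
    next
      assume xy: "x - y \<in> I"
      have "z - x \<in> I \<longleftrightarrow> z - y \<in> I" for z
        using additive_subgroup_add[OF I_add xy, of "z - x"] additive_subgroup_diff[OF I_add _ xy, of "z - y"]
        by (auto simp: algebra_simps)
      then show "cls x = cls y" by (simp add: cls_def)
    qed
    have "cls ` R \<subseteq> cls ` T0"
    proof clarify
      fix x assume x: "x \<in> R"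
      then obtain t y where t: "t \<in> T0" "y \<in> R" "x - t = of_nat c * y" using T0(3) by blast
      have "x - t = (y0 * y) * x0" using t(3) c(3) by simp
      also have "\<dots> \<in> I" by (intro I_mult mult_in_R c t x0)
      finally show "cls x \<in> cls ` T0" using cls_eq[OF x, of t] t(1) T0(2) by auto
    qed
    then have fin: "finite (cls ` R)" using T0(1) finite_surj by blast
    define N where "N = card (cls ` R)"
    have N: "N > 0" using fin zero_in_R unfolding N_def by (subst card_gt_0_iff) auto
    obtain TI where TI: "TI \<subseteq> R" "inj_on cls TI" "cls ` R = cls ` TI"
      using subset_image_inj[of "cls ` R" cls R] by auto
    have card_TI: "card TI = N" "finite TI"
      using TI fin by (auto simp: N_def card_image finite_image_iff)
    \<comment> \<open>The largest \<open>B\<close> with \<open>B ^ n \<le> N\<close>: small enough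
      for the final count, while \<open>N < (B + 1) ^ n\<close> supplies the first
      pigeonhole.\<close>
    define B where "B = Max {B. B ^ n \<le> N}"
    have le: "B \<le> N" if "B ^ n \<le> N" for B
      using that n_pos by (metis le_trans self_le_power less_one linorder_not_le zero_le)
    have finB: "finite {B. B ^ n \<le> N}" by (rule finite_subset[of _ "{..N}"]) (auto dest: le)
    have B1: "1 \<in> {B. B ^ n \<le> N}" using N by simp
    have B: "B ^ n \<le> N" using Max_in[OF finB] B1 unfolding B_def by blast
    have B_pos: "B > 0" using Max_ge[OF finB B1] unfolding B_def by simp
    have B_Suc: "N < (B + 1) ^ n"
    proof (rule ccontr)
      assume "\<not> N < (B + 1) ^ n"
      then have "B + 1 \<le> B" using Max_ge[OF finB, of "B + 1"] unfolding B_def by simp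
      then show False by simp
    qed
    define g where "g a = (\<Sum>i<n. of_int (a i) * w i)" for a :: "nat \<Rightarrow> int"
    have gR: "g a \<in> R" for a
      unfolding g_def by (intro additive_subgroup_sum[OF additive_subgroup_R] mult_in_R of_int_in_R w_R) auto
    let ?A = "{..<n} \<rightarrow>\<^sub>E {0..int B}"
    have "card ?A = (B + 1) ^ n" by (simp add: card_PiE nat_add_distrib)
    moreover have "card ((cls \<circ> g) ` ?A) \<le> N"
      unfolding N_def using gR by (intro card_mono fin) auto
    ultimately have "\<not> inj_on (cls \<circ> g) ?A" using B_Suc by (auto dest!: card_image)
    then obtain a a' where a: "a \<in> ?A" "a' \<in> ?A" "a \<noteq> a'" "cls (g a) = cls (g a')"
      by (auto simp: inj_on_def)
    define b where "b i = a i - a' i" for i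
    define \<beta> where "\<beta> = g b"
    have "\<beta> = g a - g a'" by (simp add: \<beta>_def g_def b_def sum_subtractf[symmetric] algebra_simps)
    then have \<beta>I: "\<beta> \<in> I" using a(4) cls_eq gR by simp
    have "\<beta> \<noteq> 0"
    proof
      assume "\<beta> = 0"
      then have "(\<Sum>i<n. of_int (b i) * w i) = 0" by (simp add: \<beta>_def g_def)
      then have "(of_int (b i) :: 'a) = 0" if "i < n" for i
        by (intro basis_of_independent[OF w _ _ that, where c = "\<lambda>i. of_int (b i)"]) auto
      then have "a i = a' i" if "i < n" for i using that by (simp add: b_def)
      then show False using a(1-3) by (metis PiE_ext lessThan_iff)
    qed
    have b_bound: "\<bar>b i\<bar> \<le> int B" if "i < n" for i
      using a(1,2) that by (force simp: b_def PiE_iff)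
    have "\<exists>t\<in>{1..E}. \<exists>y\<in>R. of_nat t * x = \<beta> * y" if x: "x \<in> I" for x
    proof (rule ccontr)
      assume neg: "\<not> ?thesis"
      have neg': "j = j'" if "j \<le> j'" "j' \<le> E" "y \<in> R" "of_nat j' * x - of_nat j * x = \<beta> * y" for j j' y
      proof (rule ccontr)
        assume "j \<noteq> j'"
        then have "j' - j \<in> {1..E}" using that by auto
        moreover have "of_nat (j' - j) * x = \<beta> * y" using that by (simp add: of_nat_diff left_diff_distrib)
        ultimately show False using neg that(3) by blast
      qed
      \<comment> \<open>Under the assumption to be refuted these \<open>N * (E + 1)\<close> elements
        are pairwise incongruent modulo \<beta>.\<close>
      define f where "f = (\<lambda>(s, j). s + of_nat j * x)"
      have \<beta>y: "\<beta> * y \<in> I" if "y \<in> R" for y using I_mult[OF that \<beta>I] by (simp add: mult.commute)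
      have nx: "of_nat j * x \<in> I" for j using additive_subgroup_of_nat_mult[OF I_add x] .
      have key: "u = v" if uv: "u \<in> TI \<times> {..E}" "v \<in> TI \<times> {..E}" and y: "y \<in> R" "f u - f v = \<beta> * y" for u v y
      proof -
        obtain s j s' j' where eq: "u = (s, j)" "v = (s', j')" "s \<in> TI" "s' \<in> TI" "j \<le> E" "j' \<le> E"
          using uv by auto
        have "s - s' = \<beta> * y - (of_nat j * x - of_nat j' * x)"
          using y(2) by (simp add: f_def eq algebra_simps)
        also have "\<dots> \<in> I" using \<beta>y[OF y(1)] nx by (intro additive_subgroup_diff[OF I_add])
        finally have "cls s = cls s'" using cls_eq eq TI(1) by auto
        then have "s = s'" using TI(2) eq by (auto dest: inj_onD)
        then have "of_nat j * x - of_nat j' * x = \<beta> * y" using y(2) by (simp add: f_def eq)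
        moreover from this have "of_nat j' * x - of_nat j * x = \<beta> * (- y)" by (simp add: algebra_simps)
        ultimately have "j = j'"
          using neg'[of j j' "- y"] neg'[of j' j y] y(1) additive_subgroup_uminus[OF additive_subgroup_R y(1)] eq(5,6)
          by (cases "j \<le> j'") auto
        then show ?thesis using eq \<open>s = s'\<close> by simp
      qed
      have inj: "inj_on f (TI \<times> {..E})"
        using key[OF _ _ zero_in_R] by (auto intro!: inj_onI)
      have "finite (f ` (TI \<times> {..E})) \<and> card (f ` (TI \<times> {..E})) \<le> E * B ^ n"
      proof (rule E[of \<beta> b])
        show "\<beta> = (\<Sum>i<n. of_int (b i) * w i)" by (simp add: \<beta>_def g_def)
        show "f ` (TI \<times> {..E}) \<subseteq> R"
          using TI(1) nx I(2) by (auto simp: f_def intro!: additive_subgroup_add[OF additive_subgroup_R])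
        fix s t y assume "s \<in> f ` (TI \<times> {..E})" "t \<in> f ` (TI \<times> {..E})" "y \<in> R" "s - t = \<beta> * y"
        then show "s = t" using key by blast
      qed (use \<open>\<beta> \<noteq> 0\<close> b_bound B_pos in auto)
      then have "N * (E + 1) \<le> E * B ^ n" using inj card_TI by (simp add: card_image card_cartesian_product)
      also have "\<dots> \<le> E * N" using B by simp
      finally show False using N by simp
    qed
    then show "\<exists>\<beta>\<in>I - {0}. \<forall>x\<in>I. \<exists>t\<in>{1..E}. \<exists>y\<in>R. of_nat t * x = \<beta> * y"
      using \<beta>I \<open>\<beta> \<noteq> 0\<close> by blast
  qed
qed

text \<open>Every ideal can be scaled to lie between \<open>M * R\<close> and \<open>R\<close> for
  one fixed integer \<open>M\<close>, and between these there are only finitely many subgroups. With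
  \<beta> from \<open>ideal_almost_principal\<close>, the scaling factor is
  \<open>M / \<beta>\<close>: the result lies in \<open>R\<close> because every
  \<open>t \<le> C\<close> divides \<open>M = fact C\<close>, and it contains the multiples of
  \<open>M\<close> because \<beta> belongs to the ideal.\<close>

lemma finite_ideal_classes:
  obtains \<R> where "finite \<R>" "\<And>I. fractional_ideal F I \<Longrightarrow> \<exists>a\<in>F - {0}. (\<lambda>x. a * x) ` I \<in> \<R>"
proof -
  obtain C :: nat where C: "\<And>I. fractional_ideal F I \<Longrightarrow> I \<subseteq> R \<Longrightarrow>
      \<exists>\<beta>\<in>I - {0}. \<forall>x\<in>I. \<exists>t\<in>{1..C}. \<exists>y\<in>R. of_nat t * x = \<beta> * y"
    using ideal_almost_principal by blast
  define M :: nat where "M = fact C"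
  have M: "M > 0" by (simp add: M_def)
  obtain T where T: "finite T" "T \<subseteq> R" "\<And>x. x \<in> R \<Longrightarrow> \<exists>t\<in>T. \<exists>y\<in>R. x - t = of_nat M * y"
    using R_finite_mod[OF M] by blast
  \<comment> \<open>A subgroup of \<open>R\<close> containing the multiples of \<open>M\<close> is
    the union of the residue classes of those representatives that it contains, so the subsets of
    \<open>T\<close> account for all of them.\<close>
  define \<R> where "\<R> = (\<lambda>S. {x \<in> R. \<exists>t\<in>S. \<exists>y\<in>R. x - t = of_nat M * y}) ` Pow T"
  have key: "J \<in> \<R>" if J: "additive_subgroup J" "J \<subseteq> R" "\<And>y. y \<in> R \<Longrightarrow> of_nat M * y \<in> J" for J
  proof -
    have "J = {x \<in> R. \<exists>t\<in>J \<inter> T. \<exists>y\<in>R. x - t = of_nat M * y}" (is "_ = ?J")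
    proof
      show "J \<subseteq> ?J"
      proof
        fix x assume x: "x \<in> J"
        then obtain t y where t: "t \<in> T" "y \<in> R" "x - t = of_nat M * y" using T(3) J(2) by blast
        have "t = x - of_nat M * y" using t(3) by (simp add: algebra_simps)
        then have "t \<in> J" using additive_subgroup_diff[OF J(1) x J(3)[OF t(2)]] by simp
        then show "x \<in> ?J" using x J(2) t by blast
      qed
      show "?J \<subseteq> J"
      proof clarify
        fix x t y assume "x \<in> R" "t \<in> J" "t \<in> T" "y \<in> R" "x - t = of_nat M * y"
        then have "x = t + of_nat M * y" by (simp add: algebra_simps)
        then show "x \<in> J" using additive_subgroup_add[OF J(1) \<open>t \<in> J\<close> J(3)[OF \<open>y \<in> R\<close>]] by simp
      qed
    qed
    then show ?thesis unfolding \<R>_def by blast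
  qed
  show ?thesis
  proof (rule that[of \<R>])
    show "finite \<R>" using T(1) by (simp add: \<R>_def)
    fix I assume I: "fractional_ideal F I"
    obtain d where d: "d \<in> R - {0}" "\<forall>x\<in>I. d * x \<in> R" using I by (auto simp: fractional_ideal_def)
    define I' where "I' = (\<lambda>x. d * x) ` I"
    have "I' \<subseteq> R" using d by (auto simp: I'_def)
    have "fractional_ideal F I'"
      unfolding fractional_ideal_def
    proof (intro conjI ballI)
      show "I' \<subseteq> F" using \<open>I' \<subseteq> R\<close> R_subset_F by auto
      show "0 \<in> I'" using I by (auto simp: I'_def fractional_ideal_def intro!: image_eqI[of _ _ 0])
      show "I' \<noteq> {0}"
      proof -
        obtain x where "x \<in> I" "x \<noteq> 0" using I by (auto simp: fractional_ideal_def)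
        then have "d * x \<in> I'" "d * x \<noteq> 0" using d by (auto simp: I'_def)
        then show ?thesis by auto
      qed
      show "x + y \<in> I'" if xy: "x \<in> I'" "y \<in> I'" for x y
      proof -
        obtain x' y' where "x = d * x'" "y = d * y'" "x' \<in> I" "y' \<in> I" using xy by (auto simp: I'_def)
        moreover have "x' + y' \<in> I" using I \<open>x' \<in> I\<close> \<open>y' \<in> I\<close> unfolding fractional_ideal_def by blast
        ultimately show ?thesis by (auto simp: I'_def distrib_left[symmetric])
      qed
      show "a * x \<in> I'" if ax: "a \<in> R" "x \<in> I'" for a x
      proof -
        obtain x' where "x = d * x'" "x' \<in> I" using ax by (auto simp: I'_def)
        moreover have "a * x' \<in> I" using I \<open>x' \<in> I\<close> ax(1) unfolding fractional_ideal_def by blast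
        ultimately show ?thesis by (auto simp: I'_def intro!: image_eqI[of _ _ "a * x'"])
      qed
      show "\<exists>d\<in>R - {0}. \<forall>x\<in>I'. d * x \<in> R" using one_in_R \<open>I' \<subseteq> R\<close> by (intro bexI[of _ 1]) auto
    qed
    then obtain \<beta> where \<beta>: "\<beta> \<in> I' - {0}" "\<forall>x\<in>I'. \<exists>t\<in>{1..C}. \<exists>y\<in>R. of_nat t * x = \<beta> * y"
      using C[OF _ \<open>I' \<subseteq> R\<close>] by blast
    have \<beta>0: "\<beta> \<noteq> 0" using \<beta>(1) by simp
    have \<beta>R: "\<beta> \<in> R" using \<beta>(1) \<open>I' \<subseteq> R\<close> by auto
    have M\<beta>: "of_nat M / \<beta> * x \<in> R" if x': "x \<in> I'" for x
    proof -
      obtain t y where t: "t \<in> {1..C}" "y \<in> R" "of_nat t * x = \<beta> * y"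
        using bspec[OF \<beta>(2) x'] by blast
      have "t dvd M" unfolding M_def using t(1) by (intro dvd_fact) auto
      then obtain s where s: "M = t * s" by (elim dvdE)
      have "of_nat M / \<beta> * x = of_nat s * (of_nat t * x) / \<beta>" by (simp add: s)
      also have "\<dots> = of_nat s * y" using t(3) \<beta>0 by simp
      also have "\<dots> \<in> R" using mult_in_R[OF of_int_in_R[of "int s"] t(2)] by simp
      finally show ?thesis .
    qed
    \<comment> \<open>The factor \<open>d\<close> first moves the fractional ideal into
      \<open>R\<close>.\<close>
    define a where "a = of_nat M / \<beta> * d"
    have "a \<in> F - {0}"
    proof -
      have "a \<in> F" unfolding a_def using \<beta>R d R_subset_F
        by (intro closed_subfield_mult[OF F] closed_subfield_divide[OF F] closed_subfield_of_nat[OF F]) auto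
      then show ?thesis using \<beta>0 d M by (auto simp: a_def)
    qed
    moreover have "(\<lambda>x. a * x) ` I \<in> \<R>"
    proof (rule key)
      show "(\<lambda>x. a * x) ` I \<subseteq> R"
        using M\<beta> by (auto simp: a_def I'_def mult.assoc)
      show "additive_subgroup ((\<lambda>x. a * x) ` I)"
      proof (rule additive_subgroupI)
        show "0 \<in> (\<lambda>x. a * x) ` I" using I by (auto simp: fractional_ideal_def intro!: image_eqI[of _ _ 0])
        fix x y assume xy: "x \<in> (\<lambda>x. a * x) ` I" "y \<in> (\<lambda>x. a * x) ` I"
        then obtain x' y' where *: "x = a * x'" "y = a * y'" "x' \<in> I" "y' \<in> I" by auto
        have "of_int (- 1) * y' \<in> I" using I *(4) of_int_in_R unfolding fractional_ideal_def by blast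
        then have "x' + of_int (- 1) * y' \<in> I" using I *(3) unfolding fractional_ideal_def by blast
        then show "x - y \<in> (\<lambda>x. a * x) ` I"
          by (auto simp: * algebra_simps intro!: image_eqI[of _ _ "x' - y'"])
      qed
      fix y assume y: "y \<in> R"
      obtain x where x: "x \<in> I" "\<beta> = d * x" using \<beta>(1) by (auto simp: I'_def)
      have "y * x \<in> I" using I x(1) y unfolding fractional_ideal_def by blast
      moreover have "of_nat M * y = a * (y * x)"
        using x(2) \<beta>0 by (simp add: a_def)
      ultimately show "of_nat M * y \<in> (\<lambda>x. a * x) ` I" by blast
    qed
    ultimately show "\<exists>a\<in>F - {0}. (\<lambda>x. a * x) ` I \<in> \<R>" by blast
  qed
qed

end

section \<open>The group of fractional ideals\<close>

lemma ideal_product_memI: "x \<in> I \<Longrightarrow> y \<in> J \<Longrightarrow> x * y \<in> ideal_product I J"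
  unfolding ideal_product_def by (intro CollectI exI[of _ 1] exI[of _ "\<lambda>_. x"] exI[of _ "\<lambda>_. y"]) auto

lemma ideal_product_subset:
  assumes "\<And>x y. x \<in> I \<Longrightarrow> y \<in> J \<Longrightarrow> x * y \<in> M" "additive_subgroup M"
  shows "ideal_product I J \<subseteq> M"
  using assms unfolding ideal_product_def by (auto intro!: additive_subgroup_sum)

lemma ideal_product_mono: "I \<subseteq> I' \<Longrightarrow> J \<subseteq> J' \<Longrightarrow> ideal_product I J \<subseteq> ideal_product I' J'"
  unfolding ideal_product_def by blast

lemma ideal_product_commute: "ideal_product I J = ideal_product J I"
proof -
  have "ideal_product I J \<subseteq> ideal_product J I" for I J :: "'a set"
  proof
    fix z assume "z \<in> ideal_product I J"
    then obtain n :: nat and x y where "z = (\<Sum>i<n. x i * y i)" "\<forall>i<n. x i \<in> I" "\<forall>i<n. y i \<in> J"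
      by (auto simp: ideal_product_def)
    then show "z \<in> ideal_product J I"
      unfolding ideal_product_def
      by (intro CollectI exI[of _ n] exI[of _ y] exI[of _ x]) (auto simp: mult.commute)
  qed
  then show ?thesis by blast
qed

text \<open>The two sums are concatenated, and the minus sign is absorbed by the factors from
  \<open>I\<close>.\<close>

lemma additive_subgroup_ideal_product:
  assumes "additive_subgroup I"
  shows "additive_subgroup (ideal_product I J)"
proof (rule additive_subgroupI)
  show "0 \<in> ideal_product I J" unfolding ideal_product_def by (intro CollectI exI[of _ 0]) auto
  fix u v assume "u \<in> ideal_product I J" "v \<in> ideal_product I J"
  then obtain n :: nat and x y and m :: nat and x' y'
    where u: "u = (\<Sum>i<n. x i * y i)" "\<forall>i<n. x i \<in> I" "\<forall>i<n. y i \<in> J"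
      and v: "v = (\<Sum>i<m. x' i * y' i)" "\<forall>i<m. x' i \<in> I" "\<forall>i<m. y' i \<in> J"
    by (auto simp: ideal_product_def)
  define x'' where "x'' i = (if i < n then x i else - x' (i - n))" for i
  define y'' where "y'' i = (if i < n then y i else y' (i - n))" for i
  have "(\<Sum>i<n + k. x'' i * y'' i) = u - (\<Sum>i<k. x' i * y' i)" for k
  proof (induction k)
    case 0
    show ?case by (simp add: u x''_def y''_def)
  next
    case (Suc k)
    then show ?case by (simp add: x''_def y''_def)
  qed
  then have "u - v = (\<Sum>i<n + m. x'' i * y'' i)" by (simp add: v)
  moreover have "\<forall>i<n + m. x'' i \<in> I"
    using u(2) v(2) additive_subgroup_uminus[OF assms] by (auto simp: x''_def)
  moreover have "\<forall>i<n + m. y'' i \<in> J"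
    using u(3) v(3) by (auto simp: y''_def)
  ultimately show "u - v \<in> ideal_product I J" unfolding ideal_product_def by blast
qed

lemma ideal_product_assoc_subset:
  assumes "additive_subgroup I"
  shows "ideal_product (ideal_product I J) K \<subseteq> ideal_product I (ideal_product J K)"
proof (rule ideal_product_subset[OF _ additive_subgroup_ideal_product[OF assms]])
  let ?M = "ideal_product I (ideal_product J K)"
  fix z c assume zc: "z \<in> ideal_product I J" "c \<in> K"
  have "ideal_product I J \<subseteq> {z. c * z \<in> ?M}"
  proof (rule ideal_product_subset)
    show "additive_subgroup {z. c * z \<in> ?M}"
      by (intro additive_subgroup_vimage_mult additive_subgroup_ideal_product assms)
    fix x y assume "x \<in> I" "y \<in> J"
    then have "x * (y * c) \<in> ?M" using zc(2) by (intro ideal_product_memI)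
    then show "x * y \<in> {z. c * z \<in> ?M}" by (simp add: algebra_simps)
  qed
  then show "z * c \<in> ?M" using zc(1) by (auto simp: mult.commute)
qed

text \<open>The second inclusion is the first one with the roles of \<open>I\<close> and
  \<open>K\<close> exchanged by commutativity.\<close>

lemma ideal_product_assoc:
  assumes "additive_subgroup I" "additive_subgroup K"
  shows "ideal_product (ideal_product I J) K = ideal_product I (ideal_product J K)"
proof
  show "ideal_product I (ideal_product J K) \<subseteq> ideal_product (ideal_product I J) K"
    using ideal_product_assoc_subset[OF assms(2), of J I]
    by (simp only: ideal_product_commute[of I "ideal_product K J"] ideal_product_commute[of J K]
        ideal_product_commute[of "ideal_product J I" K] ideal_product_commute[of I J])
qed (rule ideal_product_assoc_subset[OF assms(1)])

definition scale :: "'a::times \<Rightarrow> 'a set \<Rightarrow> 'a set" where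
  "scale a I = (\<lambda>x. a * x) ` I"

lemma scale_scale: "scale a (scale b I) = scale (a * b) I" for a :: "'a::comm_ring_1"
  by (simp add: scale_def image_image mult.assoc)

lemma scale_1: "scale 1 I = I" for I :: "'a::comm_ring_1 set"
  by (simp add: scale_def)

lemma additive_subgroup_scale:
  fixes a :: "'a::comm_ring_1"
  assumes "additive_subgroup I"
  shows "additive_subgroup (scale a I)"
proof (rule additive_subgroupI)
  show "0 \<in> scale a I"
    unfolding scale_def using additive_subgroup_0[OF assms] by (intro image_eqI[of _ _ 0]) simp_all
  fix x y assume "x \<in> scale a I" "y \<in> scale a I"
  then obtain u v where "x = a * u" "y = a * v" "u \<in> I" "v \<in> I" by (auto simp: scale_def)
  then show "x - y \<in> scale a I"
    unfolding scale_def using additive_subgroup_diff[OF assms, of u v]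
    by (intro image_eqI[of _ _ "u - v"]) (simp_all add: right_diff_distrib)
qed

lemma ideal_product_scale:
  assumes "additive_subgroup I" "additive_subgroup J"
  shows "ideal_product (scale a I) J = scale a (ideal_product I J)"
proof
  have IJ: "additive_subgroup (ideal_product I J)" by (rule additive_subgroup_ideal_product[OF assms(1)])
  show "ideal_product (scale a I) J \<subseteq> scale a (ideal_product I J)"
    by (rule ideal_product_subset[OF _ additive_subgroup_scale[OF IJ]])
      (auto simp: scale_def mult.assoc intro: ideal_product_memI)
  have "ideal_product I J \<subseteq> {z. a * z \<in> ideal_product (scale a I) J}"
  proof (rule ideal_product_subset)
    show "additive_subgroup {z. a * z \<in> ideal_product (scale a I) J}"
      by (intro additive_subgroup_vimage_mult additive_subgroup_ideal_product additive_subgroup_scale assms)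
    fix x y assume "x \<in> I" "y \<in> J"
    then have "(a * x) * y \<in> ideal_product (scale a I) J"
      by (intro ideal_product_memI) (auto simp: scale_def)
    then show "x * y \<in> {z. a * z \<in> ideal_product (scale a I) J}" by (simp add: mult.assoc)
  qed
  then show "scale a (ideal_product I J) \<subseteq> ideal_product (scale a I) J" by (auto simp: scale_def)
qed

text \<open>The product over the permutations in the Leibniz formula other than the identity has an
  off-diagonal factor, so it lies in \<open>B\<close>.\<close>

lemma det_one_minus_in_ideal:
  fixes b :: "nat \<Rightarrow> nat \<Rightarrow> 'a::comm_ring_1"
  assumes B: "additive_subgroup B" "\<And>a x. a \<in> S \<Longrightarrow> x \<in> B \<Longrightarrow> a * x \<in> B" "B \<subseteq> S"
    and S: "1 \<in> S" "additive_subgroup S" "\<And>x y. x \<in> S \<Longrightarrow> y \<in> S \<Longrightarrow> x * y \<in> S"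
    and b: "\<And>i j. i < m \<Longrightarrow> j < m \<Longrightarrow> b i j \<in> B"
  shows "Determinant.det (mat m m (\<lambda>(i, j). of_bool (i = j) - b i j)) - 1 \<in> B"
proof -
  let ?M = "mat m m (\<lambda>(i, j). of_bool (i = j) - b i j)"
  let ?t = "\<lambda>p. signof p * (\<Prod>i = 0..<m. ?M $$ (i, p i))"
  let ?P = "{p. p permutes {0..<m}}"
  have M: "?M $$ (i, j) \<in> S" if "i < m" "j < m" for i j
    using that additive_subgroup_uminus[OF S(2) subsetD[OF B(3) b[OF that]]]
      additive_subgroup_diff[OF S(2) S(1) subsetD[OF B(3) b[OF that]]] by (cases "i = j") simp_all
  have prod_S: "(\<Prod>i\<in>A. f i) \<in> S" if "\<And>i. i \<in> A \<Longrightarrow> f i \<in> S" for A :: "nat set" and f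
    using that by (induction A rule: infinite_finite_induct) (simp_all add: S(1,3))
  have "(\<Prod>i\<in>A. ?M $$ (i, i)) - 1 \<in> B" if "A \<subseteq> {0..<m}" for A
    using finite_subset[OF that finite_atLeastLessThan] that
  proof (induction A rule: finite_induct)
    case empty
    then show ?case by (simp add: additive_subgroup_0[OF B(1)])
  next
    case (insert i A)
    define q where "q = (\<Prod>i\<in>A. ?M $$ (i, i))"
    have "?M $$ (i, i) * (q - 1) \<in> B" using insert.IH insert.prems unfolding q_def by (intro B(2)[OF M]) auto
    moreover have "b i i \<in> B" using insert b by auto
    ultimately have "?M $$ (i, i) * (q - 1) - b i i \<in> B" by (rule additive_subgroup_diff[OF B(1)])
    moreover have "?M $$ (i, i) = 1 - b i i" using insert by simp
    ultimately show ?case using insert by (simp add: q_def[symmetric] algebra_simps)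
  qed
  moreover have "?t id = (\<Prod>i\<in>{0..<m}. ?M $$ (i, i))" by simp
  ultimately have id: "?t id - 1 \<in> B" by (simp only: order_refl)
  have rest: "?t p \<in> B" if p: "p permutes {0..<m}" "p \<noteq> id" for p
  proof -
    obtain i where i: "p i \<noteq> i" using p(2) by fastforce
    then have im: "i < m" using p(1) by (auto simp: permutes_def)
    have pm: "p j < m" if "j < m" for j using permutes_in_image[OF p(1), of j] that by simp
    have "?M $$ (i, p i) = - b i (p i)" using im pm[OF im] i by auto
    moreover have "b i (p i) \<in> B" using b im pm by auto
    ultimately have "?M $$ (i, p i) \<in> B" using additive_subgroup_uminus[OF B(1)] by simp
    moreover have "(\<Prod>i = 0..<m. ?M $$ (i, p i)) =
        (\<Prod>j\<in>{0..<m} - {i}. ?M $$ (j, p j)) * ?M $$ (i, p i)"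
      using im by (subst prod.remove[of _ i]) (auto simp: mult.commute)
    moreover have "(\<Prod>j\<in>{0..<m} - {i}. ?M $$ (j, p j)) \<in> S" using M pm by (intro prod_S) auto
    ultimately have "(\<Prod>i = 0..<m. ?M $$ (i, p i)) \<in> B" using B(2) by simp
    then show ?thesis
      using additive_subgroup_of_int_mult[OF B(1), of _ "sign p"] by simp
  qed
  have fin: "finite ?P" by (simp add: finite_permutations)
  have "Determinant.det ?M = (\<Sum>p\<in>?P. ?t p)" by (simp add: Determinant.det_def)
  also have "\<dots> = ?t id + (\<Sum>p\<in>?P - {id}. ?t p)"
    using fin by (intro sum.remove) (auto simp: permutes_id)
  finally have "Determinant.det ?M - 1 = (?t id - 1) + (\<Sum>p\<in>?P - {id}. ?t p)" by simp
  also have "\<dots> \<in> B"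
    using rest by (intro additive_subgroup_add[OF B(1) id] additive_subgroup_sum[OF B(1)]) auto
  finally show ?thesis .
qed

context number_field_locale
begin

lemma
  assumes "fractional_ideal F I"
  shows fractional_ideal_subset: "I \<subseteq> F"
    and fractional_ideal_mult: "a \<in> R \<Longrightarrow> x \<in> I \<Longrightarrow> a * x \<in> I"
    and fractional_ideal_nonzero: "\<exists>x\<in>I. x \<noteq> 0"
    and fractional_ideal_denominator: "\<exists>d\<in>R - {0}. \<forall>x\<in>I. d * x \<in> R"
    and additive_subgroup_fractional_ideal: "additive_subgroup I"
proof -
  show "I \<subseteq> F" and mult: "\<And>a x. a \<in> R \<Longrightarrow> x \<in> I \<Longrightarrow> a * x \<in> I"
    and "\<exists>x\<in>I. x \<noteq> 0" "\<exists>d\<in>R - {0}. \<forall>x\<in>I. d * x \<in> R"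
    using assms by (auto simp: fractional_ideal_def)
  show "additive_subgroup I"
  proof (rule additive_subgroupI)
    show "0 \<in> I" using assms by (simp add: fractional_ideal_def)
    fix x y assume xy: "x \<in> I" "y \<in> I"
    have "x + of_int (- 1) * y \<in> I"
      using assms xy(1) mult[OF of_int_in_R xy(2)] unfolding fractional_ideal_def by blast
    then show "x - y \<in> I" by simp
  qed
qed

lemma fractional_idealI:
  assumes "I \<subseteq> F" "additive_subgroup I" "\<And>a x. a \<in> R \<Longrightarrow> x \<in> I \<Longrightarrow> a * x \<in> I"
    "x \<in> I" "x \<noteq> 0" "d \<in> R" "d \<noteq> 0" "\<And>x. x \<in> I \<Longrightarrow> d * x \<in> R"
  shows "fractional_ideal F I"
  unfolding fractional_ideal_def
proof (intro conjI ballI)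
  show "I \<noteq> {0}" using assms(4,5) by auto
  show "\<exists>d\<in>R - {0}. \<forall>x\<in>I. d * x \<in> R" using assms(6-8) by (intro bexI[of _ d]) auto
qed (use assms(1-3) additive_subgroup_0[OF assms(2)] additive_subgroup_add[OF assms(2)] in simp_all)

lemma fractional_ideal_R: "fractional_ideal F R"
  by (rule fractional_idealI[of _ 1 1]) (auto simp: R_subset_F additive_subgroup_R mult_in_R one_in_R)

lemma fractional_ideal_product:
  assumes I: "fractional_ideal F I" and J: "fractional_ideal F J"
  shows "fractional_ideal F (ideal_product I J)"
proof -
  note addI = additive_subgroup_fractional_ideal[OF I]
  obtain x y where xy: "x \<in> I" "x \<noteq> 0" "y \<in> J" "y \<noteq> 0" using fractional_ideal_nonzero I J by meson
  obtain d e where d: "d \<in> R" "d \<noteq> 0" "\<And>x. x \<in> I \<Longrightarrow> d * x \<in> R" and e: "e \<in> R" "e \<noteq> 0" "\<And>x. x \<in> J \<Longrightarrow> e * x \<in> R"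
    using fractional_ideal_denominator[OF I] fractional_ideal_denominator[OF J] by auto
  show ?thesis
  proof (rule fractional_idealI[of _ "x * y" "d * e"])
    show "ideal_product I J \<subseteq> F"
      using fractional_ideal_subset[OF I] fractional_ideal_subset[OF J]
      by (intro ideal_product_subset additive_subgroup_closed_subfield F) (auto intro!: closed_subfield_mult[OF F])
    show "additive_subgroup (ideal_product I J)" by (rule additive_subgroup_ideal_product[OF addI])
    show "x * y \<in> ideal_product I J" using xy by (intro ideal_product_memI)
    show "d * e \<in> R" using d e by (intro mult_in_R)
    show "a * z \<in> ideal_product I J" if "a \<in> R" "z \<in> ideal_product I J" for a z
    proof -
      have "ideal_product I J \<subseteq> {z. a * z \<in> ideal_product I J}"
        using ideal_product_memI[OF fractional_ideal_mult[OF I that(1)], of _ _ J]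
        by (intro ideal_product_subset additive_subgroup_vimage_mult additive_subgroup_ideal_product[OF addI])
          (auto simp: mult.assoc)
      then show ?thesis using that(2) by auto
    qed
    show "d * e * z \<in> R" if "z \<in> ideal_product I J" for z
    proof -
      have "d * e * (x * y) \<in> R" if "x \<in> I" "y \<in> J" for x y
        using mult_in_R[OF d(3)[OF that(1)] e(3)[OF that(2)]] by (simp add: algebra_simps)
      then have "ideal_product I J \<subseteq> {z. d * e * z \<in> R}"
        by (intro ideal_product_subset additive_subgroup_vimage_mult additive_subgroup_R) auto
      then show ?thesis using that by auto
    qed
  qed (use xy d e in auto)
qed

lemma ideal_product_R:
  assumes "fractional_ideal F I"
  shows "ideal_product R I = I"
proof
  show "ideal_product R I \<subseteq> I"
    by (intro ideal_product_subset fractional_ideal_mult[OF assms] additive_subgroup_fractional_ideal[OF assms])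
  show "I \<subseteq> ideal_product R I"
    using ideal_product_memI[OF one_in_R] by fastforce
qed

lemma fractional_ideal_scale:
  assumes "fractional_ideal F I" "a \<in> F" "a \<noteq> 0"
  shows "fractional_ideal F (scale a I)"
proof -
  obtain d :: nat where d: "d > 0" "of_nat d * a \<in> R" using denominator[OF assms(2)] .
  obtain e where e: "e \<in> R" "e \<noteq> 0" "\<And>x. x \<in> I \<Longrightarrow> e * x \<in> R"
    using fractional_ideal_denominator[OF assms(1)] by auto
  obtain x where x: "x \<in> I" "x \<noteq> 0" using fractional_ideal_nonzero[OF assms(1)] by auto
  show ?thesis
  proof (rule fractional_idealI[of _ "a * x" "of_nat d * e"])
    show "scale a I \<subseteq> F"
      using fractional_ideal_subset[OF assms(1)] assms(2) by (auto simp: scale_def intro!: closed_subfield_mult[OF F])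
    show "additive_subgroup (scale a I)"
      by (intro additive_subgroup_scale additive_subgroup_fractional_ideal assms)
    show "c * z \<in> scale a I" if "c \<in> R" "z \<in> scale a I" for c z
      using that fractional_ideal_mult[OF assms(1) that(1)] by (auto simp: scale_def mult.left_commute[of c a])
    show "of_nat d * e \<in> R" using e of_int_in_R[of "int d"] mult_in_R by simp
    show "of_nat d * e * z \<in> R" if z: "z \<in> scale a I" for z
    proof -
      obtain y where y: "y \<in> I" "z = a * y" using z by (auto simp: scale_def)
      show ?thesis using mult_in_R[OF d(2) e(3)[OF y(1)]] by (simp add: y algebra_simps)
    qed
  qed (use x d e assms in \<open>auto simp: scale_def\<close>)
qed

lemma ideal_product_principal:
  assumes "fractional_ideal F I"
  shows "ideal_product (scale a R) I = scale a I"
  using assms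
  by (simp add: ideal_product_scale additive_subgroup_R additive_subgroup_fractional_ideal ideal_product_R)

lemma fractional_ideal_group_simps [simp]:
  "carrier (fractional_ideal_group F) = {I. fractional_ideal F I}"
  "I \<otimes>\<^bsub>fractional_ideal_group F\<^esub> J = ideal_product I J"
  "\<one>\<^bsub>fractional_ideal_group F\<^esub> = R"
  by (simp_all add: fractional_ideal_group_def)

lemma comm_monoid_fractional_ideal_group: "comm_monoid (fractional_ideal_group F)"
proof (rule comm_monoidI)
  show "x \<otimes>\<^bsub>fractional_ideal_group F\<^esub> y \<otimes>\<^bsub>fractional_ideal_group F\<^esub> z =
      x \<otimes>\<^bsub>fractional_ideal_group F\<^esub> (y \<otimes>\<^bsub>fractional_ideal_group F\<^esub> z)"
    if "x \<in> carrier (fractional_ideal_group F)" "y \<in> carrier (fractional_ideal_group F)"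
      "z \<in> carrier (fractional_ideal_group F)" for x y z
    using that by (simp add: ideal_product_assoc additive_subgroup_fractional_ideal)
next
  show "x \<otimes>\<^bsub>fractional_ideal_group F\<^esub> y = y \<otimes>\<^bsub>fractional_ideal_group F\<^esub> x" for x y
    by (simp add: ideal_product_commute)
qed (simp_all add: fractional_ideal_product fractional_ideal_R ideal_product_R)

lemma fractional_ideal_finitely_generated:
  assumes "fractional_ideal F I"
  obtains V where "finite V" "I = zspan V"
proof -
  obtain d where d: "d \<in> R" "d \<noteq> 0" "\<And>x. x \<in> I \<Longrightarrow> d * x \<in> R"
    using fractional_ideal_denominator[OF assms] by auto
  obtain u :: "nat \<Rightarrow> 'a" and m where u: "R = zspan (u ` {..<m})" by (rule R_finitely_generated)
  have "I \<subseteq> zspan ((\<lambda>x. inverse d * x) ` u ` {..<m})"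
  proof
    fix x assume "x \<in> I"
    then have b: "d * x \<in> zspan (u ` {..<m})" using d(3) u by simp
    have a: "inverse d \<in> zspan {inverse d}" by (simp add: zspan.base)
    have "inverse d * (d * x) \<in> zspan ((\<lambda>x. inverse d * x) ` u ` {..<m})"
      by (rule zspan_mult_closed[OF _ additive_subgroup_zspan a b]) (auto intro!: zspan.base)
    moreover have "inverse d * (d * x) = x" using d(2) by simp
    ultimately show "x \<in> zspan ((\<lambda>x. inverse d * x) ` u ` {..<m})" by simp
  qed
  then show ?thesis
    using additive_subgroup_finitely_generated[OF _ additive_subgroup_fractional_ideal[OF assms]] that
    by (metis finite_imageI finite_lessThan)
qed

text \<open>Both inclusions are instances of the determinant trick, applied to generators of \<open>A\<close>.\<close>

lemma ideal_product_cancel: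
  assumes A: "fractional_ideal F A" and B: "fractional_ideal F B" and eq: "ideal_product A B = A"
  shows "B = R"
proof
  obtain V where V: "finite V" "A = zspan V" using fractional_ideal_finitely_generated[OF A] .
  obtain v :: "nat \<Rightarrow> 'a" and m where v: "V = v ` {..<m}" using V(1) by (rule finite_indexed)
  obtain a0 where a0: "a0 \<in> A" "a0 \<noteq> 0" using fractional_ideal_nonzero[OF A] by auto
  have "\<exists>i<m. v i \<noteq> 0"
  proof (rule ccontr)
    assume "\<not> (\<exists>i<m. v i \<noteq> 0)"
    then have "zspan V \<subseteq> {0}" by (intro zspan_minimal) (auto simp: v additive_subgroup_def)
    then show False using a0 V(2) by auto
  qed
  then obtain i0 where i0: "i0 < m" "v i0 \<noteq> 0" by auto
  have vA: "v i \<in> A" if "i < m" for i using that V(2) v by (auto intro: zspan.base)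
  show BR: "B \<subseteq> R"
  proof
    fix x assume x: "x \<in> B"
    have "algebraic_int x"
    proof (rule algebraic_int_if_stable[OF V(1)])
      show "v i0 \<in> V" "v i0 \<noteq> 0" using i0 v by auto
      fix w assume "w \<in> V"
      then have "w * x \<in> ideal_product A B" using x V(2) by (intro ideal_product_memI) (auto intro: zspan.base)
      then show "x * w \<in> zspan V" using eq V(2) by (simp add: mult.commute)
    qed
    then show "x \<in> R" using x fractional_ideal_subset[OF B] by (auto simp: R_iff)
  qed
  note addB = additive_subgroup_fractional_ideal[OF B]
  \<comment> \<open>Combinations of the generators of \<open>A\<close> with coefficients in
    \<open>B\<close>. They exhaust \<open>ideal_product A B\<close>, which is \<open>A\<close>, so
    each generator is such a combination of all generators.\<close>
  let ?M = "{x. \<exists>b. (\<forall>j<m. b j \<in> B) \<and> x = (\<Sum>j<m. b j * v j)}"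
  have addM: "additive_subgroup ?M"
  proof (rule additive_subgroupI)
    show "0 \<in> ?M" using additive_subgroup_0[OF addB] by (intro CollectI exI[of _ "\<lambda>_. 0"]) auto
    fix x y assume "x \<in> ?M" "y \<in> ?M"
    then obtain b c where bc: "\<forall>j<m. b j \<in> B" "x = (\<Sum>j<m. b j * v j)" "\<forall>j<m. c j \<in> B" "y = (\<Sum>j<m. c j * v j)"
      by blast
    then have "x - y = (\<Sum>j<m. (b j - c j) * v j)" by (simp add: sum_subtractf left_diff_distrib)
    moreover have "\<forall>j<m. b j - c j \<in> B" using bc additive_subgroup_diff[OF addB] by blast
    ultimately show "x - y \<in> ?M" by (intro CollectI exI[of _ "\<lambda>j. b j - c j"]) blast
  qed
  have "ideal_product A B \<subseteq> ?M"
  proof (rule ideal_product_subset[OF _ addM])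
    fix x y assume x: "x \<in> A" and y: "y \<in> B"
    obtain c :: "nat \<Rightarrow> int" where "x = (\<Sum>j<m. of_int (c j) * v j)"
      using x unfolding V(2) v by (rule zspan_image_indexed)
    then have "x * y = (\<Sum>j<m. (of_int (c j) * v j) * y)" by (simp only: sum_distrib_right)
    also have "\<dots> = (\<Sum>j<m. (of_int (c j) * y) * v j)" by (rule sum.cong) (simp_all add: mult_ac)
    finally have "x * y = (\<Sum>j<m. (of_int (c j) * y) * v j)" .
    moreover have "\<forall>j<m. of_int (c j) * y \<in> B" using y additive_subgroup_of_int_mult[OF addB] by auto
    ultimately show "x * y \<in> ?M" by (intro CollectI exI[of _ "\<lambda>j. of_int (c j) * y"]) blast
  qed
  then have "\<forall>i\<in>{..<m}. \<exists>b. (\<forall>j<m. b j \<in> B) \<and> v i = (\<Sum>j<m. b j * v j)"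
    using vA eq by blast
  from bchoice[OF this] obtain b where b: "\<And>i j. i < m \<Longrightarrow> j < m \<Longrightarrow> b i j \<in> B"
    "\<And>i. i < m \<Longrightarrow> v i = (\<Sum>j<m. b i j * v j)" by blast
  \<comment> \<open>The identity minus the matrix of these coefficients kills the vector of
    generators, so its determinant vanishes. The determinant is also congruent to 1 modulo
    \<open>B\<close>, whence 1 lies in \<open>B\<close>.\<close>
  let ?N = "mat m m (\<lambda>(i, j). of_bool (i = j) - b i j)"
  have "?N *\<^sub>v vec m v = 0\<^sub>v m"
  proof (rule eq_vecI)
    fix i assume "i < dim_vec (0\<^sub>v m :: 'a vec)"
    then have i: "i < m" by simp
    have "vec_index (?N *\<^sub>v vec m v) i = (\<Sum>j<m. (of_bool (i = j) - b i j) * v j)"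
      using i by (simp add: scalar_prod_def lessThan_atLeast0)
    also have "\<dots> = (\<Sum>j<m. of_bool (i = j) * v j) - (\<Sum>j<m. b i j * v j)"
      by (simp only: left_diff_distrib sum_subtractf)
    also have "(\<Sum>j<m. of_bool (i = j) * v j) = (\<Sum>j<m. if j = i then v i else 0)"
      by (rule sum.cong) auto
    also have "\<dots> = v i" using i by simp
    also have "v i - (\<Sum>j<m. b i j * v j) = 0" using b(2)[OF i] by simp
    finally show "vec_index (?N *\<^sub>v vec m v) i = vec_index (0\<^sub>v m) i" using i by simp
  qed simp
  moreover have "vec m v \<noteq> 0\<^sub>v m"
    using i0 by (auto simp: vec_eq_iff)
  ultimately have "\<exists>u. u \<in> carrier_vec m \<and> u \<noteq> 0\<^sub>v m \<and> ?N *\<^sub>v u = 0\<^sub>v m"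
    by (intro exI[of _ "vec m v"] conjI vec_carrier)
  then have "Determinant.det ?N = 0" using det_0_iff_vec_prod_zero[OF mat_carrier] by blast
  moreover have "Determinant.det ?N - 1 \<in> B"
    by (rule det_one_minus_in_ideal[OF addB fractional_ideal_mult[OF B] BR one_in_R additive_subgroup_R mult_in_R b(1)])
  ultimately have "- 1 \<in> B" by simp
  then have "1 \<in> B" using additive_subgroup_uminus[OF addB] by fastforce
  then show "R \<subseteq> B" using fractional_ideal_mult[OF B, of _ 1] by auto
qed

lemma finite_ideal_classes_scale:
  "\<exists>\<R>. finite \<R> \<and> (\<forall>I. fractional_ideal F I \<longrightarrow> (\<exists>a\<in>F - {0}. scale a I \<in> \<R>))"
  unfolding scale_def by (rule finite_ideal_classes) blast

text \<open>Among the infinitely many powers of \<open>I\<close> two share a representative, so some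
  power \<open>i\<close> of \<open>I\<close> equals \<open>c\<close> times a higher power
  \<open>j\<close>. Writing the latter as the power \<open>i\<close> times \<open>I\<close> times
  the power \<open>l = j - i - 1\<close> and cancelling the power \<open>i\<close>, the inverse is
  \<open>c\<close> times the power \<open>l\<close>.\<close>

lemma fractional_ideal_invertible:
  assumes I: "fractional_ideal F I"
  obtains J where "fractional_ideal F J" "ideal_product I J = R"
proof -
  interpret G: comm_monoid "fractional_ideal_group F" by (rule comm_monoid_fractional_ideal_group)
  let ?G = "fractional_ideal_group F"
  obtain \<R> where \<R>: "finite \<R>" "\<And>I. fractional_ideal F I \<Longrightarrow> \<exists>a\<in>F - {0}. scale a I \<in> \<R>"
    using finite_ideal_classes_scale by blast
  have pow: "fractional_ideal F (I [^]\<^bsub>?G\<^esub> (k::nat))" for k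
    using G.nat_pow_closed[of I k] I by simp
  have "\<forall>k::nat. \<exists>a. a \<in> F - {0} \<and> scale a (I [^]\<^bsub>?G\<^esub> k) \<in> \<R>" using \<R>(2)[OF pow] by blast
  from choice[OF this] obtain a where a: "\<And>k::nat. a k \<in> F - {0}" "\<And>k::nat. scale (a k) (I [^]\<^bsub>?G\<^esub> k) \<in> \<R>"
    by blast
  have "\<not> inj_on (\<lambda>k. scale (a k) (I [^]\<^bsub>?G\<^esub> k)) (UNIV :: nat set)"
  proof
    assume "inj_on (\<lambda>k. scale (a k) (I [^]\<^bsub>?G\<^esub> k)) (UNIV :: nat set)"
    moreover have "finite ((\<lambda>k. scale (a k) (I [^]\<^bsub>?G\<^esub> k)) ` (UNIV :: nat set))"
      by (rule finite_subset[OF _ \<R>(1)]) (use a(2) in auto)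
    ultimately show False by (auto dest: finite_imageD)
  qed
  then obtain i j :: nat where ij: "i < j" "scale (a i) (I [^]\<^bsub>?G\<^esub> i) = scale (a j) (I [^]\<^bsub>?G\<^esub> j)"
    unfolding inj_on_def by (metis UNIV_I linorder_neqE_nat)
  define c where "c = inverse (a i) * a j"
  have c: "c \<in> F" "c \<noteq> 0"
    using a(1)[of i] a(1)[of j] by (auto simp: c_def intro: closed_subfield_mult[OF F] closed_subfield_inverse[OF F])
  have "scale (inverse (a i)) (scale (a i) (I [^]\<^bsub>?G\<^esub> i)) = scale c (I [^]\<^bsub>?G\<^esub> j)"
    unfolding ij(2) by (simp add: scale_scale c_def)
  then have 1: "I [^]\<^bsub>?G\<^esub> i = scale c (I [^]\<^bsub>?G\<^esub> j)"
    using a(1)[of i] by (simp add: scale_scale scale_1)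
  obtain l where l: "j = i + Suc l" using ij(1) less_imp_Suc_add by auto
  define J where "J = scale c (I [^]\<^bsub>?G\<^esub> l)"
  have J: "fractional_ideal F J" unfolding J_def by (intro fractional_ideal_scale pow c)
  have IJ: "fractional_ideal F (ideal_product I J)" by (intro fractional_ideal_product I J)
  have add: "additive_subgroup Y" if "fractional_ideal F Y" for Y
    using that by (rule additive_subgroup_fractional_ideal)
  have "ideal_product (I [^]\<^bsub>?G\<^esub> i) (ideal_product I J) = I [^]\<^bsub>?G\<^esub> i"
  proof -
    have "ideal_product I J = scale c (ideal_product (I [^]\<^bsub>?G\<^esub> l) I)"
      unfolding J_def by (subst ideal_product_commute) (intro ideal_product_scale add pow I)
    also have "ideal_product (I [^]\<^bsub>?G\<^esub> l) I = I [^]\<^bsub>?G\<^esub> Suc l" by simp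
    finally have "ideal_product (I [^]\<^bsub>?G\<^esub> i) (ideal_product I J) =
        scale c (ideal_product (I [^]\<^bsub>?G\<^esub> Suc l) (I [^]\<^bsub>?G\<^esub> i))"
      by (subst ideal_product_commute) (simp only: ideal_product_scale add pow)
    also have "ideal_product (I [^]\<^bsub>?G\<^esub> Suc l) (I [^]\<^bsub>?G\<^esub> i) = I [^]\<^bsub>?G\<^esub> j"
      using G.nat_pow_mult[of I "Suc l" i] I unfolding l by (simp add: add.commute)
    finally show ?thesis using 1 by simp
  qed
  then have "ideal_product I J = R" by (rule ideal_product_cancel[OF pow IJ])
  then show ?thesis using that J by blast
qed

lemma comm_group_fractional_ideal_group: "comm_group (fractional_ideal_group F)"
proof -
  interpret G: comm_monoid "fractional_ideal_group F" by (rule comm_monoid_fractional_ideal_group)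
  have "carrier (fractional_ideal_group F) \<subseteq> Units (fractional_ideal_group F)"
  proof
    fix I assume I: "I \<in> carrier (fractional_ideal_group F)"
    then obtain J where J: "fractional_ideal F J" "ideal_product I J = R"
      using fractional_ideal_invertible[of I] by auto
    show "I \<in> Units (fractional_ideal_group F)"
      unfolding Units_def using I J ideal_product_commute[of I J] by auto
  qed
  then show ?thesis by (intro comm_group.intro group.intro group_axioms.intro G.comm_monoid_axioms G.monoid_axioms)
qed

section \<open>The ideal class group\<close>

definition principal_ideal :: "'a \<Rightarrow> 'a set" where
  "principal_ideal a = scale a R"

lemma principal_fractional_ideals_eq:
  "principal_fractional_ideals F = principal_ideal ` (F - {0})"
  unfolding principal_fractional_ideals_def principal_ideal_def scale_def by blast

lemma principal_ideal_mult:
  "ideal_product (principal_ideal a) (principal_ideal b) = principal_ideal (a * b)"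
proof -
  have "ideal_product (scale b R) R = scale b R"
    by (simp add: ideal_product_scale additive_subgroup_R ideal_product_R[OF fractional_ideal_R])
  then show ?thesis
    unfolding principal_ideal_def
    by (simp add: ideal_product_scale additive_subgroup_R additive_subgroup_scale
        ideal_product_commute[of R "scale b R"] scale_scale)
qed

lemma fractional_ideal_principal: "a \<in> F - {0} \<Longrightarrow> fractional_ideal F (principal_ideal a)"
  unfolding principal_ideal_def by (intro fractional_ideal_scale fractional_ideal_R) auto

lemma subgroup_principal: "subgroup (principal_fractional_ideals F) (fractional_ideal_group F)"
proof -
  interpret G: comm_group "fractional_ideal_group F" by (rule comm_group_fractional_ideal_group)
  show ?thesis
  proof (rule G.subgroupI)
    show "principal_fractional_ideals F \<subseteq> carrier (fractional_ideal_group F)"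
      using fractional_ideal_principal by (auto simp: principal_fractional_ideals_eq)
    show "principal_fractional_ideals F \<noteq> {}"
      using closed_subfield_1[OF F] by (auto simp: principal_fractional_ideals_eq)
  next
    fix I assume "I \<in> principal_fractional_ideals F"
    then obtain a where a: "a \<in> F - {0}" "I = principal_ideal a" by (auto simp: principal_fractional_ideals_eq)
    have ia: "inverse a \<in> F - {0}" using a closed_subfield_inverse[OF F] by auto
    have "principal_ideal (inverse a) \<otimes>\<^bsub>fractional_ideal_group F\<^esub> I = \<one>\<^bsub>fractional_ideal_group F\<^esub>"
      using a by (simp add: principal_ideal_mult) (simp add: principal_ideal_def scale_1)
    then have "inv\<^bsub>fractional_ideal_group F\<^esub> I = principal_ideal (inverse a)"
      using fractional_ideal_principal[OF ia] fractional_ideal_principal[OF a(1)] a(2)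
      by (intro G.inv_equality) auto
    then show "inv\<^bsub>fractional_ideal_group F\<^esub> I \<in> principal_fractional_ideals F"
      using ia by (auto simp: principal_fractional_ideals_eq)
  next
    fix I J assume "I \<in> principal_fractional_ideals F" "J \<in> principal_fractional_ideals F"
    then obtain a b where "a \<in> F - {0}" "I = principal_ideal a" "b \<in> F - {0}" "J = principal_ideal b"
      by (auto simp: principal_fractional_ideals_eq)
    moreover have "a * b \<in> F - {0}" using calculation closed_subfield_mult[OF F] by auto
    ultimately show "I \<otimes>\<^bsub>fractional_ideal_group F\<^esub> J \<in> principal_fractional_ideals F"
      by (auto simp: principal_fractional_ideals_eq principal_ideal_mult)
  qed
qed

definition ideal_class :: "'a set \<Rightarrow> 'a set set" where
  "ideal_class I = principal_fractional_ideals F #>\<^bsub>fractional_ideal_group F\<^esub> I"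

text \<open>A coset of the principal ideals consists of the nonzero multiples of a representative.
  In this form the action of automorphisms and the extension of ideals can be computed on
  classes.\<close>

lemma ideal_class_eq: "fractional_ideal F I \<Longrightarrow> ideal_class I = (\<lambda>a. scale a I) ` (F - {0})"
  unfolding ideal_class_def r_coset_def principal_fractional_ideals_eq principal_ideal_def
  by (simp add: ideal_product_principal UNION_singleton_eq_range image_image)

lemma ideal_class_eq_iff:
  assumes "fractional_ideal F I" "fractional_ideal F J"
  shows "ideal_class I = ideal_class J \<longleftrightarrow> (\<exists>a\<in>F - {0}. I = scale a J)"
proof
  have "I \<in> ideal_class I"
    unfolding ideal_class_eq[OF assms(1)]
    using closed_subfield_1[OF F] by (intro image_eqI[of _ _ 1]) (simp_all add: scale_1)
  then show "\<exists>a\<in>F - {0}. I = scale a J" if "ideal_class I = ideal_class J"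
    using that by (auto simp: ideal_class_eq[OF assms(2)])
next
  assume "\<exists>a\<in>F - {0}. I = scale a J"
  then obtain a where a: "a \<in> F" "a \<noteq> 0" "I = scale a J" by auto
  have J: "J = scale (inverse a) I" using a by (simp add: scale_scale scale_1)
  have "(\<lambda>c. scale c (scale d Y)) ` (F - {0}) \<subseteq> (\<lambda>c. scale c Y) ` (F - {0})"
    if "d \<in> F" "d \<noteq> 0" for d Y
    using that closed_subfield_mult[OF F] by (auto simp: scale_scale)
  note sub = this
  have "inverse a \<in> F" "inverse a \<noteq> 0" using a closed_subfield_inverse[OF F] by auto
  then show "ideal_class I = ideal_class J"
    unfolding ideal_class_eq[OF assms(1)] ideal_class_eq[OF assms(2)]
    using sub[of a J, unfolded a(3)[symmetric]] sub[of "inverse a" I, unfolded J[symmetric]] a(1,2) by blast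
qed

lemma comm_group_class_group: "comm_group (ideal_class_group F)"
  unfolding ideal_class_group_def
  by (rule comm_group.abelian_FactGroup[OF comm_group_fractional_ideal_group subgroup_principal])

lemma carrier_class_group: "carrier (ideal_class_group F) = ideal_class ` {I. fractional_ideal F I}"
  unfolding ideal_class_group_def FactGroup_def RCOSETS_def ideal_class_def
  by (simp add: UNION_singleton_eq_range)

lemma class_group_mult:
  assumes "fractional_ideal F I" "fractional_ideal F J"
  shows "ideal_class I \<otimes>\<^bsub>ideal_class_group F\<^esub> ideal_class J = ideal_class (ideal_product I J)"
proof -
  interpret G: comm_group "fractional_ideal_group F" by (rule comm_group_fractional_ideal_group)
  interpret N: normal "principal_fractional_ideals F" "fractional_ideal_group F"
    by (rule G.subgroup_imp_normal[OF subgroup_principal])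
  show ?thesis
    using N.rcos_sum[of I J] assms by (simp add: ideal_class_group_def FactGroup_def ideal_class_def)
qed

lemma class_group_one: "\<one>\<^bsub>ideal_class_group F\<^esub> = ideal_class R"
proof -
  have "\<one>\<^bsub>ideal_class_group F\<^esub> = principal_fractional_ideals F"
    by (simp add: ideal_class_group_def FactGroup_def)
  then show ?thesis
    by (simp add: ideal_class_eq[OF fractional_ideal_R] principal_fractional_ideals_eq principal_ideal_def)
qed

lemma finite_class_group: "finite (carrier (ideal_class_group F))"
proof -
  obtain \<R> where \<R>: "finite \<R>" "\<And>I. fractional_ideal F I \<Longrightarrow> \<exists>a\<in>F - {0}. scale a I \<in> \<R>"
    using finite_ideal_classes_scale by blast
  have "carrier (ideal_class_group F) \<subseteq> ideal_class ` \<R>"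
  proof
    fix Y assume "Y \<in> carrier (ideal_class_group F)"
    then obtain I where I: "fractional_ideal F I" "Y = ideal_class I" by (auto simp: carrier_class_group)
    obtain a where a: "a \<in> F - {0}" "scale a I \<in> \<R>" using \<R>(2)[OF I(1)] by blast
    have "ideal_class (scale a I) = Y"
      using I a(1) by (subst I(2), subst ideal_class_eq_iff) (auto intro: fractional_ideal_scale)
    then show "Y \<in> ideal_class ` \<R>" using a(2) by blast
  qed
  then show ?thesis using \<R>(1) finite_surj by blast
qed

end

section \<open>Automorphisms and ideals\<close>

definition field_aut :: "'a::field set \<Rightarrow> ('a \<Rightarrow> 'a) \<Rightarrow> bool" where
  "field_aut L h \<longleftrightarrow> h ` L = L \<and> h 1 = 1 \<and>
     (\<forall>x\<in>L. \<forall>y\<in>L. h (x + y) = h x + h y \<and> h (x * y) = h x * h y)"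

locale field_automorphism =
  fixes L :: "'a::field_char_0 set" and h
  assumes L: "closed_subfield L" and aut: "field_aut L h"
begin

lemma h_in: "x \<in> L \<Longrightarrow> h x \<in> L"
  and h_add: "x \<in> L \<Longrightarrow> y \<in> L \<Longrightarrow> h (x + y) = h x + h y"
  and h_mult: "x \<in> L \<Longrightarrow> y \<in> L \<Longrightarrow> h (x * y) = h x * h y"
  and h_1: "h 1 = 1"
  and h_image: "h ` L = L"
  using aut by (auto simp: field_aut_def)

lemma h_0: "h 0 = 0"
  using h_add[of 0 0] closed_subfield_0[OF L] by simp

lemma h_uminus: "x \<in> L \<Longrightarrow> h (- x) = - h x"
  using h_add[of x "- x"] closed_subfield_uminus[OF L] h_0 by (simp add: eq_neg_iff_add_eq_0 add.commute)

lemma h_diff: "x \<in> L \<Longrightarrow> y \<in> L \<Longrightarrow> h (x - y) = h x - h y"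
  using h_add[of x "- y"] closed_subfield_uminus[OF L] h_uminus by simp

lemma h_eq_0_iff: "x \<in> L \<Longrightarrow> h x = 0 \<longleftrightarrow> x = 0"
  using h_mult[of x "inverse x"] closed_subfield_inverse[OF L, of x] h_1 h_0 by (cases "x = 0") auto

lemma h_inj_on: "inj_on h L"
proof (rule inj_onI)
  fix x y assume "x \<in> L" "y \<in> L" "h x = h y"
  then show "x = y" using h_diff[of x y] h_eq_0_iff[of "x - y"] closed_subfield_diff[OF L] by simp
qed

lemma h_sum: "(\<And>i. i \<in> A \<Longrightarrow> f i \<in> L) \<Longrightarrow> h (\<Sum>i\<in>A. f i) = (\<Sum>i\<in>A. h (f i))"
  by (induction A rule: infinite_finite_induct) (simp_all add: h_0 h_add closed_subfield_sum[OF L])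

lemma h_prod: "(\<And>i. i \<in> A \<Longrightarrow> f i \<in> L) \<Longrightarrow> h (\<Prod>i\<in>A. f i) = (\<Prod>i\<in>A. h (f i))"
  by (induction A rule: infinite_finite_induct) (simp_all add: h_1 h_mult closed_subfield_prod[OF L])

lemma h_power: "x \<in> L \<Longrightarrow> h (x ^ n) = h x ^ n"
  by (induction n) (simp_all add: h_1 h_mult closed_subfield_power[OF L])

lemma h_of_nat: "h (of_nat n) = of_nat n"
  by (induction n) (simp_all add: h_0 h_1 h_add closed_subfield_1[OF L] closed_subfield_of_nat[OF L])

lemma h_of_int: "h (of_int n) = of_int n"
  by (cases n) (simp_all add: h_of_nat h_uminus closed_subfield_of_nat[OF L] del: of_nat_Suc)

lemma h_poly:
  assumes "x \<in> L"
  shows "h (poly (map_poly of_int p) x) = poly (map_poly of_int p) (h x)"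
proof -
  have "h (poly (map_poly of_int p) x) = (\<Sum>i\<le>degree p. h (of_int (coeff p i) * x ^ i))"
    unfolding poly_altdef
    by (simp add: coeff_map_poly h_sum assms closed_subfield_mult[OF L] closed_subfield_of_int[OF L] closed_subfield_power[OF L])
  also have "\<dots> = (\<Sum>i\<le>degree p. of_int (coeff p i) * h x ^ i)"
    by (simp add: h_mult assms closed_subfield_of_int[OF L] closed_subfield_power[OF L] h_of_int h_power)
  finally show ?thesis by (simp add: poly_altdef coeff_map_poly)
qed

lemma poly_in_L: "x \<in> L \<Longrightarrow> poly (map_poly of_int p) x \<in> L"
  unfolding poly_altdef
  by (intro closed_subfield_sum[OF L] closed_subfield_mult[OF L] closed_subfield_power[OF L])
    (simp_all add: coeff_map_poly closed_subfield_of_int[OF L])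

text \<open>The map \<open>h\<close> commutes with integer polynomials and sends only 0 to 0, so
  \<open>x\<close> and \<open>h x\<close> satisfy the same monic integer equations.\<close>

lemma algebraic_int_h_iff: "x \<in> L \<Longrightarrow> algebraic_int (h x) \<longleftrightarrow> algebraic_int x"
  unfolding algebraic_int_altdef_ipoly by (simp add: h_eq_0_iff poly_in_L flip: h_poly)

lemma h_ring_of_integers: "h ` ring_of_integers L = ring_of_integers L"
proof -
  have "h ` ring_of_integers L = h ` L \<inter> {x. algebraic_int x}"
    using algebraic_int_h_iff by (auto simp: ring_of_integers_def)
  then show ?thesis by (auto simp: h_image ring_of_integers_def)
qed

lemma additive_subgroup_h_image:
  assumes "additive_subgroup I" "I \<subseteq> L"
  shows "additive_subgroup (h ` I)"
proof (rule additive_subgroupI)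
  show "0 \<in> h ` I" using additive_subgroup_0[OF assms(1)] h_0 by force
  fix x y assume "x \<in> h ` I" "y \<in> h ` I"
  then obtain u v where "u \<in> I" "v \<in> I" "x = h u" "y = h v" by auto
  then show "x - y \<in> h ` I"
    using assms additive_subgroup_diff[OF assms(1), of u v] by (intro image_eqI[of _ _ "u - v"]) (auto simp: h_diff subset_iff)
qed

lemma h_image_zspan:
  assumes "S \<subseteq> L"
  shows "h ` zspan S = zspan (h ` S)"
proof
  have SL: "zspan S \<subseteq> L" using assms by (intro zspan_minimal additive_subgroup_closed_subfield L)
  have "zspan S \<subseteq> {x \<in> L. h x \<in> zspan (h ` S)}"
  proof (rule zspan_minimal[OF additive_subgroupI])
    show "0 \<in> {x \<in> L. h x \<in> zspan (h ` S)}" by (simp add: h_0 zspan.zero closed_subfield_0[OF L])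
    show "S \<subseteq> {x \<in> L. h x \<in> zspan (h ` S)}" using assms by (auto intro: zspan.base)
  qed (auto simp: h_diff closed_subfield_diff[OF L] intro: zspan.diff)
  then show "h ` zspan S \<subseteq> zspan (h ` S)" by auto
  show "zspan (h ` S) \<subseteq> h ` zspan S"
    by (rule zspan_minimal[OF additive_subgroup_h_image[OF additive_subgroup_zspan SL]]) (auto intro: zspan.base)
qed

lemma h_image_ideal_product:
  assumes "I \<subseteq> L" "J \<subseteq> L"
  shows "h ` ideal_product I J = ideal_product (h ` I) (h ` J)"
proof
  show "h ` ideal_product I J \<subseteq> ideal_product (h ` I) (h ` J)"
  proof clarify
    fix z assume "z \<in> ideal_product I J"
    then obtain n :: nat and x y where z: "z = (\<Sum>i<n. x i * y i)" "\<forall>i<n. x i \<in> I" "\<forall>i<n. y i \<in> J"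
      by (auto simp: ideal_product_def)
    have "h z = (\<Sum>i<n. h (x i) * h (y i))"
      unfolding z(1) using z(2,3) assms by (subst h_sum) (auto simp: h_mult subset_iff intro!: closed_subfield_mult[OF L])
    then show "h z \<in> ideal_product (h ` I) (h ` J)"
      unfolding ideal_product_def using z(2,3)
      by (intro CollectI exI[of _ n] exI[of _ "\<lambda>i. h (x i)"] exI[of _ "\<lambda>i. h (y i)"]) auto
  qed
  show "ideal_product (h ` I) (h ` J) \<subseteq> h ` ideal_product I J"
  proof
    fix z assume "z \<in> ideal_product (h ` I) (h ` J)"
    then obtain n :: nat and x y where z: "z = (\<Sum>i<n. x i * y i)" "\<forall>i\<in>{..<n}. x i \<in> h ` I" "\<forall>i\<in>{..<n}. y i \<in> h ` J"
      by (auto simp: ideal_product_def)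
    have "\<forall>i\<in>{..<n}. \<exists>u. u \<in> I \<and> x i = h u" "\<forall>i\<in>{..<n}. \<exists>v. v \<in> J \<and> y i = h v" using z by blast+
    from bchoice[OF this(1)] bchoice[OF this(2)] obtain u v
      where uv: "\<And>i. i < n \<Longrightarrow> u i \<in> I \<and> x i = h (u i)" "\<And>i. i < n \<Longrightarrow> v i \<in> J \<and> y i = h (v i)" by auto
    have "z = (\<Sum>i<n. h (u i * v i))"
      unfolding z(1) using uv assms by (intro sum.cong) (auto simp: h_mult subset_iff)
    also have "\<dots> = h (\<Sum>i<n. u i * v i)"
      using uv assms by (intro h_sum[symmetric] closed_subfield_mult[OF L]) auto
    finally show "z \<in> h ` ideal_product I J"
      unfolding ideal_product_def using uv by blast
  qed
qed

lemma h_image_scale: "a \<in> L \<Longrightarrow> I \<subseteq> L \<Longrightarrow> h ` scale a I = scale (h a) (h ` I)"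
  unfolding scale_def image_image by (intro image_cong) (auto simp: h_mult)

end

locale number_field_automorphism = number_field_locale L + field_automorphism L h
  for L :: "'a::field_char_0 set" and h
begin

lemma fractional_ideal_h_image:
  assumes I: "fractional_ideal L I"
  shows "fractional_ideal L (h ` I)"
proof -
  note IL = fractional_ideal_subset[OF I]
  obtain x where x: "x \<in> I" "x \<noteq> 0" using fractional_ideal_nonzero[OF I] by auto
  obtain d where d: "d \<in> R" "d \<noteq> 0" "\<And>x. x \<in> I \<Longrightarrow> d * x \<in> R"
    using fractional_ideal_denominator[OF I] by auto
  show ?thesis
  proof (rule fractional_idealI[of _ "h x" "h d"])
    show "h ` I \<subseteq> L" using IL h_in by auto
    show "additive_subgroup (h ` I)" by (intro additive_subgroup_h_image additive_subgroup_fractional_ideal I IL)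
    show "h x \<in> h ` I" "h x \<noteq> 0" using x IL h_eq_0_iff by auto
    show "h d \<in> R" using d h_ring_of_integers by blast
    show "h d \<noteq> 0" using d R_subset_F h_eq_0_iff by auto
    show "h d * y \<in> R" if y: "y \<in> h ` I" for y
    proof -
      obtain u where u: "u \<in> I" "y = h u" using y by auto
      have "h d * y = h (d * u)" using u d(1) IL R_subset_F by (simp add: h_mult subset_iff)
      then show ?thesis using d(3)[OF u(1)] h_ring_of_integers by blast
    qed
    show "a * y \<in> h ` I" if a: "a \<in> R" and y: "y \<in> h ` I" for a y
    proof -
      obtain u where u: "u \<in> I" "y = h u" using y by auto
      obtain b where b: "b \<in> R" "a = h b" using a h_ring_of_integers by (metis imageE)
      have "a * y = h (b * u)" using u b IL R_subset_F by (simp add: h_mult subset_iff)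
      then show ?thesis using fractional_ideal_mult[OF I b(1) u(1)] by blast
    qed
  qed
qed

text \<open>Classes are sets of sets, hence the double image. The scalars \<open>h a\<close> run
  through all nonzero elements of \<open>L\<close> again.\<close>

lemma image_ideal_class:
  assumes I: "fractional_ideal L I"
  shows "(`) h ` ideal_class I = ideal_class (h ` I)"
proof -
  have "(`) h ` ideal_class I = (\<lambda>a. scale (h a) (h ` I)) ` (L - {0})"
    unfolding ideal_class_eq[OF I] image_image
    using h_image_scale[OF _ fractional_ideal_subset[OF I]] by (intro image_cong) auto
  also have "\<dots> = (\<lambda>a. scale a (h ` I)) ` h ` (L - {0})" by (simp only: image_image)
  also have "h ` (L - {0}) = L - {0}"
    using h_image h_eq_0_iff by (auto simp: h_in)
  finally show ?thesis by (simp add: ideal_class_eq[OF fractional_ideal_h_image[OF I]])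
qed

end

context number_field_locale
begin

lemma ideal_class_carrier: "fractional_ideal F I \<Longrightarrow> ideal_class I \<in> carrier (ideal_class_group F)"
  by (auto simp: carrier_class_group)

lemma fractional_ideal_power:
  "fractional_ideal F I \<Longrightarrow> fractional_ideal F (I [^]\<^bsub>fractional_ideal_group F\<^esub> (n::nat))"
  using monoid.nat_pow_closed[of "fractional_ideal_group F" I n]
    comm_group_fractional_ideal_group by (simp add: comm_group_def group_def)

lemma ideal_class_power:
  assumes "fractional_ideal F I"
  shows "ideal_class (I [^]\<^bsub>fractional_ideal_group F\<^esub> n) = ideal_class I [^]\<^bsub>ideal_class_group F\<^esub> (n::nat)"
proof (induction n)
  case 0
  show ?case by (simp add: class_group_one)
next
  case (Suc n)
  then show ?case
    using class_group_mult[OF fractional_ideal_power[OF assms, of n] assms] by simp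
qed

lemma common_denominator_nat:
  assumes "finite Z" "Z \<subseteq> F"
  obtains d :: nat where "d > 0" "\<And>z. z \<in> Z \<Longrightarrow> of_nat d * z \<in> R"
  using assms
proof (induction Z arbitrary: thesis rule: finite_induct)
  case empty
  show ?case by (rule empty(1)[of 1]) auto
next
  case (insert z Z)
  obtain d :: nat where d: "d > 0" "\<And>z. z \<in> Z \<Longrightarrow> of_nat d * z \<in> R" using insert by blast
  obtain e :: nat where e: "e > 0" "of_nat e * z \<in> R" using denominator[of z] insert.prems by auto
  show ?case
  proof (rule insert.prems(1)[of "d * e"])
    fix y assume y: "y \<in> insert z Z"
    show "of_nat (d * e) * y \<in> R"
    proof (cases "y = z")
      case True
      then show ?thesis using mult_in_R[OF of_int_in_R[of "int d"] e(2)] by (simp add: mult.assoc)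
    next
      case False
      then have "of_nat d * y \<in> R" using y d(2) by auto
      then show ?thesis using mult_in_R[OF of_int_in_R[of "int e"], of "of_nat d * y"] by (simp add: mult.left_commute mult.assoc)
    qed
  qed (use d e in simp)
qed

lemma fractional_ideal_generated:
  assumes "finite Z" "Z \<subseteq> F" "z \<in> Z" "z \<noteq> 0"
  shows "fractional_ideal F (ideal_product (zspan Z) R)"
proof -
  obtain d :: nat where d: "d > 0" "\<And>z. z \<in> Z \<Longrightarrow> of_nat d * z \<in> R"
    using common_denominator_nat[OF assms(1,2)] by blast
  have ZF: "zspan Z \<subseteq> F" by (intro zspan_minimal additive_subgroup_closed_subfield F assms)
  have "zspan Z \<subseteq> {z. of_nat d * z \<in> R}"
    using d(2) by (intro zspan_minimal additive_subgroup_vimage_mult additive_subgroup_R) auto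
  then have dZ: "of_nat d * z \<in> R" if "z \<in> zspan Z" for z using that by auto
  note add = additive_subgroup_ideal_product[OF additive_subgroup_zspan]
  show ?thesis
  proof (rule fractional_idealI[of _ "z * 1" "of_nat d"])
    show "ideal_product (zspan Z) R \<subseteq> F"
      using ZF R_subset_F by (intro ideal_product_subset additive_subgroup_closed_subfield F) (auto intro!: closed_subfield_mult[OF F])
    show "additive_subgroup (ideal_product (zspan Z) R)" by (rule add)
    show "z * 1 \<in> ideal_product (zspan Z) R" by (intro ideal_product_memI zspan.base assms one_in_R)
    show "of_nat d \<in> R" using of_int_in_R[of "int d"] by simp
    show "a * x \<in> ideal_product (zspan Z) R" if a: "a \<in> R" and x: "x \<in> ideal_product (zspan Z) R" for a x
    proof -
      have "a * (u * v) \<in> ideal_product (zspan Z) R" if "u \<in> zspan Z" "v \<in> R" for u v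
        using ideal_product_memI[OF that(1) mult_in_R[OF a that(2)]] by (simp add: mult.left_commute)
      then have "ideal_product (zspan Z) R \<subseteq> {x. a * x \<in> ideal_product (zspan Z) R}"
        by (intro ideal_product_subset additive_subgroup_vimage_mult add) auto
      then show ?thesis using x by auto
    qed
    show "of_nat d * x \<in> R" if x: "x \<in> ideal_product (zspan Z) R" for x
    proof -
      have "of_nat d * (u * v) \<in> R" if "u \<in> zspan Z" "v \<in> R" for u v
        using mult_in_R[OF dZ[OF that(1)] that(2)] by (simp add: mult.assoc)
      then have "ideal_product (zspan Z) R \<subseteq> {x. of_nat d * x \<in> R}"
        by (intro ideal_product_subset additive_subgroup_vimage_mult additive_subgroup_R) auto
      then show ?thesis using x by auto
    qed
  qed (use d assms in auto)
qed

section \<open>Contents of polynomials and Gauss's lemma\<close>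

definition content :: "'a poly \<Rightarrow> 'a set" where
  "content f = ideal_product (zspan (range (coeff f))) R"

lemma finite_range_coeff: "finite (range (coeff f))"
  by (simp add: range_coeff)

lemma fractional_ideal_content:
  assumes "range (coeff f) \<subseteq> F" "f \<noteq> 0"
  shows "fractional_ideal F (content f)"
  unfolding content_def
  by (rule fractional_ideal_generated[OF finite_range_coeff assms(1), of "Polynomial.lead_coeff f"])
    (use assms(2) in auto)

lemma coeff_in_content: "coeff f i \<in> content f"
  using ideal_product_memI[OF zspan.base[of "coeff f i" "range (coeff f)"] one_in_R] by (simp add: content_def)

lemma content_subset:
  assumes "\<And>i. coeff f i \<in> I" "fractional_ideal F I"
  shows "content f \<subseteq> I"
proof -
  have "zspan (range (coeff f)) \<subseteq> I"
    using assms by (intro zspan_minimal additive_subgroup_fractional_ideal) auto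
  then have "x * y \<in> I" if "x \<in> zspan (range (coeff f))" "y \<in> R" for x y
    using fractional_ideal_mult[OF assms(2) that(2), of x] that(1) by (auto simp: mult.commute)
  then show ?thesis
    unfolding content_def using assms(2)
    by (intro ideal_product_subset additive_subgroup_fractional_ideal)
qed

text \<open>The harder inclusion uses an inverse \<open>J\<close> of the content of the product. For
  \<open>d\<close> in \<open>J\<close> the polynomial \<open>d * f * g\<close> has integral
  coefficients, so by Dedekind's theorem each \<open>d * coeff f i * coeff g j\<close> is integral.
  Hence \<open>J\<close> times the product of the contents lies in \<open>R\<close>, and multiplying
  by the content of \<open>f * g\<close> removes \<open>J\<close>.\<close>

lemma content_mult:
  assumes f: "range (coeff f) \<subseteq> F" "f \<noteq> 0" and g: "range (coeff g) \<subseteq> F" "g \<noteq> 0"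
  shows "content (f * g) = ideal_product (content f) (content g)"
proof
  note fi_f = fractional_ideal_content[OF f] and fi_g = fractional_ideal_content[OF g]
  note fi = fractional_ideal_product[OF fi_f fi_g]
  have fg: "range (coeff (f * g)) \<subseteq> F" "f * g \<noteq> 0"
    using f g by (auto simp: coeff_mult intro!: closed_subfield_sum[OF F] closed_subfield_mult[OF F])
  note fi_fg = fractional_ideal_content[OF fg]
  show "content (f * g) \<subseteq> ideal_product (content f) (content g)"
    by (intro content_subset fi)
      (auto simp: coeff_mult intro!: additive_subgroup_sum[OF additive_subgroup_fractional_ideal[OF fi]]
        ideal_product_memI coeff_in_content)
  obtain J where J: "fractional_ideal F J" "ideal_product (content (f * g)) J = R"
    using fractional_ideal_invertible[OF fi_fg] .
  have key: "d * (coeff f i * coeff g j) \<in> R" if d: "d \<in> J" for d i j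
  proof -
    have dF: "d \<in> F" using d fractional_ideal_subset[OF J(1)] by auto
    have "algebraic_int (coeff (Polynomial.smult d f) i * coeff g j)"
    proof (rule algebraic_int_coeff_products)
      fix i
      have "coeff (f * g) i * d \<in> R" using ideal_product_memI[OF coeff_in_content d, of "f * g" i] J(2) by simp
      then show "algebraic_int (coeff (Polynomial.smult d f * g) i)" by (simp add: R_iff mult.commute)
    qed
    moreover have "d * (coeff f i * coeff g j) \<in> F"
      using dF f g by (intro closed_subfield_mult[OF F]) auto
    ultimately show ?thesis by (simp add: R_iff mult.assoc)
  qed
  have add: "additive_subgroup I" if "fractional_ideal F I" for I
    using that by (rule additive_subgroup_fractional_ideal)
  have 1: "d * (x * y) \<in> R" if d: "d \<in> J" and x: "x \<in> content f" and y: "y \<in> content g" for d x y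
  proof -
    have a: "d * (coeff f i * y) \<in> R" for i
    proof -
      have "zspan (range (coeff g)) \<subseteq> {y. d * coeff f i * y \<in> R}"
        using key[OF d] by (intro zspan_minimal additive_subgroup_vimage_mult additive_subgroup_R) (auto simp: mult.assoc)
      then have "content g \<subseteq> {y. d * coeff f i * y \<in> R}"
        unfolding content_def
        by (intro ideal_product_subset additive_subgroup_vimage_mult additive_subgroup_R)
          (auto simp flip: mult.assoc intro: mult_in_R)
      then show ?thesis using y by (auto simp: mult.assoc)
    qed
    have "zspan (range (coeff f)) \<subseteq> {x. d * y * x \<in> R}"
      using a by (intro zspan_minimal additive_subgroup_vimage_mult additive_subgroup_R) (auto simp: mult_ac)
    then have "content f \<subseteq> {x. d * y * x \<in> R}"
      unfolding content_def
      by (intro ideal_product_subset additive_subgroup_vimage_mult additive_subgroup_R)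
        (auto simp flip: mult.assoc intro: mult_in_R)
    then show ?thesis using x by (auto simp: mult_ac)
  qed
  have sub: "ideal_product J (ideal_product (content f) (content g)) \<subseteq> R"
  proof (rule ideal_product_subset[OF _ additive_subgroup_R])
    fix d z assume d: "d \<in> J" and z: "z \<in> ideal_product (content f) (content g)"
    have "ideal_product (content f) (content g) \<subseteq> {z. d * z \<in> R}"
      using 1[OF d] by (intro ideal_product_subset additive_subgroup_vimage_mult additive_subgroup_R) auto
    then show "d * z \<in> R" using z by auto
  qed
  have "ideal_product (content f) (content g) = ideal_product R (ideal_product (content f) (content g))"
    by (rule ideal_product_R[OF fi, symmetric])
  also have "\<dots> = ideal_product (content (f * g)) (ideal_product J (ideal_product (content f) (content g)))"
    unfolding J(2)[symmetric] by (rule ideal_product_assoc[OF add[OF fi_fg] add[OF fi]])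
  also have "\<dots> \<subseteq> ideal_product (content (f * g)) R" by (intro ideal_product_mono sub) simp
  also have "\<dots> = content (f * g)"
    using ideal_product_R[OF fi_fg] by (simp only: ideal_product_commute[of _ R])
  finally show "ideal_product (content f) (content g) \<subseteq> content (f * g)" .
qed

text \<open>Finitely many generators serve as the coefficients. Conjugation, extension and norm of
  ideals can then be carried out on polynomials.\<close>

lemma fractional_ideal_eq_content:
  assumes I: "fractional_ideal F I"
  obtains f where "range (coeff f) \<subseteq> F" "f \<noteq> 0" "I = content f"
proof -
  obtain V where V: "finite V" "I = zspan V" using fractional_ideal_finitely_generated[OF I] .
  obtain v :: "nat \<Rightarrow> 'a" and m where v: "V = v ` {..<m}" using V(1) by (rule finite_indexed)
  have VI: "V \<subseteq> I" using V(2) by (auto intro: zspan.base)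
  define f where "f = Poly (map v [0..<m])"
  have cf: "coeff f i = (if i < m then v i else 0)" for i
    by (simp add: f_def nth_default_def)
  have fI: "coeff f i \<in> I" for i
    using VI additive_subgroup_0[OF additive_subgroup_fractional_ideal[OF I]] v by (auto simp: cf)
  have "I \<subseteq> content f"
  proof -
    have "V \<subseteq> content f"
    proof
      fix x assume "x \<in> V"
      then obtain i where "i < m" "x = v i" using v by auto
      then show "x \<in> content f" using coeff_in_content[of f i] by (simp add: cf)
    qed
    then show ?thesis
      unfolding V(2) content_def
      by (intro zspan_minimal additive_subgroup_ideal_product additive_subgroup_zspan)
  qed
  then have eq: "I = content f" using content_subset[OF fI I] by auto
  moreover have "f \<noteq> 0"
  proof
    assume "f = 0"
    moreover have "zspan {0 :: 'a} \<subseteq> {0}" by (intro zspan_minimal) (auto simp: additive_subgroup_def)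
    ultimately have "content f \<subseteq> {0}"
      unfolding content_def by (intro ideal_product_subset) (auto simp: additive_subgroup_def)
    then show False using eq fractional_ideal_nonzero[OF I] by auto
  qed
  moreover have "range (coeff f) \<subseteq> F" using fI fractional_ideal_subset[OF I] by auto
  ultimately show ?thesis using that by blast
qed

end

section \<open>Extension of ideals along a Galois extension\<close>

lemma prod_mono_reindex:
  assumes "bij_betw \<phi> H H" "\<And>h. h \<in> H \<Longrightarrow> f (\<phi> h) = g h"
  shows "prod g H = prod f H"
  using prod.reindex_bij_betw[OF assms(1), of f] assms(2) by simp

text \<open>The set \<open>H\<close> stands for \<open>Gal(L/F)\<close>, given by functions on
  \<open>L\<close>. Finiteness supplies the group structure: left composition with an element of
  \<open>H\<close> is an injective map of a finite set to itself, hence a permutation.\<close>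

locale galois_pair =
  fixes F L :: "'a::field_char_0 set" and H :: "('a \<Rightarrow> 'a) set"
  assumes number_field_F: "number_field F" and number_field_L: "number_field L" and FL: "F \<subseteq> L"
    and finite_H: "finite H"
    and H_extensional: "h \<in> H \<Longrightarrow> h \<in> extensional L"
    and H_aut: "h \<in> H \<Longrightarrow> field_aut L h"
    and H_compose: "g \<in> H \<Longrightarrow> h \<in> H \<Longrightarrow> compose L g h \<in> H"
    and H_fixed: "x \<in> L \<Longrightarrow> (\<forall>h\<in>H. h x = x) \<longleftrightarrow> x \<in> F"
begin

sublocale FF: number_field_locale F by unfold_locales (rule number_field_F)
sublocale LL: number_field_locale L by unfold_locales (rule number_field_L)

lemma h_auto: "h \<in> H \<Longrightarrow> number_field_automorphism L h"
  by (simp add: number_field_automorphism_def LL.number_field_locale_axioms field_automorphism_def LL.F H_aut)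

lemma H_in: "h \<in> H \<Longrightarrow> x \<in> L \<Longrightarrow> h x \<in> L"
  using H_aut unfolding field_aut_def by blast

lemma bij_betw_compose:
  assumes g: "g \<in> H"
  shows "bij_betw (compose L g) H H"
proof -
  interpret g: number_field_automorphism L g by (rule h_auto[OF g])
  have inj: "inj_on (compose L g) H"
  proof (rule inj_onI)
    fix h h' assume h: "h \<in> H" "h' \<in> H" "compose L g h = compose L g h'"
    show "h = h'"
    proof (rule extensionalityI[OF H_extensional[OF h(1)] H_extensional[OF h(2)]])
      fix x assume x: "x \<in> L"
      have "g (h x) = g (h' x)" using fun_cong[OF h(3), of x] x by (simp add: compose_def)
      moreover have "h x \<in> L" "h' x \<in> L" by (rule H_in[OF _ x], rule h)+
      ultimately show "h x = h' x" using g.h_inj_on by (auto dest: inj_onD)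
    qed
  qed
  have "compose L g ` H = H"
    using inj H_compose[OF g] by (intro endo_inj_surj finite_H) auto
  then show ?thesis using inj by (simp add: bij_betw_def)
qed

text \<open>Applying an element of \<open>H\<close> permutes the factors, and \<open>F\<close> is
  the fixed field of \<open>H\<close>.\<close>

lemma norm_in_F:
  assumes a: "a \<in> L"
  shows "(\<Prod>h\<in>H. h a) \<in> F"
proof -
  have hL: "h a \<in> L" if "h \<in> H" for h by (rule H_in[OF that a])
  have "(\<Prod>h\<in>H. h a) \<in> L" by (intro closed_subfield_prod LL.F hL)
  moreover have "g (\<Prod>h\<in>H. h a) = (\<Prod>h\<in>H. h a)" if g: "g \<in> H" for g
  proof -
    interpret g: number_field_automorphism L g by (rule h_auto[OF g])
    have "g (\<Prod>h\<in>H. h a) = (\<Prod>h\<in>H. g (h a))" by (rule g.h_prod) (rule hL)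
    also have "\<dots> = (\<Prod>h\<in>H. h a)"
      by (rule prod_mono_reindex[OF bij_betw_compose[OF g]]) (simp add: compose_def a)
    finally show ?thesis .
  qed
  ultimately show ?thesis using H_fixed by blast
qed

definition extend :: "'a set \<Rightarrow> 'a set" where
  "extend I = ideal_product I LL.R"

lemma RF_subset_RL: "FF.R \<subseteq> LL.R"
  using FL by (auto simp: ring_of_integers_def)

lemma extend_R: "extend FF.R = LL.R"
proof
  show "extend FF.R \<subseteq> LL.R"
    unfolding extend_def
    by (rule ideal_product_subset[OF _ LL.additive_subgroup_R]) (use RF_subset_RL LL.mult_in_R in blast)
  show "LL.R \<subseteq> extend FF.R"
    unfolding extend_def using ideal_product_memI[OF FF.one_in_R, of _ LL.R] by fastforce
qed

text \<open>The extension of \<open>FF.R\<close> is \<open>LL.R\<close>, so by associativity the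
  same coefficients generate both sides. A polynomial over \<open>F\<close> thus represents an ideal
  and its extension at once.\<close>

lemma extend_content: "extend (FF.content f) = LL.content f"
proof -
  have "extend (FF.content f) = ideal_product (zspan (range (coeff f))) (ideal_product FF.R LL.R)"
    unfolding extend_def FF.content_def
    by (intro ideal_product_assoc additive_subgroup_zspan LL.additive_subgroup_R)
  then show ?thesis using extend_R by (simp add: extend_def LL.content_def)
qed

lemma fractional_ideal_extend:
  assumes "fractional_ideal F I"
  shows "fractional_ideal L (extend I)"
proof -
  obtain f where f: "range (coeff f) \<subseteq> F" "f \<noteq> 0" "I = FF.content f"
    using FF.fractional_ideal_eq_content[OF assms] by blast
  then show ?thesis using LL.fractional_ideal_content[of f] FL by (auto simp: extend_content)
qed

lemma extend_mult:
  assumes I: "fractional_ideal F I" and J: "fractional_ideal F J"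
  shows "extend (ideal_product I J) = ideal_product (extend I) (extend J)"
proof -
  note add = FF.additive_subgroup_fractional_ideal
  have "ideal_product (extend I) (extend J) = ideal_product I (ideal_product LL.R (extend J))"
    unfolding extend_def
    by (intro ideal_product_assoc add[OF I] additive_subgroup_ideal_product[OF add[OF J]])
  also have "\<dots> = ideal_product I (extend J)" by (simp add: LL.ideal_product_R fractional_ideal_extend J)
  also have "\<dots> = extend (ideal_product I J)"
    unfolding extend_def by (intro ideal_product_assoc[symmetric] add[OF I] LL.additive_subgroup_R)
  finally show ?thesis ..
qed

lemma extend_scale:
  "fractional_ideal F I \<Longrightarrow> extend (scale a I) = scale a (extend I)"
  unfolding extend_def
  by (intro ideal_product_scale FF.additive_subgroup_fractional_ideal LL.additive_subgroup_R)

lemma extend_power: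
  assumes I: "fractional_ideal F I"
  shows "extend (I [^]\<^bsub>fractional_ideal_group F\<^esub> n) = extend I [^]\<^bsub>fractional_ideal_group L\<^esub> (n::nat)"
proof (induction n)
  case 0
  show ?case by (simp add: extend_R)
next
  case (Suc n)
  then show ?case using extend_mult[OF FF.fractional_ideal_power[OF I, of n] I] by simp
qed

lemma subset_extend: "I \<subseteq> extend I"
  unfolding extend_def using ideal_product_memI[OF _ LL.one_in_R] by fastforce

text \<open>With an inverse \<open>J\<close> of \<open>I\<close>, an element \<open>x\<close> of the
  extension lying in \<open>F\<close> satisfies: \<open>x * y\<close> is integral and in
  \<open>F\<close> for all \<open>y\<close> in \<open>J\<close>. So \<open>x\<close> times
  \<open>ideal_product I J\<close> lies in \<open>I\<close>, and that product contains 1.\<close>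

lemma extend_contract:
  assumes I: "fractional_ideal F I"
  shows "extend I \<inter> F = I"
proof
  show "I \<subseteq> extend I \<inter> F" using subset_extend FF.fractional_ideal_subset[OF I] by auto
  obtain J where J: "fractional_ideal F J" "ideal_product I J = FF.R"
    using FF.fractional_ideal_invertible[OF I] .
  show "extend I \<inter> F \<subseteq> I"
  proof clarify
    fix x assume x: "x \<in> extend I" "x \<in> F"
    have xJ: "x * y \<in> FF.R" if y: "y \<in> J" for y
    proof -
      have "x * y \<in> ideal_product (extend I) (extend J)"
        using x(1) y subset_extend by (intro ideal_product_memI) auto
      also have "ideal_product (extend I) (extend J) = LL.R"
        using extend_mult[OF I J(1)] J(2) extend_R by simp
      finally have "algebraic_int (x * y)" by (simp add: LL.R_iff)
      moreover have "x * y \<in> F"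
        using x(2) y FF.fractional_ideal_subset[OF J(1)] by (intro closed_subfield_mult[OF FF.F]) auto
      ultimately show ?thesis by (simp add: FF.R_iff)
    qed
    have "x * (i * y) \<in> I" if "i \<in> I" "y \<in> J" for i y
      using FF.fractional_ideal_mult[OF I xJ[OF that(2)] that(1)] by (simp add: mult_ac)
    then have sub: "\<And>i y. i \<in> I \<Longrightarrow> y \<in> J \<Longrightarrow> i * y \<in> {z. x * z \<in> I}" by simp
    have "ideal_product I J \<subseteq> {z. x * z \<in> I}"
      by (rule ideal_product_subset[OF sub
            additive_subgroup_vimage_mult[OF FF.additive_subgroup_fractional_ideal[OF I]]])
    then have "1 \<in> {z. x * z \<in> I}" using J(2) FF.one_in_R by blast
    then show "x \<in> I" by simp
  qed
qed

lemma extend_inj: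
  "fractional_ideal F I \<Longrightarrow> fractional_ideal F J \<Longrightarrow> extend I = extend J \<Longrightarrow> I = J"
  using extend_contract by metis

lemma H_image_extend:
  assumes h: "h \<in> H" and I: "fractional_ideal F I"
  shows "h ` extend I = extend I"
proof -
  interpret h: number_field_automorphism L h by (rule h_auto[OF h])
  have IL: "I \<subseteq> L" using FF.fractional_ideal_subset[OF I] FL by auto
  have "h x = x" if "x \<in> I" for x
    using that h IL FF.fractional_ideal_subset[OF I] H_fixed by blast
  then have "h ` I = I" by force
  then show ?thesis
    unfolding extend_def using h.h_image_ideal_product[OF IL LL.R_subset_F] by (simp add: h.h_ring_of_integers)
qed

text \<open>Extended ideals are stable under \<open>H\<close>, so a relation
  \<open>extend I = scale a (extend J)\<close> holds with every conjugate \<open>h a\<close> in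
  place of \<open>a\<close>. The product of these relations replaces \<open>a\<close> by its norm,
  which lies in \<open>F\<close>, and injectivity of extension brings the relation down to
  \<open>F\<close>.\<close>

lemma ideal_class_power_eq_if_extend_eq:
  assumes I: "fractional_ideal F I" and J: "fractional_ideal F J"
    and eq: "LL.ideal_class (extend I) = LL.ideal_class (extend J)"
  shows "FF.ideal_class I [^]\<^bsub>ideal_class_group F\<^esub> card H = FF.ideal_class J [^]\<^bsub>ideal_class_group F\<^esub> card H"
proof -
  let ?GF = "fractional_ideal_group F" and ?GL = "fractional_ideal_group L"
  note eI = fractional_ideal_extend[OF I] and eJ = fractional_ideal_extend[OF J]
  obtain a where a: "a \<in> L" "a \<noteq> 0" "extend I = scale a (extend J)"
    using eq LL.ideal_class_eq_iff[OF eI eJ] by auto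
  note add = LL.additive_subgroup_fractional_ideal
  have h: "extend I = scale (h a) (extend J)" if h: "h \<in> H" for h
  proof -
    interpret h: number_field_automorphism L h by (rule h_auto[OF h])
    have "h ` extend I = scale (h a) (h ` extend J)"
      unfolding a(3) by (rule h.h_image_scale[OF a(1) LL.fractional_ideal_subset[OF eJ]])
    then show ?thesis using H_image_extend[OF h] I J by simp
  qed
  have "extend I [^]\<^bsub>?GL\<^esub> card S = scale (\<Prod>h\<in>S. h a) (extend J [^]\<^bsub>?GL\<^esub> card S)"
    if "S \<subseteq> H" for S
    using finite_subset[OF that finite_H] that
  proof (induction S rule: finite_induct)
    case empty
    show ?case by (simp add: scale_1)
  next
    case (insert h S)
    note pJ = LL.fractional_ideal_power[OF eJ, of "card S"]
    have "extend I [^]\<^bsub>?GL\<^esub> card (insert h S) = ideal_product (extend I [^]\<^bsub>?GL\<^esub> card S) (extend I)"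
      using insert by simp
    also have "\<dots> = ideal_product (scale (\<Prod>h\<in>S. h a) (extend J [^]\<^bsub>?GL\<^esub> card S)) (scale (h a) (extend J))"
    proof (rule arg_cong2[of _ _ _ _ ideal_product])
      show "extend I [^]\<^bsub>?GL\<^esub> card S = scale (\<Prod>h\<in>S. h a) (extend J [^]\<^bsub>?GL\<^esub> card S)"
        using insert by simp
      show "extend I = scale (h a) (extend J)" by (rule h) (use insert in simp)
    qed
    also have "\<dots> = scale (\<Prod>h\<in>S. h a) (ideal_product (scale (h a) (extend J)) (extend J [^]\<^bsub>?GL\<^esub> card S))"
      by (simp add: ideal_product_scale add pJ eJ additive_subgroup_scale
          ideal_product_commute[of "extend J [^]\<^bsub>?GL\<^esub> card S" "scale (h a) (extend J)"])
    also have "\<dots> = scale ((\<Prod>h\<in>S. h a) * h a) (ideal_product (extend J [^]\<^bsub>?GL\<^esub> card S) (extend J))"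
      by (simp add: ideal_product_scale add pJ eJ scale_scale
          ideal_product_commute[of "extend J [^]\<^bsub>?GL\<^esub> card S" "extend J"])
    finally show ?case using insert by (simp add: mult.commute)
  qed
  from this[OF subset_refl]
  have "extend (I [^]\<^bsub>?GF\<^esub> card H) = extend (scale (\<Prod>h\<in>H. h a) (J [^]\<^bsub>?GF\<^esub> card H))"
    by (simp add: extend_power I J extend_scale FF.fractional_ideal_power)
  moreover have "(\<Prod>h\<in>H. h a) \<noteq> 0"
  proof -
    have "h a \<noteq> 0" if "h \<in> H" for h
    proof -
      interpret h: number_field_automorphism L h by (rule h_auto[OF that])
      show ?thesis using h.h_eq_0_iff a by simp
    qed
    then show ?thesis using finite_H by simp
  qed
  ultimately have "I [^]\<^bsub>?GF\<^esub> card H = scale (\<Prod>h\<in>H. h a) (J [^]\<^bsub>?GF\<^esub> card H)"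
    using extend_inj[OF FF.fractional_ideal_power[OF I] FF.fractional_ideal_scale[OF FF.fractional_ideal_power[OF J] norm_in_F[OF a(1)]]]
    by blast
  then have "FF.ideal_class (I [^]\<^bsub>?GF\<^esub> card H) = FF.ideal_class (J [^]\<^bsub>?GF\<^esub> card H)"
    unfolding FF.ideal_class_eq_iff[OF FF.fractional_ideal_power[OF I] FF.fractional_ideal_power[OF J]]
    using norm_in_F[OF a(1)] \<open>(\<Prod>h\<in>H. h a) \<noteq> 0\<close> by blast
  then show ?thesis by (simp add: FF.ideal_class_power I J)
qed

section \<open>Norms of polynomials and of ideals\<close>

lemma map_poly_mult_on:
  assumes h: "h \<in> H" and f: "range (coeff f) \<subseteq> L" and g: "range (coeff g) \<subseteq> L"
  shows "map_poly h (f * g) = map_poly h f * map_poly h g"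
proof -
  interpret h: number_field_automorphism L h by (rule h_auto[OF h])
  show ?thesis
  proof (rule poly_eqI)
    fix i
    have "h (\<Sum>j\<le>i. coeff f j * coeff g (i - j)) = (\<Sum>j\<le>i. h (coeff f j * coeff g (i - j)))"
      using f g by (intro h.h_sum closed_subfield_mult[OF LL.F]) auto
    also have "\<dots> = (\<Sum>j\<le>i. h (coeff f j) * h (coeff g (i - j)))"
      using f g by (intro sum.cong refl h.h_mult) auto
    finally show "coeff (map_poly h (f * g)) i = coeff (map_poly h f * map_poly h g) i"
      by (simp add: coeff_map_poly h.h_0 coeff_mult)
  qed
qed

lemma range_coeff_prod:
  "finite S \<Longrightarrow> (\<And>s. s \<in> S \<Longrightarrow> range (coeff (f s)) \<subseteq> L) \<Longrightarrow> range (coeff (\<Prod>s\<in>S. f s)) \<subseteq> L"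
proof (induction S rule: finite_induct)
  case empty
  show ?case using closed_subfield_0[OF LL.F] closed_subfield_1[OF LL.F] by (auto simp: coeff_1)
next
  case (insert s S)
  then show ?case
    by (force simp: coeff_mult intro!: closed_subfield_sum[OF LL.F] closed_subfield_mult[OF LL.F])
qed

text \<open>An element of \<open>H\<close> permutes the conjugate polynomials, so it fixes every
  coefficient of their product.\<close>

lemma norm_poly_coeff_in_F:
  assumes f: "range (coeff f) \<subseteq> L"
  shows "range (coeff (\<Prod>h\<in>H. map_poly h f)) \<subseteq> F"
proof -
  have h0: "h 0 = 0" if "h \<in> H" for h
    using field_automorphism.h_0[OF field_automorphism.intro] LL.F H_aut[OF that] by blast
  have hf: "range (coeff (map_poly h f)) \<subseteq> L" if "h \<in> H" for h
    using f H_in[OF that] by (auto simp: coeff_map_poly h0[OF that])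
  define N where "N = (\<Prod>h\<in>H. map_poly h f)"
  have N: "range (coeff N) \<subseteq> L"
    unfolding N_def using hf by (intro range_coeff_prod finite_H)
  have "map_poly g N = N" if g: "g \<in> H" for g
  proof -
    have "map_poly g (\<Prod>h\<in>S. map_poly h f) = (\<Prod>h\<in>S. map_poly g (map_poly h f))" if "S \<subseteq> H" for S
      using finite_subset[OF that finite_H] that
    proof (induction S rule: finite_induct)
      case empty
      show ?case using H_aut[OF g] h0[OF g] by (simp add: field_aut_def map_poly_1)
    next
      case (insert s S)
      then show ?case
        using map_poly_mult_on[OF g hf[of s] range_coeff_prod[of S "\<lambda>h. map_poly h f"]] hf
        by (auto simp: subset_iff)
    qed
    then have "map_poly g N = (\<Prod>h\<in>H. map_poly g (map_poly h f))" by (simp add: N_def)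
    also have "\<dots> = N"
      unfolding N_def
    proof (rule prod_mono_reindex[OF bij_betw_compose[OF g]])
      fix h assume h: "h \<in> H"
      show "map_poly (compose L g h) f = map_poly g (map_poly h f)"
      proof (rule poly_eqI)
        fix i
        have "coeff (map_poly (compose L g h) f) i = compose L g h (coeff f i)"
          by (rule coeff_map_poly) (rule h0[OF H_compose[OF g h]])
        moreover have "coeff f i \<in> L" using f by blast
        ultimately show "coeff (map_poly (compose L g h) f) i = coeff (map_poly g (map_poly h f)) i"
          by (simp add: coeff_map_poly h0 h g compose_def)
      qed
    qed
    finally show ?thesis .
  qed
  then have "g (coeff N i) = coeff N i" if "g \<in> H" for g i
    using that coeff_map_poly[of g N i] h0 by simp
  then show ?thesis using N H_fixed unfolding N_def by blast
qed

lemma content_map_poly: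
  assumes h: "h \<in> H" and f: "range (coeff f) \<subseteq> L"
  shows "LL.content (map_poly h f) = h ` LL.content f"
proof -
  interpret h: number_field_automorphism L h by (rule h_auto[OF h])
  have "range (coeff (map_poly h f)) = h ` range (coeff f)" by (auto simp: coeff_map_poly h.h_0)
  moreover have "zspan (range (coeff f)) \<subseteq> L"
    by (intro zspan_minimal additive_subgroup_closed_subfield LL.F f)
  ultimately show ?thesis
    unfolding LL.content_def
    by (simp add: h.h_image_ideal_product LL.R_subset_F h.h_image_zspan f h.h_ring_of_integers)
qed

lemma LL_content_1: "LL.content 1 = LL.R"
proof
  show "LL.content 1 \<subseteq> LL.R"
    by (rule LL.content_subset[OF _ LL.fractional_ideal_R]) (simp add: coeff_1 LL.one_in_R LL.zero_in_R)
  have "x * 1 \<in> LL.content 1" if "x \<in> LL.R" for x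
  proof -
    have "fractional_ideal L (LL.content 1)"
      using closed_subfield_0[OF LL.F] closed_subfield_1[OF LL.F] by (intro LL.fractional_ideal_content) (auto simp: coeff_1)
    then have "x * coeff 1 0 \<in> LL.content 1"
      by (rule LL.fractional_ideal_mult[OF _ that LL.coeff_in_content])
    then show ?thesis by simp
  qed
  then show "LL.R \<subseteq> LL.content 1" by auto
qed

text \<open>The coefficients of the norm of a polynomial with content \<open>I\<close> generate the norm of \<open>I\<close>.\<close>

lemma invariant_ideal_class_power:
  assumes I: "fractional_ideal L I" and inv: "\<And>h. h \<in> H \<Longrightarrow> LL.ideal_class (h ` I) = LL.ideal_class I"
  obtains J where "fractional_ideal F J"
    "LL.ideal_class I [^]\<^bsub>ideal_class_group L\<^esub> card H = LL.ideal_class (extend J)"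
proof -
  obtain f where f: "range (coeff f) \<subseteq> L" "f \<noteq> 0" "I = LL.content f"
    using LL.fractional_ideal_eq_content[OF I] by blast
  have hf: "range (coeff (map_poly h f)) \<subseteq> L \<and> map_poly h f \<noteq> 0" if h: "h \<in> H" for h
  proof -
    interpret h: number_field_automorphism L h by (rule h_auto[OF h])
    have "h (Polynomial.lead_coeff f) \<noteq> 0" using f by (subst h.h_eq_0_iff) auto
    then have "coeff (map_poly h f) (degree f) \<noteq> 0" by (simp add: coeff_map_poly h.h_0)
    then have "map_poly h f \<noteq> 0" by (metis coeff_0)
    moreover have "range (coeff (map_poly h f)) \<subseteq> L" using f(1) h.h_in by (auto simp: coeff_map_poly h.h_0)
    ultimately show ?thesis by simp
  qed
  \<comment> \<open>By Gauss's lemma the content of the partial product is the product of the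
    conjugate ideals, and by invariance each of them lies in the class of \<open>I\<close>.
    Nonvanishing is carried along because contents of zero polynomials are no fractional
    ideals.\<close>
  have *: "(\<Prod>h\<in>S. map_poly h f) \<noteq> 0 \<and>
      LL.ideal_class (LL.content (\<Prod>h\<in>S. map_poly h f)) = LL.ideal_class I [^]\<^bsub>ideal_class_group L\<^esub> card S"
    if "S \<subseteq> H" for S
    using finite_subset[OF that finite_H] that
  proof (induction S rule: finite_induct)
    case empty
    show ?case by (simp add: LL_content_1 LL.class_group_one)
  next
    case (insert h S)
    then have h: "h \<in> H" and S: "S \<subseteq> H" by auto
    define g where "g = (\<Prod>h\<in>S. map_poly h f)"
    have g: "g \<noteq> 0" "LL.ideal_class (LL.content g) = LL.ideal_class I [^]\<^bsub>ideal_class_group L\<^esub> card S"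
      using insert.IH[OF S] by (simp_all add: g_def)
    have gL: "range (coeff g) \<subseteq> L"
      unfolding g_def by (rule range_coeff_prod[OF insert.hyps(1)]) (use hf S in blast)
    note fg = LL.fractional_ideal_content[OF gL g(1)]
    have "LL.content (map_poly h f * g) = ideal_product (LL.content g) (h ` I)"
      using LL.content_mult[of "map_poly h f" g] hf[OF h] g(1) gL content_map_poly[OF h f(1)] f(3)
        ideal_product_commute[of "h ` I" "LL.content g"] by simp
    then have "LL.ideal_class (LL.content (map_poly h f * g)) =
        LL.ideal_class (LL.content g) \<otimes>\<^bsub>ideal_class_group L\<^esub> LL.ideal_class (h ` I)"
      using LL.class_group_mult[OF fg number_field_automorphism.fractional_ideal_h_image[OF h_auto[OF h] I]] by simp
    then show ?case using insert g hf[OF h] inv[OF h] by (simp add: g_def[symmetric])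
  qed
  define N where "N = (\<Prod>h\<in>H. map_poly h f)"
  have N: "range (coeff N) \<subseteq> F" "N \<noteq> 0"
    using norm_poly_coeff_in_F[OF f(1)] *[OF subset_refl] by (auto simp: N_def)
  show ?thesis
  proof (rule that)
    show "fractional_ideal F (FF.content N)" by (rule FF.fractional_ideal_content[OF N])
    show "LL.ideal_class I [^]\<^bsub>ideal_class_group L\<^esub> card H = LL.ideal_class (extend (FF.content N))"
      using *[OF subset_refl] by (simp add: extend_content N_def)
  qed
qed

text \<open>Extension on classes through an arbitrary representative;
  \<open>class_extend_class\<close> shows that the choice does not matter.\<close>

definition class_extend :: "'a set set \<Rightarrow> 'a set set" where
  "class_extend x = LL.ideal_class (extend (SOME I. fractional_ideal F I \<and> x = FF.ideal_class I))"

lemma class_extend_class: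
  assumes I: "fractional_ideal F I"
  shows "class_extend (FF.ideal_class I) = LL.ideal_class (extend I)"
proof -
  define J where "J = (SOME J. fractional_ideal F J \<and> FF.ideal_class I = FF.ideal_class J)"
  have J: "fractional_ideal F J" "FF.ideal_class I = FF.ideal_class J"
    using someI[of "\<lambda>J. fractional_ideal F J \<and> FF.ideal_class I = FF.ideal_class J" I] I
    by (auto simp: J_def)
  then obtain a where "a \<in> F - {0}" "I = scale a J" using FF.ideal_class_eq_iff[OF I J(1)] by auto
  then have "LL.ideal_class (extend I) = LL.ideal_class (extend J)"
    unfolding LL.ideal_class_eq_iff[OF fractional_ideal_extend[OF I] fractional_ideal_extend[OF J(1)]]
    using FL extend_scale[OF J(1), of a] by auto
  then show ?thesis by (simp add: class_extend_def J_def)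
qed

lemma class_extend_hom: "class_extend \<in> hom (ideal_class_group F) (ideal_class_group L)"
proof (rule homI)
  fix x assume "x \<in> carrier (ideal_class_group F)"
  then obtain I where I: "fractional_ideal F I" "x = FF.ideal_class I" by (auto simp: FF.carrier_class_group)
  then show "class_extend x \<in> carrier (ideal_class_group L)"
    by (auto simp: class_extend_class fractional_ideal_extend LL.carrier_class_group)
  fix y assume "y \<in> carrier (ideal_class_group F)"
  then obtain J where J: "fractional_ideal F J" "y = FF.ideal_class J" by (auto simp: FF.carrier_class_group)
  show "class_extend (x \<otimes>\<^bsub>ideal_class_group F\<^esub> y) = class_extend x \<otimes>\<^bsub>ideal_class_group L\<^esub> class_extend y"
    using I J by (simp add: FF.class_group_mult class_extend_class FF.fractional_ideal_product extend_mult
        LL.class_group_mult fractional_ideal_extend)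
qed

end

section \<open>Parts of order prime to p\<close>

lemma (in group) pow_cong_eq:
  assumes "x \<in> carrier G" "x [^] n = \<one>" "[a = b] (mod n)"
  shows "x [^] (a::nat) = x [^] (b::nat)"
proof -
  have "x [^] c = x [^] (c mod n)" for c :: nat
  proof -
    have "x [^] c = x [^] (n * (c div n) + c mod n)" by simp
    also have "\<dots> = (x [^] n) [^] (c div n) \<otimes> x [^] (c mod n)"
      using assms(1) by (simp only: nat_pow_mult[symmetric] nat_pow_pow)
    finally show ?thesis using assms(1,2) by simp
  qed
  then show ?thesis using assms(3) unfolding cong_def by metis
qed

text \<open>Any annihilating exponent prime to \<open>p\<close> can replace the exact order, since
  the order divides it. Such an exponent, unlike the order, is inherited by homomorphic
  images.\<close>

lemma (in group) non_p_part_iff: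
  assumes "finite (carrier G)"
  shows "x \<in> non_p_part p G \<longleftrightarrow> x \<in> carrier G \<and> (\<exists>n>0. coprime n p \<and> x [^] (n::nat) = \<one>)"
proof -
  have "coprime (ord x) p" if "x \<in> carrier G" "coprime n p" "x [^] n = \<one>" for n :: nat
    using that pow_eq_id[OF that(1)] by (meson coprime_divisors dvd_refl)
  moreover have "ord x > 0" if "x \<in> carrier G" using ord_ge_1[OF assms that] by simp
  moreover have "x [^] ord x = \<one>" if "x \<in> carrier G" using pow_ord_eq_1[OF that] .
  ultimately show ?thesis unfolding non_p_part_def by blast
qed

text \<open>Raising to the power \<open>p ^ e\<close> is invertible on elements of order prime to
  \<open>p\<close>. Injectivity and surjectivity that hold only up to this power therefore become
  exact on the parts of order prime to \<open>p\<close>. In the application \<open>S\<close>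
  consists of the Galois-invariant classes.\<close>

lemma bij_betw_non_p_part:
  fixes A (structure) and B (structure)
  assumes A: "comm_group A" "finite (carrier A)" and B: "comm_group B" "finite (carrier B)"
    and p: "prime p" and j: "j \<in> hom A B"
    and inj: "\<And>x y. x \<in> carrier A \<Longrightarrow> y \<in> carrier A \<Longrightarrow> j x = j y \<Longrightarrow> x [^]\<^bsub>A\<^esub> (p ^ e) = y [^]\<^bsub>A\<^esub> (p ^ e)"
    and S: "\<And>x. x \<in> carrier A \<Longrightarrow> j x \<in> S"
    and surj: "\<And>y. y \<in> carrier B \<Longrightarrow> y \<in> S \<Longrightarrow> \<exists>z\<in>carrier A. y [^]\<^bsub>B\<^esub> (p ^ e) = j z"
  shows "bij_betw j (non_p_part p A) (non_p_part p B \<inter> S)"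
proof -
  interpret A: comm_group A by fact
  interpret B: comm_group B by fact
  interpret j: group_hom A B j by (simp add: group_hom_def group_hom_axioms_def j A.is_group B.is_group)
  note nA = A.non_p_part_iff[OF A(2)] and nB = B.non_p_part_iff[OF B(2)]
  have "inj_on j (non_p_part p A)"
  proof (rule inj_onI)
    fix x y assume x: "x \<in> non_p_part p A" and y: "y \<in> non_p_part p A" and eq: "j x = j y"
    obtain m where m: "coprime m p" "x [^]\<^bsub>A\<^esub> (m::nat) = \<one>\<^bsub>A\<^esub>" using x nA by auto
    obtain n where n: "coprime n p" "y [^]\<^bsub>A\<^esub> (n::nat) = \<one>\<^bsub>A\<^esub>" using y nA by auto
    have xy: "x \<in> carrier A" "y \<in> carrier A" using x y nA by auto
    have "coprime (p ^ e) (m * n)" using m(1) n(1) by (simp add: coprime_commute)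
    \<comment> \<open>An inverse of \<open>p ^ e\<close> modulo the common exponent
      \<open>m * n\<close> of \<open>x\<close> and \<open>y\<close>: it recovers both from their
      equal powers.\<close>
    then obtain u where u: "[p ^ e * u = 1] (mod m * n)"
      using cong_solve_coprime_nat unfolding One_nat_def by blast
    have 1: "z = (z [^]\<^bsub>A\<^esub> (p ^ e)) [^]\<^bsub>A\<^esub> u" if z: "z \<in> carrier A" "z [^]\<^bsub>A\<^esub> (m * n) = \<one>\<^bsub>A\<^esub>" for z
      using A.pow_cong_eq[OF z u] z by (simp add: A.nat_pow_pow)
    have "x [^]\<^bsub>A\<^esub> (m * n) = \<one>\<^bsub>A\<^esub>" using A.nat_pow_pow[OF xy(1), of m n] m by simp
    moreover have "y [^]\<^bsub>A\<^esub> (m * n) = \<one>\<^bsub>A\<^esub>"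
      using A.nat_pow_pow[OF xy(2), of n m] n by (simp add: mult.commute)
    ultimately show "x = y" using 1[OF xy(1)] 1[OF xy(2)] inj[OF xy eq] by simp
  qed
  moreover have "j ` non_p_part p A = non_p_part p B \<inter> S"
  proof
    show "j ` non_p_part p A \<subseteq> non_p_part p B \<inter> S"
    proof clarify
      fix x assume "x \<in> non_p_part p A"
      then obtain n :: nat where n: "x \<in> carrier A" "n > 0" "coprime n p" "x [^]\<^bsub>A\<^esub> n = \<one>\<^bsub>A\<^esub>"
        using nA by auto
      then have "j x [^]\<^bsub>B\<^esub> n = \<one>\<^bsub>B\<^esub>" using j.hom_nat_pow[OF n(1), of n] by simp
      then show "j x \<in> non_p_part p B \<inter> S" using n nB S by auto
    qed
    show "non_p_part p B \<inter> S \<subseteq> j ` non_p_part p A"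
    proof clarify
      fix y assume y: "y \<in> non_p_part p B" "y \<in> S"
      then obtain n :: nat where n: "y \<in> carrier B" "n > 0" "coprime n p" "y [^]\<^bsub>B\<^esub> n = \<one>\<^bsub>B\<^esub>"
        using nB by auto
      obtain z where z: "z \<in> carrier A" "y [^]\<^bsub>B\<^esub> (p ^ e) = j z" using surj[OF n(1) y(2)] by blast
      have "Coset.order A \<noteq> 0" using A(2) A.order_gt_0_iff_finite by simp
      then obtain m where m: "Coset.order A = p ^ multiplicity p (Coset.order A) * m" "\<not> p dvd m"
        using p by (metis multiplicity_decompose' not_prime_unit)
      define a where "a = multiplicity p (Coset.order A)"
      have "coprime (p ^ e * p ^ a) n" using n(3) by (simp add: coprime_commute)
      then obtain u where u: "[p ^ e * p ^ a * u = 1] (mod n)"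
        using cong_solve_coprime_nat unfolding One_nat_def by blast
      \<comment> \<open>The element \<open>z\<close> may have a component of \<open>p\<close>-power
        order. The exponent \<open>p ^ a\<close>, the \<open>p\<close>-part of the group order,
        removes it, and \<open>u\<close> undoes \<open>p ^ e * p ^ a\<close> on
        \<open>y\<close>.\<close>
      define x where "x = z [^]\<^bsub>A\<^esub> (p ^ a * u)"
      have "x [^]\<^bsub>A\<^esub> m = z [^]\<^bsub>A\<^esub> (Coset.order A * u)"
        using z(1) by (subst m(1)) (simp add: x_def A.nat_pow_pow a_def mult_ac)
      also have "\<dots> = \<one>\<^bsub>A\<^esub>"
        using z(1) A.pow_order_eq_1[OF z(1)] A.nat_pow_pow[OF z(1), of "Coset.order A" u] by simp
      finally have "x [^]\<^bsub>A\<^esub> m = \<one>\<^bsub>A\<^esub>" .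
      moreover have "m > 0" using m(2) by (cases m) simp_all
      moreover have "coprime m p" using prime_imp_coprime[OF p m(2)] by (simp add: coprime_commute)
      ultimately have "x \<in> non_p_part p A" using nA z(1) by (auto simp: x_def)
      moreover have "j x = y"
      proof -
        have "j x = (y [^]\<^bsub>B\<^esub> (p ^ e)) [^]\<^bsub>B\<^esub> (p ^ a * u)"
          unfolding x_def z(2) by (rule j.hom_nat_pow[OF z(1)])
        also have "\<dots> = y [^]\<^bsub>B\<^esub> (p ^ e * p ^ a * u)" using n(1) by (simp add: B.nat_pow_pow mult.assoc)
        also have "\<dots> = y" using B.pow_cong_eq[OF n(1,4) u] n(1) by simp
        finally show ?thesis .
      qed
      ultimately show "y \<in> j ` non_p_part p A" by blast
    qed
  qed
  ultimately show ?thesis by (simp add: bij_betw_def)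
qed

context galois_pair
begin

lemma bij_betw_class_extend:
  assumes p: "prime p" and card: "card H = p ^ e"
  shows "bij_betw class_extend (non_p_part p (ideal_class_group F))
    (non_p_part p (ideal_class_group L) \<inter> {y. \<forall>h\<in>H. (`) h ` y = y})"
proof (rule bij_betw_non_p_part[OF FF.comm_group_class_group FF.finite_class_group
      LL.comm_group_class_group LL.finite_class_group p class_extend_hom])
  fix x y assume "x \<in> carrier (ideal_class_group F)" "y \<in> carrier (ideal_class_group F)" and eq: "class_extend x = class_extend y"
  then obtain I J where "fractional_ideal F I" "x = FF.ideal_class I" "fractional_ideal F J" "y = FF.ideal_class J"
    by (auto simp: FF.carrier_class_group)
  then show "x [^]\<^bsub>ideal_class_group F\<^esub> p ^ e = y [^]\<^bsub>ideal_class_group F\<^esub> p ^ e"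
    using ideal_class_power_eq_if_extend_eq[of I J] eq by (simp add: class_extend_class card)
next
  fix x assume "x \<in> carrier (ideal_class_group F)"
  then obtain I where I: "fractional_ideal F I" "x = FF.ideal_class I" by (auto simp: FF.carrier_class_group)
  have "(`) h ` class_extend x = class_extend x" if "h \<in> H" for h
    using number_field_automorphism.image_ideal_class[OF h_auto[OF that] fractional_ideal_extend[OF I(1)]]
      H_image_extend[OF that I(1)] by (simp add: I class_extend_class)
  then show "class_extend x \<in> {y. \<forall>h\<in>H. (`) h ` y = y}" by blast
next
  fix y assume "y \<in> carrier (ideal_class_group L)" and inv: "y \<in> {y. \<forall>h\<in>H. (`) h ` y = y}"
  then obtain I where I: "fractional_ideal L I" "y = LL.ideal_class I" by (auto simp: LL.carrier_class_group)
  have "LL.ideal_class (h ` I) = LL.ideal_class I" if "h \<in> H" for h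
    using number_field_automorphism.image_ideal_class[OF h_auto[OF that] I(1)] inv that I(2) by auto
  then obtain J where "fractional_ideal F J" "LL.ideal_class I [^]\<^bsub>ideal_class_group L\<^esub> card H = LL.ideal_class (extend J)"
    by (rule invariant_ideal_class_power[OF I(1)])
  then show "\<exists>z\<in>carrier (ideal_class_group F). y [^]\<^bsub>ideal_class_group L\<^esub> p ^ e = class_extend z"
    using FF.ideal_class_carrier by (intro bexI[of _ "FF.ideal_class J"]) (auto simp: I card class_extend_class)
qed

end

section \<open>Finitely generated groups\<close>

text \<open>
  Point stabilizers of actions on at most \<open>r\<close> points, given by the orbit map \<open>c\<close> with the points
  numbered below \<open>r\<close>.
\<close>

definition small_stabilizer :: "('g, 'b) monoid_scheme \<Rightarrow> nat \<Rightarrow> ('g \<Rightarrow> nat) \<Rightarrow> 'g set \<Rightarrow> bool" where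
  "small_stabilizer G r c S \<longleftrightarrow> (\<forall>x\<in>carrier G. c x < r) \<and>
     (\<forall>s\<in>carrier G. \<forall>x\<in>carrier G. \<forall>y\<in>carrier G. c x = c y \<longrightarrow> c (s \<otimes>\<^bsub>G\<^esub> x) = c (s \<otimes>\<^bsub>G\<^esub> y)) \<and>
     S = {x \<in> carrier G. c x = c \<one>\<^bsub>G\<^esub>}"

lemma small_stabilizer_iff:
  "small_stabilizer G r c S \<Longrightarrow> x \<in> S \<longleftrightarrow> x \<in> carrier G \<and> c x = c \<one>\<^bsub>G\<^esub>"
  unfolding small_stabilizer_def by blast

lemma (in group) small_stabilizer_mult:
  assumes c: "small_stabilizer G r c S" and x: "x \<in> S" and y: "y \<in> S"
  shows "x \<otimes> y \<in> S"
proof -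
  have xy: "x \<in> carrier G" "y \<in> carrier G" "c x = c \<one>" "c y = c \<one>"
    using x y small_stabilizer_iff[OF c] by auto
  have "c (x \<otimes> y) = c (x \<otimes> \<one>)" using c xy one_closed unfolding small_stabilizer_def by blast
  then show ?thesis using xy small_stabilizer_iff[OF c] by simp
qed

lemma (in group) small_stabilizer_inv:
  assumes c: "small_stabilizer G r c S" and x: "x \<in> S"
  shows "inv x \<in> S"
proof -
  have x': "x \<in> carrier G" "c x = c \<one>" using x small_stabilizer_iff[OF c] by auto
  have "c (inv x \<otimes> x) = c (inv x \<otimes> \<one>)"
    using c x' one_closed inv_closed unfolding small_stabilizer_def by blast
  then show ?thesis using x' small_stabilizer_iff[OF c] by simp
qed

text \<open>The relation \<open>c x = c' y\<close> is preserved by left multiplication with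
  generators and their inverses, hence with every word in them; it is then applied to the pair of
  identities.\<close>

lemma (in group) small_stabilizer_generate:
  assumes c: "small_stabilizer G r c S" and c': "small_stabilizer G r c' S'" and Y: "Y \<subseteq> carrier G"
    and one: "c \<one> = c' \<one>"
    and step: "\<And>s x y. s \<in> Y \<Longrightarrow> x \<in> carrier G \<Longrightarrow> y \<in> carrier G \<Longrightarrow> c x = c' y \<Longrightarrow>
      c (s \<otimes> x) = c' (s \<otimes> y) \<and> c (inv s \<otimes> x) = c' (inv s \<otimes> y)"
    and d: "d \<in> generate G Y"
  shows "c d = c' d"
proof -
  have "\<forall>x\<in>carrier G. \<forall>y\<in>carrier G. c x = c' y \<longrightarrow> c (d \<otimes> x) = c' (d \<otimes> y)"
    using d
  proof (induction rule: generate.induct)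
    case one
    then show ?case by simp
  next
    case (incl h)
    then show ?case using step by blast
  next
    case (inv h)
    then show ?case using step by blast
  next
    case (eng h1 h2)
    have "h1 \<in> carrier G" "h2 \<in> carrier G" using eng(1,2) generate_in_carrier[OF Y] by auto
    then show ?case using eng(3,4) by (simp add: m_assoc)
  qed
  moreover have "d \<in> carrier G" using d generate_in_carrier[OF Y] by auto
  ultimately show ?thesis using one by (metis one_closed r_one)
qed

text \<open>An orbit map is encoded by finite data: its base point and the effect of the generators
  and their inverses on the numbers below \<open>r\<close>. Equal data force agreement on the
  subgroup generated by \<open>Y\<close>. To compare the stabilizers on an arbitrary
  \<open>x\<close>, density supplies a \<open>u\<close> in both of them with
  \<open>x \<otimes> u\<close> in that subgroup.\<close>

lemma (in group) finite_small_stabilizers: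
  assumes Y: "finite Y" "Y \<subseteq> carrier G"
    and \<U>: "\<And>U. U \<in> \<U> \<Longrightarrow> U \<subseteq> carrier G"
    and dense: "\<And>x U V. x \<in> carrier G \<Longrightarrow> U \<in> \<U> \<Longrightarrow> V \<in> \<U> \<Longrightarrow> \<exists>u\<in>U \<inter> V. x \<otimes> u \<in> generate G Y"
  shows "finite {S. \<exists>c. small_stabilizer G r c S \<and> (\<exists>U\<in>\<U>. U \<subseteq> S)}"
proof -
  let ?\<S> = "{S. \<exists>c. small_stabilizer G r c S \<and> (\<exists>U\<in>\<U>. U \<subseteq> S)}"
  define Z where "Z = Y \<union> (\<lambda>s. inv s) ` Y"
  have Z: "finite Z" "Z \<subseteq> carrier G" using Y by (auto simp: Z_def)
  have "\<forall>S\<in>?\<S>. \<exists>c. small_stabilizer G r c S" by blast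
  from bchoice[OF this] obtain C where C: "\<And>S. S \<in> ?\<S> \<Longrightarrow> small_stabilizer G r (C S) S" by blast
  \<comment> \<open>Numbers outside the range of the orbit map are sent to 0, which is below
    \<open>r\<close> because the base point is. The data thus lie in a finite set of extensional
    functions.\<close>
  define data where "data S = (C S \<one>, \<lambda>s\<in>Z. \<lambda>i\<in>{..<r}.
      if \<exists>x\<in>carrier G. C S x = i then C S (s \<otimes> (SOME x. x \<in> carrier G \<and> C S x = i)) else 0)" for S
  have data: "fst (data S) = C S \<one>" "s \<in> Z \<Longrightarrow> x \<in> carrier G \<Longrightarrow> snd (data S) s (C S x) = C S (s \<otimes> x)"
    if S: "S \<in> ?\<S>" for S s x
  proof -
    show "fst (data S) = C S \<one>" by (simp add: data_def)
    assume s: "s \<in> Z" and x: "x \<in> carrier G"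
    define y where "y = (SOME y. y \<in> carrier G \<and> C S y = C S x)"
    have y: "y \<in> carrier G \<and> C S y = C S x" unfolding y_def by (rule someI[of _ x]) (use x in simp)
    have "C S x < r" using C[OF S] x by (auto simp: small_stabilizer_def)
    then have "snd (data S) s (C S x) = C S (s \<otimes> y)" using s x by (auto simp: data_def y_def)
    also have "\<dots> = C S (s \<otimes> x)" using C[OF S] s Z(2) x y unfolding small_stabilizer_def by blast
    finally show "snd (data S) s (C S x) = C S (s \<otimes> x)" .
  qed
  have "data ` ?\<S> \<subseteq> {..<r} \<times> (Z \<rightarrow>\<^sub>E ({..<r} \<rightarrow>\<^sub>E {..<r}))"
  proof
    fix z assume "z \<in> data ` ?\<S>"
    then obtain S where S: "S \<in> ?\<S>" "z = data S" by blast
    have lt: "C S x < r" if "x \<in> carrier G" for x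
      using C[OF S(1)] that by (auto simp: small_stabilizer_def)
    have "C S (s \<otimes> (SOME x. x \<in> carrier G \<and> C S x = i)) < r" if "s \<in> Z" "\<exists>x\<in>carrier G. C S x = i" for s i
      using that Z(2) someI_ex[of "\<lambda>x. x \<in> carrier G \<and> C S x = i"] by (intro lt m_closed) auto
    then show "z \<in> {..<r} \<times> (Z \<rightarrow>\<^sub>E ({..<r} \<rightarrow>\<^sub>E {..<r}))"
      using lt[OF one_closed] by (auto simp: S(2) data_def)
  qed
  moreover have "finite ({..<r} \<times> (Z \<rightarrow>\<^sub>E ({..<r} \<rightarrow>\<^sub>E {..<r})))"
    using Z(1) by (intro finite_cartesian_product finite_PiE) auto
  ultimately have "finite (data ` ?\<S>)" by (rule finite_subset)
  moreover have "inj_on data ?\<S>"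
  proof -
    have sub: "S \<subseteq> S'" if S: "S \<in> ?\<S>" and S': "S' \<in> ?\<S>" and eq: "data S = data S'" for S S'
    proof
      fix x assume x: "x \<in> S"
      have xG: "x \<in> carrier G" using x C[OF S] by (auto simp: small_stabilizer_def)
      obtain U V where UV: "U \<in> \<U>" "U \<subseteq> S" "V \<in> \<U>" "V \<subseteq> S'" using S S' by blast
      obtain u where u: "u \<in> U" "u \<in> V" "x \<otimes> u \<in> generate G Y" using dense[OF xG UV(1,3)] by blast
      have uG: "u \<in> carrier G" using u(1) \<U>[OF UV(1)] by auto
      have step: "C S (s \<otimes> x) = C S' (s \<otimes> y)"
        if "s \<in> Z" "x \<in> carrier G" "y \<in> carrier G" "C S x = C S' y" for s x y
        using data(2)[OF S that(1,2)] data(2)[OF S' that(1,3)] eq that(4) by simp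
      have "C S (x \<otimes> u) = C S' (x \<otimes> u)"
        by (rule small_stabilizer_generate[OF C[OF S] C[OF S'] Y(2) _ _ u(3)])
          (use data(1)[OF S] data(1)[OF S'] eq step in \<open>auto simp: Z_def\<close>)
      moreover have "C S \<one> = C S' \<one>" using data(1)[OF S] data(1)[OF S'] eq by simp
      moreover have "x \<otimes> u \<in> S" using small_stabilizer_mult[OF C[OF S] x] u(1) UV(2) by blast
      then have "C S (x \<otimes> u) = C S \<one>" using C[OF S] unfolding small_stabilizer_def by blast
      ultimately have "x \<otimes> u \<in> S'"
        unfolding small_stabilizer_iff[OF C[OF S']] using xG uG by simp
      moreover have "inv u \<in> S'" using small_stabilizer_inv[OF C[OF S']] u(2) UV(4) by blast
      ultimately have "(x \<otimes> u) \<otimes> inv u \<in> S'" by (rule small_stabilizer_mult[OF C[OF S']])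
      then show "x \<in> S'" using xG uG by (simp add: m_assoc)
    qed
    show ?thesis
    proof (rule inj_onI)
      fix S S' assume "S \<in> ?\<S>" "S' \<in> ?\<S>" "data S = data S'"
      then show "S = S'" using sub[of S S'] sub[of S' S] by auto
    qed
  qed
  ultimately show ?thesis by (rule finite_imageD)
qed

text \<open>The first isomorphism theorem, after cutting the codomain down to the image to make the
  map surjective.\<close>

lemma (in group_hom) card_FactGroup_kernel:
  "card (carrier (G Mod kernel G H h)) = card (h ` carrier G)"
proof -
  let ?H = "H\<lparr>carrier := h ` carrier G\<rparr>"
  have "subgroup (h ` carrier G) H" by (rule img_is_subgroup)
  then have grp: "group ?H" by (rule subgroup.subgroup_is_group[OF _ H.is_group])
  have "h \<in> hom G ?H" by (auto simp: hom_def)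
  then interpret h': group_hom G ?H h by (simp add: group_hom_def group_hom_axioms_def grp G.is_group)
  have "(\<lambda>Y. the_elem (h ` Y)) \<in> iso (G Mod (kernel G ?H h)) ?H"
    by (rule h'.FactGroup_iso_set) simp
  moreover have "kernel G ?H h = kernel G H h" by (simp add: kernel_def)
  ultimately have "bij_betw (\<lambda>Y. the_elem (h ` Y)) (carrier (G Mod kernel G H h)) (h ` carrier G)"
    by (simp add: iso_def)
  then show ?thesis by (rule bij_betw_same_card)
qed

section \<open>Normal extensions\<close>

text \<open>Induction on the number of roots of \<open>q\<close> in \<open>L\<close>. A root
  \<open>a\<close> splits off a linear factor, and \<open>y\<close> is either \<open>a\<close> or a
  root of the cofactor. When no root is left, \<open>q\<close> is a nonzero constant by splitting,
  and \<open>y\<close> cannot be a root.\<close>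

lemma splitted_root_in_subfield:
  assumes L: "subfield L ambient"
  shows "q \<in> carrier (poly_ring (ambient\<lparr>carrier := L\<rparr>)) \<Longrightarrow> q \<noteq> [] \<Longrightarrow>
    ring.splitted (ambient\<lparr>carrier := L\<rparr>) q \<Longrightarrow> ring.eval ambient q y = 0 \<Longrightarrow> y \<in> L"
proof -
  let ?R = "ambient\<lparr>carrier := L\<rparr>"
  interpret amb: Ring.field "ambient :: 'a ring" by (rule field_ambient)
  interpret LF: Ring.field ?R by (rule amb.subfield_iff(2)[OF L])
  note sr = subfieldE(1)[OF L]
  have minus: "\<ominus>\<^bsub>?R\<^esub> a = - a" if "a \<in> L" for a
  proof -
    have "\<ominus>\<^bsub>?R\<^esub> a \<oplus>\<^bsub>?R\<^esub> a = \<zero>\<^bsub>?R\<^esub>" using that by (intro LF.l_neg) simp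
    then show ?thesis by (simp add: eq_neg_iff_add_eq_0)
  qed
  have poly: "set q \<subseteq> L" if "q \<in> carrier (poly_ring ?R)" for q
    using that LF.polynomial_in_carrier[OF LF.carrier_is_subring, of q] by (simp add: univ_poly_carrier)
  show "q \<in> carrier (poly_ring ?R) \<Longrightarrow> q \<noteq> [] \<Longrightarrow> LF.splitted q \<Longrightarrow> amb.eval q y = 0 \<Longrightarrow> y \<in> L"
  proof (induction "size (LF.roots q)" arbitrary: q)
    case 0
    have "length q - 1 = 0" using 0(1,4) by (simp add: LF.splitted_def)
    moreover have "length q > 0" using 0(3) by simp
    ultimately have "length q = Suc 0" by linarith
    then obtain c where c: "q = [c]" unfolding length_Suc_conv by auto
    then have "c \<noteq> 0" using 0(2) by (auto simp: univ_poly_carrier[symmetric] polynomial_def)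
    then show ?case using 0(5) c by simp
  next
    case (Suc n)
    have "LF.roots q \<noteq> {#}" using Suc.hyps(2) by auto
    then obtain a where a: "a \<in> L" "[\<one>\<^bsub>?R\<^esub>, \<ominus>\<^bsub>?R\<^esub> a] \<in> carrier (poly_ring ?R)" "[\<one>\<^bsub>?R\<^esub>, \<ominus>\<^bsub>?R\<^esub> a] pdivides\<^bsub>?R\<^esub> q"
      by (rule LF.not_empty_rootsE[OF Suc.prems(1)]) (rule that, simp_all)
    then obtain g where g: "g \<in> carrier (poly_ring ?R)" "q = [\<one>\<^bsub>?R\<^esub>, \<ominus>\<^bsub>?R\<^esub> a] \<otimes>\<^bsub>poly_ring ?R\<^esub> g"
      unfolding pdivides_def factor_def by auto
    have qm: "q = LF.poly_mult [\<one>\<^bsub>?R\<^esub>, \<ominus>\<^bsub>?R\<^esub> a] g" using g(2) by (simp add: univ_poly_mult)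
    have gne: "g \<noteq> []"
    proof
      assume "g = []"
      then have "q = []" using qm LF.poly_mult_zero(2)[of "[\<one>\<^bsub>?R\<^esub>, \<ominus>\<^bsub>?R\<^esub> a]"] poly[OF a(2)] by simp
      then show False using Suc.prems(2) by simp
    qed
    have roots: "LF.roots q = add_mset a (LF.roots g)"
      unfolding g(2) by (rule LF.poly_mult_degree_one_monic_imp_same_roots) (use a(1) g(1) gne in auto)
    have "length q - 1 = 1 + (length g - 1)"
      using LF.poly_mult_degree_eq[OF LF.carrier_is_subring, of "[\<one>\<^bsub>?R\<^esub>, \<ominus>\<^bsub>?R\<^esub> a]" g] a(2) g(1) gne
      unfolding qm by (simp add: univ_poly_carrier)
    then have "LF.splitted g" using Suc.prems(3) roots by (simp add: LF.splitted_def)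
    moreover have "amb.eval q y = amb.eval [\<one>\<^bsub>?R\<^esub>, \<ominus>\<^bsub>?R\<^esub> a] y * amb.eval g y"
      unfolding qm amb.poly_mult_consistent[OF sr] by (subst amb.eval_poly_mult) simp_all
    moreover have "amb.eval [\<one>\<^bsub>?R\<^esub>, \<ominus>\<^bsub>?R\<^esub> a] y = y - a" using minus[OF a(1)] by simp
    ultimately have "y = a \<or> amb.eval g y = 0" using Suc.prems(4) by auto
    moreover have "n = size (LF.roots g)" using Suc.hyps(2) roots by simp
    ultimately show ?case using Suc.hyps(1)[OF _ g(1) gne \<open>LF.splitted g\<close>] a(1) by auto
  qed
qed

lemma nat_pow_ambient: "x [^]\<^bsub>ambient\<^esub> (n::nat) = x ^ n"
proof (induction n)
  case 0
  interpret Ring.ring "ambient :: 'a ring" by (rule ring_ambient)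
  show ?case by simp
next
  case (Suc n)
  interpret Ring.ring "ambient :: 'a ring" by (rule ring_ambient)
  show ?case using Suc by (simp add: mult.commute)
qed

lemma eval_ambient_Cons:
  "ring.eval ambient (a # q) x = a * x ^ length q + ring.eval ambient q x"
proof -
  interpret Ring.ring "ambient :: 'a ring" by (rule ring_ambient)
  show ?thesis by (simp add: nat_pow_ambient)
qed

lemma (in field_automorphism) eval_ambient:
  assumes "set q \<subseteq> L" "\<And>a. a \<in> set q \<Longrightarrow> h a = a" "x \<in> L"
  shows "ring.eval ambient q x \<in> L \<and> h (ring.eval ambient q x) = ring.eval ambient q (h x)"
  using assms(1,2)
proof (induction q)
  case Nil
  interpret Ring.ring "ambient :: 'a ring" by (rule ring_ambient)
  show ?case by (simp add: h_0 closed_subfield_0[OF L])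
next
  case (Cons a q)
  have ax: "a * x ^ length q \<in> L"
    using Cons.prems assms(3) by (intro closed_subfield_mult[OF L] closed_subfield_power[OF L]) auto
  have "h (a * x ^ length q) = a * h x ^ length q"
    using Cons.prems assms(3) by (simp add: h_mult h_power closed_subfield_power[OF L])
  then show ?case
    using Cons ax by (simp add: eval_ambient_Cons h_add closed_subfield_add[OF L])
qed

text \<open>The element \<open>h x\<close> is a root of the minimal polynomial of \<open>x\<close>
  over \<open>k\<close>, whose coefficients \<open>h\<close> fixes. By normality this polynomial has
  all its roots in \<open>M\<close>.\<close>

lemma (in field_automorphism) normal_extension_stable:
  assumes normal: "normal_extension k M" and kM: "M \<subseteq> L" and h_fix: "\<And>a. a \<in> k \<Longrightarrow> h a = a"
    and x: "x \<in> M"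
  shows "h x \<in> M"
proof -
  interpret amb: Ring.field "ambient :: 'a ring" by (rule field_ambient)
  have k: "subfield k ambient" "k \<subseteq> M" and M: "subfield M ambient" and alg: "(amb.algebraic over k) x"
    using normal x by (auto simp: normal_extension_def algebraic_extension_def field_extension_def)
  define q where "q = amb.Irr k x"
  have q: "q \<in> carrier (k[X]\<^bsub>ambient\<^esub>)" "pirreducible\<^bsub>ambient\<^esub> k q" "amb.eval q x = 0"
    using amb.IrrE[OF k(1) _ alg] by (simp_all add: q_def)
  have "ring.splitted (ambient\<lparr>carrier := M\<rparr>) q"
    using normal q x unfolding normal_extension_def by blast
  moreover have qk: "set q \<subseteq> k"
    using q(1) by (auto simp: univ_poly_carrier[symmetric] polynomial_def)
  then have "q \<in> carrier (poly_ring (ambient\<lparr>carrier := M\<rparr>))"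
    using q(1) k(2) by (auto simp: univ_poly_carrier[symmetric] polynomial_def)
  moreover have "q \<noteq> []"
    using q(2) amb.pirreducibleE(1)[OF subfieldE(1)[OF k(1)] q(1)] by blast
  moreover have "amb.eval q (h x) = 0"
  proof -
    have "h (amb.eval q x) = amb.eval q (h x)"
      using eval_ambient[of q x] qk k(2) kM x h_fix by blast
    then show ?thesis using q(3) h_0 by simp
  qed
  ultimately show ?thesis using splitted_root_in_subfield[OF M] by blast
qed

section \<open>The Galois group of a pro-p-extension\<close>

lemma carrier_galois_group:
  "carrier (galois_group F E) = {\<sigma> \<in> Bij E. \<sigma> \<in> Ring.ring_hom (ambient\<lparr>carrier := E\<rparr>) (ambient\<lparr>carrier := E\<rparr>) \<and>
    (\<forall>x\<in>F. \<sigma> x = x)}"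
  by (simp add: galois_group_def)

locale pro_p_setting =
  fixes p :: nat and k K :: "'a::field_char_0 set"
  assumes prime_p: "prime p" and number_field_k: "number_field k"
    and pro_p: "pro_p_extension p k K"
    and fin_gen: "topologically_finitely_generated (galois_group k K) (krull_topology k K)"
begin

abbreviation "G \<equiv> galois_group k K"
abbreviation "T \<equiv> krull_topology k K"
abbreviation "A \<equiv> carrier (galois_group k K)"

lemma group_G: "group G"
  using pro_p by (simp add: pro_p_extension_def pro_p_group_def profinite_group_def topological_group_def)

sublocale G: group G by (rule group_G)

lemma galois: "galois_extension k K"
  using pro_p by (simp add: pro_p_extension_def)

lemma subfield_k: "subfield k ambient" and K: "closed_subfield K"
proof -
  have *: "subfield k ambient" "subfield K ambient"
    using galois unfolding galois_extension_def algebraic_extension_def field_extension_def by blast+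
  show "subfield k ambient" "closed_subfield K"
    using * closed_subfield_if_subfield[OF *(2)] by simp_all
qed

lemma A_iff: "\<sigma> \<in> A \<longleftrightarrow> \<sigma> \<in> extensional K \<and> bij_betw \<sigma> K K \<and> \<sigma> 1 = 1 \<and>
    (\<forall>x\<in>K. \<forall>y\<in>K. \<sigma> (x + y) = \<sigma> x + \<sigma> y \<and> \<sigma> (x * y) = \<sigma> x * \<sigma> y) \<and> (\<forall>x\<in>k. \<sigma> x = x)"
  unfolding carrier_galois_group by (auto simp: Bij_def Ring.ring_hom_def bij_betw_def)

lemma A_field_aut: "\<sigma> \<in> A \<Longrightarrow> field_aut K \<sigma>"
  unfolding A_iff field_aut_def bij_betw_def by blast

lemma A_automorphism: "\<sigma> \<in> A \<Longrightarrow> field_automorphism K \<sigma>"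
  by (simp add: field_automorphism_def K A_field_aut)

lemma A_fix: "\<sigma> \<in> A \<Longrightarrow> x \<in> k \<Longrightarrow> \<sigma> x = x"
  unfolding A_iff by blast

lemma A_Bij: "\<sigma> \<in> A \<Longrightarrow> \<sigma> \<in> Bij K"
  unfolding A_iff Bij_def by blast

lemma G_mult:
  assumes "\<sigma> \<in> A" "\<tau> \<in> A"
  shows "\<sigma> \<otimes>\<^bsub>G\<^esub> \<tau> = compose K \<sigma> \<tau>"
proof -
  have "\<sigma> \<in> Bij K" "\<tau> \<in> Bij K" using assms A_Bij by blast+
  then show ?thesis unfolding galois_group_def BijGroup_def by simp
qed

lemma G_mult_apply: "\<sigma> \<in> A \<Longrightarrow> \<tau> \<in> A \<Longrightarrow> x \<in> K \<Longrightarrow> (\<sigma> \<otimes>\<^bsub>G\<^esub> \<tau>) x = \<sigma> (\<tau> x)"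
  by (simp add: G_mult compose_def)

lemma G_one_apply: "x \<in> K \<Longrightarrow> \<one>\<^bsub>G\<^esub> x = x"
  by (simp add: galois_group_def BijGroup_def)

lemma G_inv_apply:
  assumes "\<sigma> \<in> A" "x \<in> K"
  shows "(inv\<^bsub>G\<^esub> \<sigma>) (\<sigma> x) = x" "\<sigma> ((inv\<^bsub>G\<^esub> \<sigma>) x) = x"
proof -
  show "(inv\<^bsub>G\<^esub> \<sigma>) (\<sigma> x) = x"
    using G_mult_apply[OF G.inv_closed[OF assms(1)] assms]
    unfolding G.l_inv[OF assms(1)] G_one_apply[OF assms(2)] by (rule sym)
  show "\<sigma> ((inv\<^bsub>G\<^esub> \<sigma>) x) = x"
    using G_mult_apply[OF assms(1) G.inv_closed[OF assms(1)] assms(2)]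
    unfolding G.r_inv[OF assms(1)] G_one_apply[OF assms(2)] by (rule sym)
qed

lemma fixed_by_A:
  assumes "x \<in> K" "\<And>\<sigma>. \<sigma> \<in> A \<Longrightarrow> \<sigma> x = x"
  shows "x \<in> k"
proof -
  have "{x \<in> K. \<forall>\<sigma>\<in>A. \<sigma> x = x} = k"
    using galois unfolding galois_extension_def by (rule conjunct2)
  moreover have "x \<in> {x \<in> K. \<forall>\<sigma>\<in>A. \<sigma> x = x}" using assms by simp
  ultimately show ?thesis by (rule subst)
qed

section \<open>Fixers of finite subextensions and the Krull topology\<close>

definition fixer :: "'a set \<Rightarrow> ('a \<Rightarrow> 'a) set" where
  "fixer M = {\<sigma> \<in> A. \<forall>x\<in>M. \<sigma> x = x}"

lemma fixer_eq: "k \<subseteq> M \<Longrightarrow> carrier (galois_group M K) = fixer M"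
  unfolding fixer_def carrier_galois_group by blast

lemma fixer_antimono: "M \<subseteq> N \<Longrightarrow> fixer N \<subseteq> fixer M"
  by (auto simp: fixer_def)

definition finite_subextension :: "'a set \<Rightarrow> bool" where
  "finite_subextension M \<longleftrightarrow> finite_field_extension k M \<and> field_extension M K"

lemma
  assumes "finite_subextension M"
  shows finite_subextension_kM: "k \<subseteq> M" and finite_subextension_MK: "M \<subseteq> K"
    and finite_subextension_number_field: "number_field M"
proof -
  show kM: "k \<subseteq> M" and "M \<subseteq> K"
    using assms unfolding finite_subextension_def finite_field_extension_def field_extension_def by blast+
  have Q: "subfield (\<rat> :: 'a set) ambient" "ring.finite_dimension ambient \<rat> k" "\<rat> \<subseteq> k"
    using number_field_k unfolding number_field_def finite_field_extension_def field_extension_def by blast+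
  have M: "subfield M ambient" "ring.finite_dimension ambient k M"
    using assms unfolding finite_subextension_def finite_field_extension_def field_extension_def by blast+
  have "ring.finite_dimension ambient \<rat> M"
    by (rule ring.telescopic_base_dim(1)[OF ring_ambient Q(1) subfield_k Q(2) M(2)])
  then show "number_field M"
    using Q M kM unfolding number_field_def finite_field_extension_def field_extension_def by blast
qed

lemma open_coset_fixer:
  assumes "finite_subextension M" "\<sigma> \<in> A"
  shows "openin T (\<sigma> <#\<^bsub>G\<^esub> fixer M)"
  unfolding krull_topology_def
proof (rule topology_generated_by_Basis)
  have "\<sigma> <#\<^bsub>G\<^esub> fixer M = \<sigma> <#\<^bsub>G\<^esub> carrier (galois_group M K)"
    by (simp only: fixer_eq[OF finite_subextension_kM[OF assms(1)]])
  moreover have "finite_field_extension k M" "field_extension M K"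
    using assms(1) by (simp_all add: finite_subextension_def)
  ultimately show "\<sigma> <#\<^bsub>G\<^esub> fixer M \<in> {\<sigma> <#\<^bsub>G\<^esub> carrier (galois_group M K) |\<sigma> M.
      \<sigma> \<in> A \<and> finite_field_extension k M \<and> field_extension M K}"
    using assms(2) by (intro CollectI exI[of _ \<sigma>] exI[of _ M] conjI)
qed

text \<open>Cosets of fixers are basic open sets. Two of them through \<sigma> intersect in an open
  neighbourhood of \<sigma>, which meets the dense subgroup generated by \<open>Y\<close>; by
  cancellation the two descriptions of the common point give one element of both fixers.\<close>

lemma finite_stabilizers:
  "finite {S. \<exists>c. small_stabilizer G r c S \<and> (\<exists>U\<in>fixer ` {M. finite_subextension M}. U \<subseteq> S)}"
proof -
  obtain Y where Y: "finite Y" "Y \<subseteq> A" "T closure_of (generate G Y) = A"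
    using fin_gen by (auto simp: topologically_finitely_generated_def)
  show ?thesis
  proof (rule G.finite_small_stabilizers[OF Y(1,2)])
    show "U \<subseteq> A" if "U \<in> fixer ` {M. finite_subextension M}" for U
      using that by (auto simp: fixer_def)
    fix \<sigma> U V assume \<sigma>: "\<sigma> \<in> A" and "U \<in> fixer ` {M. finite_subextension M}" "V \<in> fixer ` {M. finite_subextension M}"
    then obtain M N where MN: "finite_subextension M" "U = fixer M" "finite_subextension N" "V = fixer N" by blast
    have one: "\<one>\<^bsub>G\<^esub> \<in> fixer M'" if "M' \<subseteq> K" for M' using that G_one_apply by (auto simp: fixer_def)
    have "openin T ((\<sigma> <#\<^bsub>G\<^esub> U) \<inter> (\<sigma> <#\<^bsub>G\<^esub> V))"
      unfolding MN(2,4) by (intro openin_Int open_coset_fixer MN \<sigma>)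
    moreover have "\<sigma> \<in> (\<sigma> <#\<^bsub>G\<^esub> U) \<inter> (\<sigma> <#\<^bsub>G\<^esub> V)"
      unfolding MN(2,4) l_coset_def using \<sigma> one[OF finite_subextension_MK[OF MN(1)]] one[OF finite_subextension_MK[OF MN(3)]]
        G.r_one[OF \<sigma>] by force
    moreover have "\<sigma> \<in> T closure_of (generate G Y)" using Y(3) \<sigma> by simp
    ultimately obtain d where d: "d \<in> generate G Y" "d \<in> \<sigma> <#\<^bsub>G\<^esub> U" "d \<in> \<sigma> <#\<^bsub>G\<^esub> V"
      unfolding in_closure_of by blast
    then obtain u v where uv: "u \<in> U" "d = \<sigma> \<otimes>\<^bsub>G\<^esub> u" "v \<in> V" "d = \<sigma> \<otimes>\<^bsub>G\<^esub> v" by (auto simp: l_coset_def)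
    have "u \<in> A" "v \<in> A" using uv(1,3) by (auto simp: MN fixer_def)
    then have "u = v" using uv(2,4) \<sigma> by (metis G.l_cancel)
    then show "\<exists>u\<in>U \<inter> V. \<sigma> \<otimes>\<^bsub>G\<^esub> u \<in> generate G Y" using uv d(1) by blast
  qed
qed

section \<open>Restriction to a finite normal subextension\<close>

definition normal_subextension :: "'a set \<Rightarrow> bool" where
  "normal_subextension L \<longleftrightarrow> finite_subextension L \<and> normal_extension k L"

lemma
  assumes "normal_subextension L"
  shows normal_subextension_finite: "finite_subextension L"
    and normal_subextension_normal: "normal_extension k L"
    and normal_subextension_sub: "L \<subseteq> K"
    and normal_subextension_sup: "k \<subseteq> L"
    and normal_subextension_number_field: "number_field L"
    and normal_subextension_closed: "closed_subfield L"
proof -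
  show fin: "finite_subextension L" and "normal_extension k L"
    using assms by (simp_all add: normal_subextension_def)
  show "L \<subseteq> K" "k \<subseteq> L" and nf: "number_field L"
    using finite_subextension_MK[OF fin] finite_subextension_kM[OF fin] finite_subextension_number_field[OF fin]
    by simp_all
  show "closed_subfield L" by (rule number_field_closed_subfield[OF nf])
qed

text \<open>Normality gives one inclusion for every element of the Galois group; applied to the
  inverse of \<sigma> it gives the other.\<close>

lemma normal_subextension_image:
  assumes "normal_subextension L" "\<sigma> \<in> A"
  shows "\<sigma> ` L = L"
proof -
  have LK: "L \<subseteq> K" by (rule normal_subextension_sub[OF assms(1)])
  have sub: "\<tau> x \<in> L" if "\<tau> \<in> A" "x \<in> L" for \<tau> x
    by (rule field_automorphism.normal_extension_stable[OF A_automorphism[OF that(1)]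
          normal_subextension_normal[OF assms(1)] LK A_fix[OF that(1)] that(2)])
  show ?thesis
  proof
    show "\<sigma> ` L \<subseteq> L" using sub[OF assms(2)] by blast
    show "L \<subseteq> \<sigma> ` L"
    proof
      fix x assume x: "x \<in> L"
      have "\<sigma> ((inv\<^bsub>G\<^esub> \<sigma>) x) = x" using G_inv_apply(2)[OF assms(2)] x LK by blast
      then show "x \<in> \<sigma> ` L" using sub[OF G.inv_closed[OF assms(2)] x] by (metis imageI)
    qed
  qed
qed

abbreviation res :: "'a set \<Rightarrow> ('a \<Rightarrow> 'a) \<Rightarrow> ('a \<Rightarrow> 'a)" where
  "res L \<sigma> \<equiv> restrict \<sigma> L"

context
  fixes L assumes L: "normal_subextension L"
begin

lemmas L_fin = normal_subextension_finite[OF L]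
lemmas LK = normal_subextension_sub[OF L]
lemmas L_closed = normal_subextension_closed[OF L]

lemma res_in: "\<sigma> \<in> A \<Longrightarrow> x \<in> L \<Longrightarrow> \<sigma> x \<in> L"
  by (drule normal_subextension_image[OF L]) blast

lemma res_Bij: "\<sigma> \<in> A \<Longrightarrow> res L \<sigma> \<in> Bij L"
proof -
  assume \<sigma>: "\<sigma> \<in> A"
  have "inj_on \<sigma> L" using field_automorphism.h_inj_on[OF A_automorphism[OF \<sigma>]] LK by (rule inj_on_subset)
  then have "bij_betw \<sigma> L L" using normal_subextension_image[OF L \<sigma>] by (simp add: bij_betw_def)
  then have "bij_betw (res L \<sigma>) L L" by (simp add: bij_betw_restrict_eq)
  then show ?thesis by (simp add: Bij_def)
qed

text \<open>The left factor is left unrestricted, so that \<sigma>, an automorphism of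
  \<open>K\<close>, acts on the restrictions by left composition.\<close>

lemma res_mult':
  assumes "\<sigma> \<in> A" "\<tau> \<in> A"
  shows "res L (\<sigma> \<otimes>\<^bsub>G\<^esub> \<tau>) = compose L \<sigma> (res L \<tau>)"
proof (rule ext)
  fix x
  show "res L (\<sigma> \<otimes>\<^bsub>G\<^esub> \<tau>) x = compose L \<sigma> (res L \<tau>) x"
    using G_mult_apply[OF assms, of x] LK by (cases "x \<in> L") (auto simp: compose_def)
qed

lemma res_mult:
  assumes "\<sigma> \<in> A" "\<tau> \<in> A"
  shows "res L (\<sigma> \<otimes>\<^bsub>G\<^esub> \<tau>) = compose L (res L \<sigma>) (res L \<tau>)"
  unfolding res_mult'[OF assms] by (rule ext) (simp add: compose_def res_in[OF assms(2)])

lemma group_hom_res: "group_hom G (BijGroup L) (res L)"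
proof -
  have "res L \<in> hom G (BijGroup L)"
    by (rule homI) (simp_all add: BijGroup_def res_Bij res_mult)
  then show ?thesis by (simp add: group_hom_def group_hom_axioms_def group_G group_BijGroup)
qed

lemma res_field_aut:
  assumes \<sigma>: "\<sigma> \<in> A"
  shows "field_aut L (res L \<sigma>)"
  unfolding field_aut_def
proof (intro conjI ballI)
  interpret s: field_automorphism K \<sigma> by (rule A_automorphism[OF \<sigma>])
  show "res L \<sigma> ` L = L" using normal_subextension_image[OF L \<sigma>] by simp
  show "res L \<sigma> 1 = 1" using closed_subfield_1[OF L_closed] s.h_1 by simp
  fix x y assume xy: "x \<in> L" "y \<in> L"
  then have xyK: "x \<in> K" "y \<in> K" using LK by blast+
  show "res L \<sigma> (x + y) = res L \<sigma> x + res L \<sigma> y"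
    using xy closed_subfield_add[OF L_closed xy] s.h_add[OF xyK] by simp
  show "res L \<sigma> (x * y) = res L \<sigma> x * res L \<sigma> y"
    using xy closed_subfield_mult[OF L_closed xy] s.h_mult[OF xyK] by simp
qed

text \<open>The kernel of restriction is \<open>fixer L\<close>, an open normal subgroup, so the
  pro-\<open>p\<close> condition applies to the quotient, which is isomorphic to the image.\<close>

lemma card_res: "\<exists>e. card (res L ` A) = p ^ e"
proof -
  interpret r: group_hom G "BijGroup L" "res L" by (rule group_hom_res)
  have ker: "kernel G (BijGroup L) (res L) = fixer L"
    by (auto simp: kernel_def fixer_def BijGroup_def restrict_def fun_eq_iff)
  have "\<one>\<^bsub>G\<^esub> <#\<^bsub>G\<^esub> fixer L = fixer L"
    by (auto simp: l_coset_def fixer_def)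
  then have "openin T (fixer L)" using open_coset_fixer[OF L_fin G.one_closed] by simp
  moreover have "fixer L \<lhd> G" using r.normal_kernel ker by simp
  ultimately have "\<exists>e. card (carrier (G Mod fixer L)) = p ^ e"
    using pro_p by (auto simp: pro_p_extension_def pro_p_group_def)
  then show ?thesis using r.card_FactGroup_kernel ker by simp
qed

text \<open>A power of \<open>p\<close> is positive, whereas an infinite set has cardinality
  0.\<close>

lemma finite_res: "finite (res L ` A)"
proof -
  obtain e where "card (res L ` A) = p ^ e" using card_res by blast
  then have "card (res L ` A) > 0" using prime_p by (simp add: prime_gt_0_nat)
  then show ?thesis by (rule card_ge_0_finite)
qed

text \<open>Left composition with any \<sigma> permutes the restrictions, so the sum is fixed by the
  whole Galois group.\<close>

lemma trace_in_k:
  assumes y: "y \<in> L"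
  shows "(\<Sum>h\<in>res L ` A. h y) \<in> k"
proof (rule fixed_by_A)
  have hL: "h y \<in> L" if "h \<in> res L ` A" for h using that res_in y by auto
  show "(\<Sum>h\<in>res L ` A. h y) \<in> K"
    using hL LK by (intro closed_subfield_sum[OF K]) auto
  fix \<sigma> assume \<sigma>: "\<sigma> \<in> A"
  interpret s: field_automorphism K \<sigma> by (rule A_automorphism[OF \<sigma>])
  have inj: "inj_on (compose L \<sigma>) (res L ` A)"
  proof (rule inj_onI)
    fix h h' assume h: "h \<in> res L ` A" "h' \<in> res L ` A" "compose L \<sigma> h = compose L \<sigma> h'"
    show "h = h'"
    proof (rule extensionalityI[of _ L])
      show "h \<in> extensional L" "h' \<in> extensional L" using h by auto
      fix x assume x: "x \<in> L"
      have "\<sigma> (h x) = \<sigma> (h' x)" using fun_cong[OF h(3), of x] x by (simp add: compose_def)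
      moreover have "h x \<in> K" "h' x \<in> K" using h(1,2) x res_in LK by auto
      ultimately show "h x = h' x" using s.h_inj_on by (auto dest: inj_onD)
    qed
  qed
  have "compose L \<sigma> ` res L ` A \<subseteq> res L ` A"
  proof clarify
    fix \<tau> assume \<tau>: "\<tau> \<in> A"
    show "compose L \<sigma> (res L \<tau>) \<in> res L ` A"
      unfolding res_mult'[OF \<sigma> \<tau>, symmetric] using \<sigma> \<tau> by (intro imageI G.m_closed)
  qed
  then have "bij_betw (compose L \<sigma>) (res L ` A) (res L ` A)"
    using inj endo_inj_surj[OF finite_res] by (simp add: bij_betw_def)
  then have "(\<Sum>h\<in>res L ` A. (compose L \<sigma> h) y) = (\<Sum>h\<in>res L ` A. h y)"
    by (rule sum.reindex_bij_betw[where g = "\<lambda>h. h y"])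
  moreover have "\<sigma> (\<Sum>h\<in>res L ` A. h y) = (\<Sum>h\<in>res L ` A. \<sigma> (h y))"
    using hL LK by (intro s.h_sum) auto
  ultimately show "\<sigma> (\<Sum>h\<in>res L ` A. h y) = (\<Sum>h\<in>res L ` A. h y)"
    using y by (simp add: compose_def)
qed

text \<open>
  For every \<open>s\<close> moving some \<open>b s \<in> F\<close>, the factor \<open>s (b s) - h (b s)\<close> kills the summand \<open>h = s\<close>, so
  that only multiples of \<open>x\<close> survive in the sum over all \<open>h\<close> of \<open>h x\<close> times all these factors.
\<close>

lemma fixed_by_fixer:
  assumes F: "normal_subextension F" and x: "x \<in> L" "\<And>\<sigma>. \<sigma> \<in> fixer F \<Longrightarrow> \<sigma> x = x" and FL: "F \<subseteq> L"
  shows "x \<in> F"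
proof -
  note Fc = normal_subextension_closed[OF F] and kF = normal_subextension_sup[OF F]
  define H where "H = res L ` A"
  have finH: "finite H" unfolding H_def by (rule finite_res)
  define HF where "HF = {h \<in> H. \<forall>y\<in>F. h y = y}"
  have hF: "h y \<in> F" if "h \<in> H" "y \<in> F" for h y
  proof -
    obtain \<sigma> where \<sigma>: "\<sigma> \<in> A" "h = res L \<sigma>" using \<open>h \<in> H\<close> by (auto simp: H_def)
    have "h y = \<sigma> y" using \<sigma>(2) FL that(2) by auto
    moreover have "\<sigma> y \<in> F" using normal_subextension_image[OF F \<sigma>(1)] that(2) by blast
    ultimately show ?thesis by simp
  qed
  have "\<forall>s\<in>H - HF. \<exists>b. b \<in> F \<and> s b \<noteq> b" by (auto simp: HF_def)
  from bchoice[OF this] obtain b where b: "\<And>s. s \<in> H - HF \<Longrightarrow> b s \<in> F \<and> s (b s) \<noteq> b s" by blast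
  \<comment> \<open>Multiplying out one factor leaves a combination, with coefficients in
    \<open>F\<close>, of the sums for \<open>y\<close> and for \<open>b s * y\<close> with one
    factor fewer. With no factors left the sum is a trace and lies in \<open>k\<close>. For this the
    claim is needed for all \<open>y\<close> at once.\<close>
  have key: "(\<Sum>h\<in>H. (\<Prod>s\<in>S. s (b s) - h (b s)) * h y) \<in> F" if "finite S" "S \<subseteq> H - HF" "y \<in> L" for S y
    using that
  proof (induction S arbitrary: y rule: finite_induct)
    case empty
    then show ?case using trace_in_k[of y] kF by (auto simp: H_def)
  next
    case (insert s S)
    have bs: "b s \<in> F" "s (b s) \<in> F" using b[of s] insert.prems hF[of s "b s"] by auto
    have "(\<Sum>h\<in>H. (\<Prod>s\<in>insert s S. s (b s) - h (b s)) * h y) =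
        (\<Sum>h\<in>H. s (b s) * ((\<Prod>s\<in>S. s (b s) - h (b s)) * h y) - (\<Prod>s\<in>S. s (b s) - h (b s)) * h (b s * y))"
    proof (rule sum.cong)
      fix h assume "h \<in> H"
      then obtain \<sigma> where \<sigma>: "\<sigma> \<in> A" "h = res L \<sigma>" by (auto simp: H_def)
      have "h (b s * y) = h (b s) * h y"
        using res_field_aut[OF \<sigma>(1)] bs(1) FL insert.prems(2) unfolding \<sigma>(2) field_aut_def by blast
      then show "(\<Prod>s\<in>insert s S. s (b s) - h (b s)) * h y =
          s (b s) * ((\<Prod>s\<in>S. s (b s) - h (b s)) * h y) - (\<Prod>s\<in>S. s (b s) - h (b s)) * h (b s * y)"
        using insert.hyps by (simp add: algebra_simps)
    qed simp
    also have "\<dots> = s (b s) * (\<Sum>h\<in>H. (\<Prod>s\<in>S. s (b s) - h (b s)) * h y) -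
        (\<Sum>h\<in>H. (\<Prod>s\<in>S. s (b s) - h (b s)) * h (b s * y))"
      by (simp add: sum_subtractf sum_distrib_left)
    also have "\<dots> \<in> F"
    proof (intro closed_subfield_diff[OF Fc] closed_subfield_mult[OF Fc] bs insert.IH)
      show "b s * y \<in> L" using bs(1) FL insert.prems(2) by (intro closed_subfield_mult[OF L_closed]) auto
    qed (use insert.prems in auto)
    finally show ?case .
  qed
  define P where "P h = (\<Prod>s\<in>H - HF. s (b s) - h (b s))" for h
  define c where "c = (\<Prod>s\<in>H - HF. s (b s) - b s)"
  have "(\<Sum>h\<in>H. P h * h x) = (\<Sum>h\<in>HF. P h * h x)"
  proof (rule sum.mono_neutral_right[OF finH])
    show "HF \<subseteq> H" by (auto simp: HF_def)
    show "\<forall>h\<in>H - HF. P h * h x = 0"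
      using finH by (auto simp: P_def intro!: prod_zero)
  qed
  also have "\<dots> = (\<Sum>h\<in>HF. c * x)"
  proof (rule sum.cong)
    fix h assume h: "h \<in> HF"
    then obtain \<sigma> where \<sigma>: "\<sigma> \<in> A" "h = res L \<sigma>" by (auto simp: HF_def H_def)
    have hfix: "h y = y" if "y \<in> F" for y using h that by (simp add: HF_def)
    have "\<sigma> y = y" if "y \<in> F" for y
      using hfix[OF that] FL that unfolding \<sigma>(2) by (metis restrict_apply' subsetD)
    then have "\<sigma> \<in> fixer F" using \<sigma>(1) by (simp add: fixer_def)
    then have "h x = x" using x \<sigma> by simp
    moreover have "h (b s) = b s" if "s \<in> H - HF" for s using hfix b[OF that] by blast
    then have "P h = c" unfolding P_def c_def by (intro prod.cong) auto
    ultimately show "P h * h x = c * x" by simp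
  qed simp
  finally have "(\<Sum>h\<in>H. P h * h x) = of_nat (card HF) * c * x" by simp
  moreover have "(\<Sum>h\<in>H. P h * h x) \<in> F"
    unfolding P_def using key[of "H - HF" x] finH x(1) by simp
  ultimately have 1: "of_nat (card HF) * c * x \<in> F" by simp
  have cF: "c \<in> F" unfolding c_def using b hF by (intro closed_subfield_prod[OF Fc] closed_subfield_diff[OF Fc]) auto
  have "c \<noteq> 0" unfolding c_def using finH b by auto
  have "res L \<one>\<^bsub>G\<^esub> \<in> HF" using FL LK G_one_apply by (auto simp: HF_def H_def)
  then have "card HF \<noteq> 0" using finH by (auto simp: HF_def)
  \<comment> \<open>Division by \<open>card HF\<close> is possible in characteristic 0.\<close>
  have "x = (of_nat (card HF) * c * x) / (of_nat (card HF) * c)"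
    using \<open>c \<noteq> 0\<close> \<open>card HF \<noteq> 0\<close> by simp
  also have "\<dots> \<in> F"
    by (intro closed_subfield_divide[OF Fc] 1 closed_subfield_mult[OF Fc] closed_subfield_of_nat[OF Fc] cF)
  finally show ?thesis .
qed

lemma galois_pair_res:
  assumes F: "normal_subextension F" and FL: "F \<subseteq> L"
  shows "galois_pair F L (res L ` fixer F)"
proof
  have fA: "fixer F \<subseteq> A" by (auto simp: fixer_def)
  show "number_field F" "number_field L"
    by (rule normal_subextension_number_field, rule F, rule normal_subextension_number_field, rule L)
  show "F \<subseteq> L" by (rule FL)
  show "finite (res L ` fixer F)" using finite_subset[OF image_mono[OF fA] finite_res] .
  show "h \<in> extensional L" if "h \<in> res L ` fixer F" for h using that by auto
  show "field_aut L h" if "h \<in> res L ` fixer F" for h using that fA res_field_aut by auto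
  show "compose L g h \<in> res L ` fixer F" if gh: "g \<in> res L ` fixer F" "h \<in> res L ` fixer F" for g h
  proof -
    obtain \<sigma> \<tau> where st: "\<sigma> \<in> fixer F" "\<tau> \<in> fixer F" "g = res L \<sigma>" "h = res L \<tau>" using gh by auto
    have "\<sigma> \<otimes>\<^bsub>G\<^esub> \<tau> \<in> fixer F"
      using st(1,2) FL LK G_mult_apply by (auto simp: fixer_def subset_iff)
    moreover have "compose L g h = res L (\<sigma> \<otimes>\<^bsub>G\<^esub> \<tau>)"
      unfolding st(3,4) using st(1,2) fA by (intro res_mult[symmetric]) blast+
    ultimately show ?thesis by blast
  qed
  show "(\<forall>h\<in>res L ` fixer F. h x = x) \<longleftrightarrow> x \<in> F" if x: "x \<in> L" for x
    using fixed_by_fixer[OF F x _ FL] x by (auto simp: fixer_def)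
qed

text \<open>The restrictions of \<open>fixer F\<close> form a subgroup of a group of
  \<open>p\<close>-power order, so Lagrange's theorem applies.\<close>

lemma card_res_fixer:
  assumes F: "normal_subextension F" and FL: "F \<subseteq> L"
  shows "\<exists>e. card (res L ` fixer F) = p ^ e"
proof -
  interpret r: group_hom G "BijGroup L" "res L" by (rule group_hom_res)
  let ?HL = "BijGroup L\<lparr>carrier := res L ` A\<rparr>"
  have sub: "subgroup (res L ` A) (BijGroup L)" by (rule r.img_is_subgroup)
  then interpret HL: group ?HL by (rule subgroup.subgroup_is_group[OF _ group_BijGroup])
  have FK: "F \<subseteq> K" using FL LK by auto
  have "subgroup (fixer F) G"
  proof (rule G.subgroupI)
    show "fixer F \<noteq> {}" using FK G_one_apply by (auto simp: fixer_def)
    show "inv\<^bsub>G\<^esub> \<sigma> \<in> fixer F" if "\<sigma> \<in> fixer F" for \<sigma>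
      using that G_inv_apply(1)[of \<sigma>] FK by (force simp: fixer_def)
    show "\<sigma> \<otimes>\<^bsub>G\<^esub> \<tau> \<in> fixer F" if "\<sigma> \<in> fixer F" "\<tau> \<in> fixer F" for \<sigma> \<tau>
      using that FK G_mult_apply by (auto simp: fixer_def subset_iff)
  qed (auto simp: fixer_def)
  then have "subgroup (res L ` fixer F) (BijGroup L)" by (rule r.subgroup_img_is_subgroup)
  then have "subgroup (res L ` fixer F) ?HL"
    by (rule group.subgroup_incl[OF group_BijGroup _ sub]) (auto simp: fixer_def)
  then have "card (rcosets\<^bsub>?HL\<^esub> (res L ` fixer F)) * card (res L ` fixer F) = Coset.order ?HL"
    by (rule HL.lagrange)
  then have "card (res L ` fixer F) dvd card (res L ` A)" by (simp add: Coset.order_def) (metis dvd_triv_right)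
  then show ?thesis using card_res divides_primepow_nat[OF prime_p] by auto
qed

end

text \<open>Classes with fewer than \<open>p ^ m\<close> conjugates are fixed by \<open>fixer F\<close>, hence come from \<open>F\<close>.\<close>

lemma card_non_p_part_cong:
  assumes F: "normal_subextension F" and L: "normal_subextension L" and FL: "F \<subseteq> L"
    and small: "\<And>S c M. small_stabilizer G (p ^ m) c S \<Longrightarrow> finite_subextension M \<Longrightarrow> fixer M \<subseteq> S \<Longrightarrow> fixer F \<subseteq> S"
  shows "[card (non_p_part p (ideal_class_group L)) = card (non_p_part p (ideal_class_group F))] (mod p ^ m)"
proof -
  interpret gp: galois_pair F L "res L ` fixer F" by (rule galois_pair_res[OF L F FL])
  let ?C = "ideal_class_group L"
  interpret C: comm_group ?C by (rule gp.LL.comm_group_class_group)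
  define E where "E = non_p_part p ?C"
  define Fix where "Fix = {y. \<forall>h\<in>res L ` fixer F. (`) h ` y = y}"
  have fin_E: "finite E"
    unfolding E_def non_p_part_def by (rule finite_subset[OF _ gp.LL.finite_class_group]) auto
  obtain e where e: "card (res L ` fixer F) = p ^ e" using card_res_fixer[OF L F FL] by blast
  have "card (non_p_part p (ideal_class_group F)) = card (E \<inter> Fix)"
    using bij_betw_same_card[OF gp.bij_betw_class_extend[OF prime_p e]] by (simp add: E_def Fix_def)
  moreover have "card E = card (E \<inter> Fix) + card (E - Fix)"
    using card_Int_Diff[OF fin_E] .
  \<comment> \<open>The set \<open>E - Fix\<close> is a disjoint union of orbits under the
    restricted Galois group. Their sizes are powers of \<open>p\<close>, so it remains to exclude
    those below \<open>p ^ m\<close>.\<close>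
  moreover have "p ^ m dvd card (E - Fix)"
  proof -
    have LK: "L \<subseteq> K" by (rule LK[OF L])
    have E_carrier: "y \<in> carrier ?C" if "y \<in> E" for y using that by (simp add: E_def non_p_part_def)
    have E_sub: "I \<subseteq> L" if y: "y \<in> E" and I: "I \<in> y" for y I
    proof -
      obtain J where J: "fractional_ideal L J" "y = gp.LL.ideal_class J"
        using E_carrier[OF y] by (auto simp: gp.LL.carrier_class_group)
      then obtain a where "a \<in> L - {0}" "I = scale a J" using I gp.LL.ideal_class_eq[OF J(1)] by auto
      then show ?thesis using gp.LL.fractional_ideal_subset[OF gp.LL.fractional_ideal_scale[OF J(1)]] by auto
    qed
    have auto: "number_field_automorphism L h" if "h \<in> res L ` A" for h
      using that res_field_aut[OF L] gp.LL.F
      by (auto simp: number_field_automorphism_def gp.LL.number_field_locale_axioms field_automorphism_def)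
    have class_in: "(`) h ` y \<in> carrier ?C" if h: "h \<in> res L ` A" and y: "y \<in> carrier ?C" for h y
    proof -
      interpret h: number_field_automorphism L h by (rule auto[OF h])
      show ?thesis using y h.image_ideal_class h.fractional_ideal_h_image by (auto simp: gp.LL.carrier_class_group)
    qed
    have class_mult: "(`) h ` (x \<otimes>\<^bsub>?C\<^esub> y) = ((`) h ` x) \<otimes>\<^bsub>?C\<^esub> ((`) h ` y)"
      if h: "h \<in> res L ` A" and x: "x \<in> carrier ?C" and y: "y \<in> carrier ?C" for h x y
    proof -
      interpret h: number_field_automorphism L h by (rule auto[OF h])
      obtain I J where IJ: "fractional_ideal L I" "x = gp.LL.ideal_class I" "fractional_ideal L J" "y = gp.LL.ideal_class J"
        using x y by (auto simp: gp.LL.carrier_class_group)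
      then show ?thesis
        by (simp add: gp.LL.class_group_mult h.image_ideal_class h.fractional_ideal_h_image
            gp.LL.fractional_ideal_product h.h_image_ideal_product gp.LL.fractional_ideal_subset)
    qed
    have class_hom: "(`) ((`) h) \<in> hom ?C ?C" if h: "h \<in> res L ` A" for h
      using class_in[OF h] class_mult[OF h] by (intro homI) auto
    have act_E: "(`) h ` y \<in> E" if h: "h \<in> res L ` A" and y: "y \<in> E" for h y
    proof -
      interpret hh: group_hom ?C ?C "(`) ((`) h)"
        by (simp add: group_hom_def group_hom_axioms_def class_hom[OF h] C.is_group)
      obtain n :: nat where n: "n > 0" "coprime n p" "y [^]\<^bsub>?C\<^esub> n = \<one>\<^bsub>?C\<^esub>"
        using y C.non_p_part_iff[OF gp.LL.finite_class_group] unfolding E_def by blast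
      have "((`) h ` y) [^]\<^bsub>?C\<^esub> n = \<one>\<^bsub>?C\<^esub>"
        using hh.hom_nat_pow[OF E_carrier[OF y], of n] n(3) by simp
      then show ?thesis
        unfolding E_def C.non_p_part_iff[OF gp.LL.finite_class_group]
        using n class_in[OF h E_carrier[OF y]] by blast
    qed
    have act_eq: "(`) g ` y = (`) h ` y" if "y \<in> E" "\<And>x. x \<in> L \<Longrightarrow> g x = h x" for g h y
      using E_sub[OF that(1)] that(2) by (intro image_cong refl) blast
    have act_compose: "(`) (compose L g h) ` y = (`) g ` (`) h ` y" if "y \<in> E" for g h y
    proof -
      have "(`) (compose L g h) ` y = (`) (\<lambda>x. g (h x)) ` y" by (rule act_eq[OF that]) (simp add: compose_def)
      then show ?thesis by (simp add: image_image)
    qed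
    have act_id: "(`) h ` y = y" if "y \<in> E" "\<And>x. x \<in> L \<Longrightarrow> h x = x" for h y
      using act_eq[OF that(1), of h "\<lambda>x. x"] that(2) by simp
    \<comment> \<open>The finite group of restrictions acts here instead of the profinite group, so
      that the orbit-stabilizer theorem bounds orbit sizes by a power of \<open>p\<close>.\<close>
    let ?HL = "BijGroup L\<lparr>carrier := res L ` A\<rparr>"
    define \<phi> where "\<phi> h = (\<lambda>y\<in>E. (`) h ` y)" for h :: "'a \<Rightarrow> 'a"
    have sub: "subgroup (res L ` A) (BijGroup L)" by (rule group_hom.img_is_subgroup[OF group_hom_res[OF L]])
    interpret HL: group ?HL by (rule subgroup.subgroup_is_group[OF sub group_BijGroup])
    have HL_mult: "g \<otimes>\<^bsub>?HL\<^esub> h = compose L g h" if "g \<in> res L ` A" "h \<in> res L ` A" for g h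
      using that res_Bij[OF L] by (auto simp: BijGroup_def)
    have HL_one: "\<one>\<^bsub>?HL\<^esub> = (\<lambda>x\<in>L. x)" by (simp add: BijGroup_def)
    have \<phi>_apply: "\<phi> h y = (`) h ` y" if "y \<in> E" for h y using that by (simp add: \<phi>_def)
    have \<phi>_mult: "\<phi> (g \<otimes>\<^bsub>?HL\<^esub> h) = compose E (\<phi> g) (\<phi> h)" if "g \<in> res L ` A" "h \<in> res L ` A" for g h
    proof (rule ext)
      fix y
      show "\<phi> (g \<otimes>\<^bsub>?HL\<^esub> h) y = compose E (\<phi> g) (\<phi> h) y"
      proof (cases "y \<in> E")
        case True
        have "\<phi> (compose L g h) y = (`) g ` (`) h ` y" unfolding \<phi>_apply[OF True] by (rule act_compose[OF True])
        also have "\<dots> = \<phi> g (\<phi> h y)" by (simp only: \<phi>_apply[OF True] \<phi>_apply[OF act_E[OF that(2) True]])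
        finally show ?thesis by (simp only: HL_mult[OF that] compose_eq[OF True])
      qed (simp add: \<phi>_def compose_def)
    qed
    have \<phi>_Bij: "\<phi> h \<in> Bij E" if h: "h \<in> res L ` A" for h
    proof -
      define g where "g = inv\<^bsub>?HL\<^esub> h"
      have g: "g \<in> res L ` A" using HL.inv_closed[of h] h by (simp add: g_def)
      have "\<phi> g (\<phi> h y) = y" "\<phi> h (\<phi> g y) = y" if y: "y \<in> E" for y
      proof -
        have "compose L g h = (\<lambda>x\<in>L. x)" "compose L h g = (\<lambda>x\<in>L. x)"
          using HL.l_inv[of h] HL.r_inv[of h] HL_mult h g HL_one by (simp_all add: g_def)
        then have "(`) g ` (`) h ` y = y" "(`) h ` (`) g ` y = y"
          using act_compose[OF y, of g h] act_compose[OF y, of h g] act_id[OF y, of "\<lambda>x\<in>L. x"] by simp_all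
        then show "\<phi> g (\<phi> h y) = y" "\<phi> h (\<phi> g y) = y"
          by (simp_all only: \<phi>_apply[OF y] \<phi>_apply[OF act_E[OF h y]] \<phi>_apply[OF act_E[OF g y]])
      qed
      moreover have "\<phi> h \<in> E \<rightarrow> E" "\<phi> g \<in> E \<rightarrow> E" using act_E[OF h] act_E[OF g] by (simp_all add: Pi_I \<phi>_apply del: image_eqI)
      ultimately have "bij_betw (\<phi> h) E E" by (intro bij_betwI[of _ _ _ "\<phi> g"]) auto
      then show ?thesis by (simp add: Bij_def \<phi>_def)
    qed
    have "\<phi> \<in> hom ?HL (BijGroup E)"
      by (rule homI) (use \<phi>_mult \<phi>_Bij in \<open>simp_all add: BijGroup_def\<close>)
    then interpret act: group_action ?HL E \<phi>
      by (simp add: group_action_def group_hom_def group_hom_axioms_def HL.is_group group_BijGroup)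
    have orbit_iff: "z \<in> orbit ?HL \<phi> y \<longleftrightarrow> (\<exists>h\<in>res L ` A. z = (`) h ` y)" if y: "y \<in> E" for y z
    proof -
      have "carrier ?HL = res L ` A" by simp
      then show ?thesis unfolding orbit_def \<phi>_apply[OF y] by blast
    qed
    have orbit_in: "(`) \<sigma> ` y \<in> orbit ?HL \<phi> y" if "y \<in> E" "\<sigma> \<in> A" for y \<sigma>
      unfolding orbit_iff[OF that(1)]
    proof (rule bexI)
      show "(`) \<sigma> ` y = (`) (res L \<sigma>) ` y" by (rule act_eq[OF that(1)]) simp
      show "res L \<sigma> \<in> res L ` A" using that(2) by (rule imageI)
    qed
    have orbit_sub: "orbit ?HL \<phi> y \<subseteq> E" if yE: "y \<in> E" for y
    proof
      fix z assume "z \<in> orbit ?HL \<phi> y"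
      then obtain h where h: "h \<in> res L ` A" "z = (`) h ` y" unfolding orbit_iff[OF yE] by (elim bexE)
      show "z \<in> E" unfolding h(2) by (rule act_E[OF h(1) yE])
    qed
    have Fix_stable: "(`) h ` y \<in> Fix" if y: "y \<in> E" "y \<in> Fix" and h: "h \<in> res L ` A" for h y
    proof -
      obtain \<sigma> where \<sigma>: "\<sigma> \<in> A" "h = res L \<sigma>" using h by blast
      have fixed: "(`) (res L \<tau>) ` (`) h ` y = (`) h ` y" if \<tau>: "\<tau> \<in> fixer F" for \<tau>
      proof -
        have \<tau>A: "\<tau> \<in> A" using \<tau> by (simp add: fixer_def)
        define \<rho> where "\<rho> = inv\<^bsub>G\<^esub> \<sigma> \<otimes>\<^bsub>G\<^esub> (\<tau> \<otimes>\<^bsub>G\<^esub> \<sigma>)"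
        have \<rho>A: "\<rho> \<in> A" using \<sigma> \<tau>A by (simp add: \<rho>_def)
        have "\<rho> x = x" if x: "x \<in> F" for x
        proof -
          have xK: "x \<in> K" using x FL LK by auto
          have "\<sigma> x \<in> F" using normal_subextension_image[OF F \<sigma>(1)] x by blast
          then have "\<tau> (\<sigma> x) = \<sigma> x" using \<tau> by (simp add: fixer_def)
          then show ?thesis
            using \<sigma> \<tau>A xK by (simp add: \<rho>_def G_mult_apply G_inv_apply)
        qed
        then have "\<rho> \<in> fixer F" using \<rho>A by (simp add: fixer_def)
        then have \<rho>y: "(`) (res L \<rho>) ` y = y" using y(2) unfolding Fix_def by blast
        have "\<sigma> \<otimes>\<^bsub>G\<^esub> \<rho> = \<tau> \<otimes>\<^bsub>G\<^esub> \<sigma>"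
          using \<sigma> \<tau>A by (simp add: \<rho>_def G.m_assoc[symmetric])
        then have "compose L (res L \<sigma>) (res L \<rho>) = compose L (res L \<tau>) (res L \<sigma>)"
          using res_mult[OF L] \<sigma>(1) \<tau>A \<rho>A by metis
        then have "(`) (res L \<tau>) ` (`) (res L \<sigma>) ` y = (`) (res L \<sigma>) ` (`) (res L \<rho>) ` y"
          unfolding act_compose[OF y(1), symmetric] by (rule arg_cong[where f = "\<lambda>h. (`) h ` y", OF sym])
        then show ?thesis unfolding \<rho>y \<sigma>(2) .
      qed
      show ?thesis
        unfolding Fix_def
      proof (intro CollectI ballI)
        fix h' assume "h' \<in> res L ` fixer F"
        then obtain \<tau> where \<tau>: "h' = res L \<tau>" "\<tau> \<in> fixer F" by (rule imageE)
        show "(`) h' ` (`) h ` y = (`) h ` y" unfolding \<tau>(1) by (rule fixed[OF \<tau>(2)])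
      qed
    qed
    have orbit_Fix: "orbit ?HL \<phi> y \<subseteq> E - Fix" if y: "y \<in> E - Fix" for y
    proof
      fix z assume z: "z \<in> orbit ?HL \<phi> y"
      have yE: "y \<in> E" using y by simp
      have zE: "z \<in> E" by (rule subsetD[OF orbit_sub[OF yE] z])
      have "y \<in> orbit ?HL \<phi> z" by (rule act.orbit_sym[OF yE zE z])
      then obtain h where h: "h \<in> res L ` A" "y = (`) h ` z" unfolding orbit_iff[OF zE] by (elim bexE)
      have "z \<notin> Fix"
      proof
        assume "z \<in> Fix"
        from Fix_stable[OF zE this h(1)] show False using y unfolding h(2) by simp
      qed
      with zE show "z \<in> E - Fix" by (rule DiffI)
    qed
    have orbit_card: "p ^ m dvd card (orbit ?HL \<phi> y)" if y: "y \<in> E - Fix" for y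
    proof -
      have yE: "y \<in> E" using y by simp
      obtain e where e: "card (res L ` A) = p ^ e" using card_res[OF L] by blast
      have "card (orbit ?HL \<phi> y) * card (stabilizer ?HL \<phi> y) = p ^ e"
        using act.orbit_stabilizer_theorem[OF yE] e by (simp add: Coset.order_def)
      then have "card (orbit ?HL \<phi> y) dvd p ^ e" by (metis dvd_triv_left)
      then obtain t where t: "card (orbit ?HL \<phi> y) = p ^ t" using divides_primepow_nat[OF prime_p] by blast
      have "m \<le> t"
      proof (rule ccontr)
        assume "\<not> m \<le> t"
        then have lt: "card (orbit ?HL \<phi> y) < p ^ m"          unfolding t using prime_gt_1_nat[OF prime_p] by (intro power_strict_increasing) simp_all
        have fin: "finite (orbit ?HL \<phi> y)" using orbit_sub[OF yE] fin_E by (rule finite_subset)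
        \<comment> \<open>Numbering the orbit turns the action on \<open>y\<close> into an orbit map
          with values below \<open>p ^ m\<close>, as \<open>small_stabilizer\<close> requires. From
          here on the action is that of the full Galois group again.\<close>
        obtain \<iota> where \<iota>: "bij_betw \<iota> (orbit ?HL \<phi> y) {0..<card (orbit ?HL \<phi> y)}"
          using ex_bij_betw_finite_nat[OF fin] by blast
        define c where "c \<sigma> = \<iota> ((`) \<sigma> ` y)" for \<sigma>
        have in_orbit: "(`) \<sigma> ` y \<in> orbit ?HL \<phi> y" if "\<sigma> \<in> A" for \<sigma> by (rule orbit_in[OF yE that])
        have c_eq: "c \<sigma> = c \<tau> \<longleftrightarrow> (`) \<sigma> ` y = (`) \<tau> ` y" if "\<sigma> \<in> A" "\<tau> \<in> A" for \<sigma> \<tau>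
          unfolding c_def by (rule inj_on_eq_iff[OF bij_betw_imp_inj_on[OF \<iota>] in_orbit[OF that(1)] in_orbit[OF that(2)]])
        have mult: "(`) (\<sigma> \<otimes>\<^bsub>G\<^esub> \<tau>) ` y = (`) \<sigma> ` (`) \<tau> ` y" if "\<sigma> \<in> A" "\<tau> \<in> A" for \<sigma> \<tau>
        proof -
          have "(`) (\<sigma> \<otimes>\<^bsub>G\<^esub> \<tau>) ` y = (`) (\<lambda>x. \<sigma> (\<tau> x)) ` y"
            by (rule act_eq[OF yE]) (use LK that in \<open>auto simp: G_mult_apply subset_iff\<close>)
          also have "\<dots> = (`) \<sigma> ` (`) \<tau> ` y" by (simp only: image_image)
          finally show ?thesis .
        qed
        define S where "S = {\<sigma> \<in> A. c \<sigma> = c \<one>\<^bsub>G\<^esub>}"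
        have one: "(`) \<one>\<^bsub>G\<^esub> ` y = y" by (rule act_id[OF yE]) (use LK G_one_apply in auto)
        have S_iff: "\<sigma> \<in> S \<longleftrightarrow> \<sigma> \<in> A \<and> (`) \<sigma> ` y = y" for \<sigma>
          unfolding S_def mem_Collect_eq
          by (rule conj_cong[OF refl]) (rule c_eq[OF _ G.one_closed, unfolded one])
        have "small_stabilizer G (p ^ m) c S"
          unfolding small_stabilizer_def
        proof (intro conjI ballI impI)
          fix \<sigma> assume \<sigma>: "\<sigma> \<in> A"
          have "c \<sigma> \<in> {0..<card (orbit ?HL \<phi> y)}"
            unfolding c_def by (rule bspec[OF bij_betwE[OF \<iota>] in_orbit[OF \<sigma>]])
          then show "c \<sigma> < p ^ m" using lt by simp
        next
          fix s \<sigma> \<tau> assume st: "s \<in> A" "\<sigma> \<in> A" "\<tau> \<in> A" "c \<sigma> = c \<tau>"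
          have "(`) \<sigma> ` y = (`) \<tau> ` y" by (rule iffD1[OF c_eq[OF st(2,3)] st(4)])
          then show "c (s \<otimes>\<^bsub>G\<^esub> \<sigma>) = c (s \<otimes>\<^bsub>G\<^esub> \<tau>)"
            unfolding c_def mult[OF st(1,2)] mult[OF st(1,3)] by (rule arg_cong)
        qed (rule S_def)
        \<comment> \<open>Since \<open>y\<close> is a class of \<open>L\<close>, its stabilizer
          contains \<open>fixer L\<close>; this provides the finite subextension asked for by
          \<open>small\<close>.\<close>
        moreover have "fixer L \<subseteq> S"
        proof
          fix \<sigma> assume \<sigma>: "\<sigma> \<in> fixer L"
          show "\<sigma> \<in> S"
            unfolding S_iff
          proof
            show "\<sigma> \<in> A" using \<sigma> by (simp add: fixer_def)
            show "(`) \<sigma> ` y = y" by (rule act_id[OF yE]) (use \<sigma> in \<open>simp add: fixer_def\<close>)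
          qed
        qed
        ultimately have FS: "fixer F \<subseteq> S" by (rule small[OF _ L_fin[OF L]])
        have "y \<in> Fix"
          unfolding Fix_def
        proof (intro CollectI ballI)
          fix h assume "h \<in> res L ` fixer F"
          then obtain \<sigma> where \<sigma>: "h = res L \<sigma>" "\<sigma> \<in> fixer F" by (rule imageE)
          have "(`) h ` y = (`) \<sigma> ` y" unfolding \<sigma>(1) by (rule act_eq[OF yE]) simp
          also have "\<dots> = y" using subsetD[OF FS \<sigma>(2)] unfolding S_iff by (rule conjunct2)
          finally show "(`) h ` y = y" .
        qed
        then show False using y by simp
      qed
      then show ?thesis by (simp add: t le_imp_power_dvd)
    qed
    have union: "\<Union> (orbit ?HL \<phi> ` (E - Fix)) = E - Fix"
    proof
      show "\<Union> (orbit ?HL \<phi> ` (E - Fix)) \<subseteq> E - Fix" using orbit_Fix by (rule UN_least)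
      show "E - Fix \<subseteq> \<Union> (orbit ?HL \<phi> ` (E - Fix))"
      proof
        fix y assume y: "y \<in> E - Fix"
        then show "y \<in> \<Union> (orbit ?HL \<phi> ` (E - Fix))" using act.orbit_refl[of y] by (intro UN_I[OF y]) simp
      qed
    qed
    have "p ^ m dvd card (\<Union> (orbit ?HL \<phi> ` (E - Fix)))"
    proof (rule dvd_partition)
      show "finite (\<Union> (orbit ?HL \<phi> ` (E - Fix)))" using fin_E by (simp only: union finite_Diff)
      show "\<forall>c\<in>orbit ?HL \<phi> ` (E - Fix). p ^ m dvd card c" using orbit_card by (intro ballI) (elim imageE, simp only:)
      show "\<forall>c1\<in>orbit ?HL \<phi> ` (E - Fix). \<forall>c2\<in>orbit ?HL \<phi> ` (E - Fix). c1 \<noteq> c2 \<longrightarrow> c1 \<inter> c2 = {}"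
      proof (intro ballI impI)
        fix c1 c2 assume c: "c1 \<in> orbit ?HL \<phi> ` (E - Fix)" "c2 \<in> orbit ?HL \<phi> ` (E - Fix)" "c1 \<noteq> c2"
        have sub: "orbit ?HL \<phi> ` (E - Fix) \<subseteq> orbits ?HL E \<phi>" unfolding orbits_def by blast
        show "c1 \<inter> c2 = {}"
          using act.disjoint_union[OF subsetD[OF sub c(1)] subsetD[OF sub c(2)]] c(3) by (elim disjE) simp_all
      qed
    qed
    then show ?thesis by (simp only: union)
  qed
  ultimately show ?thesis unfolding E_def[symmetric] cong_def by (metis mod_add_right_eq dvd_imp_mod_0 add.right_neutral)
qed

section \<open>Towers\<close>

lemma tower_normal_subextension:
  "finite_normal_tower k K ks \<Longrightarrow> normal_subextension (ks i)"
  by (simp add: finite_normal_tower_def normal_subextension_def finite_subextension_def)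

lemma tower_mono: "finite_normal_tower k K ks \<Longrightarrow> i \<le> j \<Longrightarrow> ks i \<subseteq> ks j"
  using lift_Suc_mono_le[of ks i j] by (simp add: finite_normal_tower_def)

text \<open>A finite \<open>k\<close>-basis of \<open>M\<close> is reached at some stage of the
  tower, and with it all of \<open>M\<close>.\<close>

lemma tower_contains:
  assumes tower: "finite_normal_tower k K ks" and M: "finite_subextension M"
  obtains n where "M \<subseteq> ks n"
proof -
  obtain d w where w: "basis_of k M d w"
    using finite_field_extension_basis[of k M] M unfolding finite_subextension_def by blast
  have "\<forall>i\<in>{..<d}. \<exists>n. w i \<in> ks n"
  proof
    fix i assume "i \<in> {..<d}"
    then have "w i \<in> K" using basis_of_mem[OF w] finite_subextension_MK[OF M] by auto
    moreover have "(\<Union>n. ks n) = K" using tower by (simp add: finite_normal_tower_def)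
    ultimately show "\<exists>n. w i \<in> ks n" by blast
  qed
  from bchoice[OF this] obtain f where f: "\<And>i. i < d \<Longrightarrow> w i \<in> ks (f i)" by blast
  \<comment> \<open>The inserted 0 keeps the set nonempty, so that \<open>Max\<close> is meaningful
    in every case.\<close>
  define n where "n = Max (insert 0 (f ` {..<d}))"
  have wn: "w i \<in> ks n" if "i < d" for i
  proof -
    have "f i \<le> n" unfolding n_def using that by (intro Max_ge) auto
    then show ?thesis using f[OF that] tower_mono[OF tower] by blast
  qed
  have n: "finite_subextension (ks n)"
    using tower_normal_subextension[OF tower] by (simp add: normal_subextension_def)
  note c = number_field_closed_subfield[OF finite_subextension_number_field[OF n]]
  have "M \<subseteq> ks n"
  proof
    fix x assume "x \<in> M"
    then obtain a where a: "\<forall>i<d. a i \<in> k" "x = (\<Sum>i<d. a i * w i)" using basis_of_coords[OF w] by blast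
    have "a i * w i \<in> ks n" if "i < d" for i
      using a(1) that wn finite_subextension_kM[OF n] by (intro closed_subfield_mult[OF c]) auto
    then show "x \<in> ks n" unfolding a(2) by (intro closed_subfield_sum[OF c]) auto
  qed
  then show ?thesis by (rule that)
qed

abbreviation class_count :: "'a set \<Rightarrow> nat" where
  "class_count F \<equiv> card (non_p_part p (ideal_class_group F))"

text \<open>For the bound \<open>p ^ m\<close> only finitely many stabilizers occur, and each
  contains the fixer of some stage of the tower, so the largest of these stages serves for all. The
  congruence covers every normal field above this stage, also those of another tower; the comparison
  of two towers depends on that.\<close>

lemma tower_cong:
  assumes tower: "finite_normal_tower k K ks"
  obtains n where "\<And>L. normal_subextension L \<Longrightarrow> ks n \<subseteq> L \<Longrightarrow> [class_count L = class_count (ks n)] (mod p ^ m)"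
proof -
  define \<S> where "\<S> = {S. \<exists>c. small_stabilizer G (p ^ m) c S \<and> (\<exists>U\<in>fixer ` {M. finite_subextension M}. U \<subseteq> S)}"
  have fin: "finite \<S>" unfolding \<S>_def by (rule finite_stabilizers)
  have "\<forall>S\<in>\<S>. \<exists>n. fixer (ks n) \<subseteq> S"
  proof
    fix S assume "S \<in> \<S>"
    then obtain M where M: "finite_subextension M" "fixer M \<subseteq> S" by (auto simp: \<S>_def)
    then obtain n where "M \<subseteq> ks n" using tower_contains[OF tower] by blast
    then show "\<exists>n. fixer (ks n) \<subseteq> S" using fixer_antimono M(2) by blast
  qed
  from bchoice[OF this] obtain f where f: "\<And>S. S \<in> \<S> \<Longrightarrow> fixer (ks (f S)) \<subseteq> S" by blast
  define n where "n = Max (insert 0 (f ` \<S>))"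
  have n: "fixer (ks n) \<subseteq> S" if "S \<in> \<S>" for S
  proof -
    have "f S \<le> n" unfolding n_def using that fin by (intro Max_ge) auto
    then show ?thesis using f[OF that] fixer_antimono tower_mono[OF tower] by blast
  qed
  have "[class_count L = class_count (ks n)] (mod p ^ m)" if L: "normal_subextension L" "ks n \<subseteq> L" for L
  proof (rule card_non_p_part_cong[OF tower_normal_subextension[OF tower] L])
    fix S c M assume "small_stabilizer G (p ^ m) c S" "finite_subextension M" "fixer M \<subseteq> S"
    then have "S \<in> \<S>" by (auto simp: \<S>_def)
    then show "fixer (ks n) \<subseteq> S" by (rule n)
  qed
  then show ?thesis by (rule that)
qed

text \<open>The residues modulo each \<open>p ^ m\<close> become constant along the tower, and their
  final values are compatible because any two of them can be read off at a common stage.\<close>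

lemma tower_limit_exists:
  assumes tower: "finite_normal_tower k K ks"
  shows "\<exists>l. limitin (padic_topology p) (\<lambda>n. padic_of_nat p (class_count (ks n))) l sequentially"
proof -
  have "\<forall>m. \<exists>n. \<forall>i\<ge>n. class_count (ks i) mod p ^ m = class_count (ks n) mod p ^ m"
  proof
    fix m
    obtain n where n: "\<And>L. normal_subextension L \<Longrightarrow> ks n \<subseteq> L \<Longrightarrow> [class_count L = class_count (ks n)] (mod p ^ m)"
      using tower_cong[OF tower] by blast
    have "[class_count (ks i) = class_count (ks n)] (mod p ^ m)" if "n \<le> i" for i
      by (rule n[OF tower_normal_subextension[OF tower] tower_mono[OF tower that]])
    then show "\<exists>n. \<forall>i\<ge>n. class_count (ks i) mod p ^ m = class_count (ks n) mod p ^ m"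
      unfolding cong_def by blast
  qed
  from choice[OF this] obtain f
    where f: "\<And>m i. f m \<le> i \<Longrightarrow> class_count (ks i) mod p ^ m = class_count (ks (f m)) mod p ^ m" by blast
  define l where "l m = class_count (ks (f m)) mod p ^ m" for m
  have p: "p > 0" using prime_p by (rule prime_gt_0_nat)
  have "l \<in> padic_integers p"
    unfolding padic_integers_def
  proof (intro CollectI allI conjI)
    fix m
    show "l m < p ^ m" using p by (simp add: l_def)
    define i where "i = max (f m) (f (Suc m))"
    have "l (Suc m) mod p ^ m = class_count (ks i) mod p ^ Suc m mod p ^ m"
      using f[of "Suc m" i] by (simp add: l_def i_def)
    also have "\<dots> = class_count (ks i) mod p ^ m" by (rule mod_mod_cancel) simp
    also have "\<dots> = l m" using f[of m i] by (simp add: l_def i_def)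
    finally show "l (Suc m) mod p ^ m = l m" .
  qed
  moreover have "\<forall>\<^sub>F i in sequentially. class_count (ks i) mod p ^ m = l m" for m
    unfolding eventually_sequentially l_def using f by blast
  ultimately show ?thesis unfolding limitin_padic_topology_iff[OF p] by blast
qed

text \<open>Modulo \<open>p ^ m\<close>, a late stage \<open>ks n\<close> of the first tower decides
  both limits: it is contained in some stage of the second tower, and all normal fields above it
  have congruent counts.\<close>

lemma tower_limit_unique:
  assumes tower: "finite_normal_tower k K ks" and tower': "finite_normal_tower k K ks'"
    and l: "limitin (padic_topology p) (\<lambda>n. padic_of_nat p (class_count (ks n))) l sequentially"
    and l': "limitin (padic_topology p) (\<lambda>n. padic_of_nat p (class_count (ks' n))) l' sequentially"
  shows "l = l'"
proof
  fix m
  have p: "p > 0" using prime_p by (rule prime_gt_0_nat)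
  obtain N where N: "\<And>i. i \<ge> N \<Longrightarrow> class_count (ks i) mod p ^ m = l m"
    using l unfolding limitin_padic_topology_iff[OF p] eventually_sequentially by blast
  obtain N' where N': "\<And>i. i \<ge> N' \<Longrightarrow> class_count (ks' i) mod p ^ m = l' m"
    using l' unfolding limitin_padic_topology_iff[OF p] eventually_sequentially by blast
  obtain n where n: "\<And>L. normal_subextension L \<Longrightarrow> ks n \<subseteq> L \<Longrightarrow> [class_count L = class_count (ks n)] (mod p ^ m)"
    using tower_cong[OF tower] by blast
  obtain n' where n': "ks n \<subseteq> ks' n'"
    using tower_contains[OF tower', of "ks n"] tower_normal_subextension[OF tower]
    by (auto simp: normal_subextension_def)
  have "l m = class_count (ks (max N n)) mod p ^ m" using N by simp
  also have "\<dots> = class_count (ks n) mod p ^ m"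
    using n[OF tower_normal_subextension[OF tower], of "max N n"] tower_mono[OF tower, of n "max N n"]
    by (simp add: cong_def)
  also have "\<dots> = class_count (ks' (max N' n')) mod p ^ m"
    using n[OF tower_normal_subextension[OF tower'], of "max N' n'"] n' tower_mono[OF tower', of n' "max N' n'"]
    by (simp add: cong_def)
  also have "\<dots> = l' m" using N' by simp
  finally show "l m = l' m" .
qed

end

theorem theorem1:
  fixes p :: nat and k K :: "'a :: field_char_0 set"
  assumes "prime p"
    and "number_field k"
    and "pro_p_extension p k K"
    and "topologically_finitely_generated (galois_group k K) (krull_topology k K)"
  shows "(\<forall>ks. finite_normal_tower k K ks \<longrightarrow>
            (\<exists>L. limitin (padic_topology p)
                   (\<lambda>n. padic_of_nat p (card (non_p_part p (ideal_class_group (ks n)))))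
                   L sequentially)) \<and>
         (\<forall>ks ks' L L'. finite_normal_tower k K ks \<and> finite_normal_tower k K ks' \<and>
            limitin (padic_topology p)
              (\<lambda>n. padic_of_nat p (card (non_p_part p (ideal_class_group (ks n)))))
              L sequentially \<and>
            limitin (padic_topology p)
              (\<lambda>n. padic_of_nat p (card (non_p_part p (ideal_class_group (ks' n)))))
              L' sequentially \<longrightarrow>
            L = L')"
proof -
  interpret pro_p_setting p k K using assms by unfold_locales
  show ?thesis using tower_limit_exists tower_limit_unique by blast
qed

end
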